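(* Let $p$ be a prime and let $R$ be a finite extension of $\mathbb{Z}_p$ with inertia degree $f$ and ramification index $e$. Set $n=ef$. Then $$\zeta_{H(R)}^{\triangleleft}(s) = \zeta_{\mathbb{Z}_p^{2n}}(s)\; \frac{\sum_{w \in S_n} p^{- \mathrm{len}(w) + 2 f\left\lfloor\frac{\mathrm{len}^{[n-2]}(w)}{f}\right\rfloor s} \prod_{j \in \mathrm{Des}(w)} x_j }{\prod_{i = 0}^{n-1} (1 - x_i)},$$ where $x_i = p^{(2n+i)(n-i) - (3n-i)s}$ for $i\in\{0,1,\dots,n-1\}$.
   Context: A finite extension $R$ of $\mathbb{Z}_p$ means a compact discrete valuation ring of characteristic zero with residue characteristic $p$ (equivalently, the ring of integers of a finite extension of $\mathbb{Q}_p$). If $\mathfrak{m}$ is its maximal ideal, the inertia degree is $f=[R/\mathfrak{m}:\mathbb{F}_p]$ and the ramification index $e$ is given by $pR=\mathfrak{m}^e$; $R$ is a free $\mathbb{Z}_p$-module of rank $n=ef$. For a ring $\mathcal{R}$, the Heisenberg group $H(\mathcal{R})$ is the group of upper unitriangular $3\times 3$ matrices over $\mathcal{R}$. For a finitely generated profinite group $G$, the normal zeta function is $\zeta^{\triangleleft}_G(s)=\sum_{m=1}^\infty a^{\triangleleft}_m(G)m^{-s}$, where $a^{\triangleleft}_m(G)$ is the number of open normal subgroups of $G$ of index $m$ and $s$ is a complex variable (with sufficiently large real part). Also, $\zeta_{\mathbb{Z}_p^{2n}}(s)=\prod_{i=0}^{2n-1}(1-p^{i-s})^{-1}$, which is the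 (normal) zeta function of the group $\mathbb{Z}_p^{2n}$. Statistics on the symmetric group $S_n$ (permutations of $\{1,\dots,n\}$, with Coxeter generators the adjacent transpositions $s_i=(i\ \,i+1)$): $\mathrm{len}$ is the Coxeter length (number of inversions); $\mathrm{Des}(w)=\{i\in\{1,\dots,n-1\} : w(i+1)<w(i)\}$ is the right descent set; and $\mathrm{len}^{[n-2]}$ is the parabolic length function, i.e. $\mathrm{len}^{[n-2]}(w)$ is the length of the unique shortest element of the coset $wW$, where $W=\langle s_1,\dots,s_{n-2}\rangle$; explicitly $\mathrm{len}^{[n-2]}(w)=n-w(n)$. *)

theory Defs
  imports "HOL-Analysis.Analysis" "HOL-Algebra.Algebra"
begin

section \<open>Finite extensions of the ring of p-adic integers\<close>

text \<open>The natural numbers k with k . 1 = 0 are the multiples of the characteristic; their gcd is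
  therefore the characteristic, and it is 0 if only k = 0 occurs.\<close>

definition ring_char :: "('a, 'b) ring_scheme \<Rightarrow> nat" where
  "ring_char R = Gcd {k :: nat. [k] \<cdot>\<^bsub>R\<^esub> \<one>\<^bsub>R\<^esub> = \<zero>\<^bsub>R\<^esub>}"

definition discrete_valuation_ring :: "('a, 'b) ring_scheme \<Rightarrow> bool" where
  "discrete_valuation_ring R \<longleftrightarrow>
     principal_domain R \<and> \<not> field R \<and> (\<exists>!M. maximalideal M R)"

definition max_ideal :: "('a, 'b) ring_scheme \<Rightarrow> 'a set" where
  "max_ideal R = (THE M. maximalideal M R)"

text \<open>Ideal powers are taken in the library's semiring of ideals; the zeroth power is the
  whole ring.\<close>

definition ideal_power :: "('a, 'b) ring_scheme \<Rightarrow> 'a set \<Rightarrow> nat \<Rightarrow> 'a set" where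
  "ideal_power R I k = I [^]\<^bsub>ideals_set R\<^esub> k"

definition adic_topology :: "('a, 'b) ring_scheme \<Rightarrow> 'a set \<Rightarrow> 'a topology" where
  "adic_topology R I =
     topology_generated_by {ideal_power R I k +>\<^bsub>R\<^esub> a | k a. a \<in> carrier R}"

definition finite_extension_Zp :: "nat \<Rightarrow> ('a, 'b) ring_scheme \<Rightarrow> bool" where
  "finite_extension_Zp p R \<longleftrightarrow>
     discrete_valuation_ring R \<and>
     compact_space (adic_topology R (max_ideal R)) \<and>
     ring_char R = 0 \<and>
     ring_char (R Quot max_ideal R) = p"

text \<open>The prime subfield of the residue field is the subfield generated by the empty set.\<close>

definition has_inertia_degree :: "('a, 'b) ring_scheme \<Rightarrow> nat \<Rightarrow> bool" where
  "has_inertia_degree R f \<longleftrightarrow>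
     ring.dimension (R Quot max_ideal R) f
       (generate_field (R Quot max_ideal R) {}) (carrier (R Quot max_ideal R))"

definition has_ramification_index :: "nat \<Rightarrow> ('a, 'b) ring_scheme \<Rightarrow> nat \<Rightarrow> bool" where
  "has_ramification_index p R e \<longleftrightarrow>
     PIdl\<^bsub>R\<^esub> ([p] \<cdot>\<^bsub>R\<^esub> \<one>\<^bsub>R\<^esub>) = ideal_power R (max_ideal R) e"


section \<open>The Heisenberg group\<close>

text \<open>A 3 x 3 matrix is a function on index pairs, extensional on \<open>idx3\<close> (\<open>undefined\<close> elsewhere),
  so that the matrices are exactly the points of the product space over \<open>idx3\<close>.\<close>

definition idx3 :: "(nat \<times> nat) set" where
  "idx3 = {1..3} \<times> {1..3}"

definition heisenberg :: "('a, 'b) ring_scheme \<Rightarrow> (nat \<times> nat \<Rightarrow> 'a) monoid" where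
  "heisenberg R =
     \<lparr>carrier = {A \<in> idx3 \<rightarrow>\<^sub>E carrier R.
                  (\<forall>i \<in> {1..3}. A (i, i) = \<one>\<^bsub>R\<^esub>) \<and>
                  (\<forall>i \<in> {1..3}. \<forall>j \<in> {1..3}. j < i \<longrightarrow> A (i, j) = \<zero>\<^bsub>R\<^esub>)},
      mult = (\<lambda>A B. \<lambda>(i, j) \<in> idx3. (\<Oplus>\<^bsub>R\<^esub> k \<in> {1..3}. A (i, k) \<otimes>\<^bsub>R\<^esub> B (k, j))),
      one = (\<lambda>(i, j) \<in> idx3. if i = j then \<one>\<^bsub>R\<^esub> else \<zero>\<^bsub>R\<^esub>)\<rparr>"

definition heisenberg_topology :: "('a, 'b) ring_scheme \<Rightarrow> (nat \<times> nat \<Rightarrow> 'a) topology" where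
  "heisenberg_topology R =
     subtopology (product_topology (\<lambda>_. adic_topology R (max_ideal R)) idx3)
       (carrier (heisenberg R))"


section \<open>Normal zeta functions\<close>

definition num_open_normal :: "('g, 'h) monoid_scheme \<Rightarrow> 'g topology \<Rightarrow> nat \<Rightarrow> nat" where
  "num_open_normal G T m = card {N. N \<lhd> G \<and> openin T N \<and> card (rcosets\<^bsub>G\<^esub> N) = m}"

text \<open>The Dirichlet series starts at index 1, hence the shift by \<open>Suc\<close>.\<close>

definition normal_zeta_term ::
    "('g, 'h) monoid_scheme \<Rightarrow> 'g topology \<Rightarrow> complex \<Rightarrow> nat \<Rightarrow> complex" where
  "normal_zeta_term G T s k = of_nat (num_open_normal G T (Suc k)) * of_nat (Suc k) powr (- s)"

definition normal_zeta :: "('g, 'h) monoid_scheme \<Rightarrow> 'g topology \<Rightarrow> complex \<Rightarrow> complex" where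
  "normal_zeta G T s = suminf (normal_zeta_term G T s)"

definition zeta_Zp_power :: "nat \<Rightarrow> nat \<Rightarrow> complex \<Rightarrow> complex" where
  "zeta_Zp_power p d s = (\<Prod>i<d. inverse (1 - of_nat p powr (of_nat i - s)))"


section \<open>Statistics on the symmetric group\<close>

definition perm_length :: "nat \<Rightarrow> (nat \<Rightarrow> nat) \<Rightarrow> nat" where
  "perm_length n w = card {(i, j). i \<in> {1..n} \<and> j \<in> {1..n} \<and> i < j \<and> w j < w i}"

definition descents :: "nat \<Rightarrow> (nat \<Rightarrow> nat) \<Rightarrow> nat set" where
  "descents n w = {i \<in> {1..n - 1}. w (i + 1) < w i}"

definition standard_parabolic :: "nat \<Rightarrow> nat \<Rightarrow> (nat \<Rightarrow> nat) set" where
  "standard_parabolic n k = generate (sym_group n) {Transposition.transpose i (i + 1) | i. i \<in> {1..k}}"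

text \<open>Multiplication in \<open>sym_group\<close> is composition of functions, right factor first, so the
  left coset of w consists of the rearrangements of the word w(1), ..., w(n) in its first
  k + 1 places.\<close>

definition parabolic_length :: "nat \<Rightarrow> nat \<Rightarrow> (nat \<Rightarrow> nat) \<Rightarrow> nat" where
  "parabolic_length n k w =
     Min (perm_length n ` (w <#\<^bsub>sym_group n\<^esub> standard_parabolic n k))"

end

theory Submission
  imports Defs
begin

text \<open>
  The centre of the Heisenberg group \<open>H\<close> of \<open>R\<close> is a copy of the additive group of \<open>R\<close>, and the
  quotient by it is \<open>R \<times> R\<close>. An open normal subgroup \<open>N\<close> therefore has two shadows: its
  projection \<open>M1\<close> to \<open>R \<times> R\<close> and its central part \<open>M2\<close> in \<open>R\<close>. Both are lattices, that is,
  open additive subgroups, and the index of \<open>N\<close> is the product of their indices. Elements over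
  \<open>(a, b)\<close> and \<open>(a', b')\<close> have the central commutator \<open>a b' - a' b\<close>, so \<open>N\<close> is normal iff \<open>M1 \<subseteq> I \<times> I\<close>, where \<open>I\<close> is the largest ideal of \<open>R\<close> inside
  \<open>M2\<close> (\<open>normal_iff_proj\<close>). Over each such pair of lattices there are exactly \<open>[R : M2] ^ (2 n)\<close>
  subgroups (\<open>card_subgroups_over\<close>): \<open>M2\<close> is joined to \<open>R\<close> by a chain of subgroups with steps of
  index \<open>p\<close>, and at each step one counts the complements of a subgroup of order \<open>p\<close>.

  If \<open>I = \<pi> ^ k R\<close>, then \<open>M1\<close> is \<open>\<pi> ^ k M\<close> for an arbitrary lattice \<open>M\<close> in \<open>R \<times> R\<close>, and the index of
  \<open>M1\<close> is \<open>p ^ (2 f k)\<close> times that of \<open>M\<close>. The zeta function is therefore the product of the sum of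
  \<open>[R \<times> R : M] ^ (- s)\<close> over \<open>M\<close> and the sum of \<open>[R : M2] ^ (2 n - s) p ^ (- 2 f k s)\<close> over \<open>M2\<close>.

  Both sums are reduced to combinatorics by a filtration \<open>L 0 \<supset> L 1 \<supset> \<dots>\<close> of \<open>R\<close> with steps of index
  \<open>p\<close> such that \<open>L (i + n) = p L i\<close> and \<open>L (f k) = \<pi> ^ k R\<close>. A gap of a lattice \<open>M\<close> is a position \<open>i\<close>
  with \<open>M \<inter> L i \<subseteq> L (i + 1)\<close>. The number of gaps determines the index and the largest gap determines
  \<open>k\<close>; the number of lattices with a given set of gaps is a power of \<open>p\<close> that depends on the set alone
  (\<open>card_lattices_with_gaps\<close>). The possible gap sets are the finite sets that contain \<open>i\<close> with
  \<open>i + n\<close>: the flush configurations of an abacus with \<open>n\<close> runners, or lists of \<open>n\<close> natural numbers. All this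
  applies to \<open>R \<times> R\<close> with \<open>2 n\<close> in place of \<open>n\<close>.

  For the first sum, pushing every bead one position further and adding one bead rotates the list
  and keeps its weight; every list arises in a unique way by rotations from a list that starts
  with \<open>0\<close>, and this splits off one factor of the zeta function of \<open>\<int>\<^sub>p ^ (2 n)\<close> at a time
  (\<open>has_sum_inv_weight\<close>). For the second sum, the first free positions of the runners are sorted. The
  order in which the runners occur is a permutation \<open>w\<close>, and the lengths of the runners increase along
  this order by arbitrary natural numbers, positive ones at the descents of \<open>w\<close>. The last of these
  positions lies on the runner \<open>w(n)\<close>, which brings in \<open>n - w(n)\<close>, the parabolic length of
  \<open>w\<close>. Summation over the increments yields the geometric series \<open>1 / (1 - x\<^sub>i)\<close>, and the descents
  yield the factors \<open>x\<^sub>j\<close> (\<open>has_sum_permutation_formula\<close>).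
\<close>

section \<open>Relative indices of subgroups\<close>

text \<open>The index is taken inside an ambient group, so that indices in a tower of subgroups of one group
  can be compared without passing to subgroups as groups of their own. It is \<open>0\<close> if infinite.\<close>

definition rel_index :: "('a, 'b) monoid_scheme \<Rightarrow> 'a set \<Rightarrow> 'a set \<Rightarrow> nat" where
  "rel_index G A B = card ((\<lambda>a. B #>\<^bsub>G\<^esub> a) ` A)"

context group
begin

lemma r_coset_eq_iff:
  assumes "subgroup B G" "a \<in> carrier G" "b \<in> carrier G"
  shows "B #> a = B #> b \<longleftrightarrow> a \<otimes> inv b \<in> B"
proof
  assume "B #> a = B #> b"
  then show "a \<otimes> inv b \<in> B"
    by (metis assms subgroup.rcos_module_imp[OF assms(1)] is_group rcos_self)
next
  assume "a \<otimes> inv b \<in> B"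
  then have "a \<in> B #> b"
    using assms subgroup.rcos_module_rev[OF assms(1) is_group] by blast
  then show "B #> a = B #> b"
    using repr_independence assms by metis
qed

lemma r_coset_mult_subgroup:
  assumes "subgroup B G" "b \<in> B" "a \<in> carrier G"
  shows "B #> (b \<otimes> a) = B #> a"
  using assms by (metis coset_assoc coset_mult_assoc coset_join2 subgroup.mem_carrier subgroup.subset)

lemma rel_index_refl:
  assumes "subgroup A G"
  shows "rel_index G A A = 1"
proof -
  have "(\<lambda>a. A #> a) ` A = {A}"
    using assms coset_join2 subgroup.mem_carrier[OF assms] subgroup.one_closed[OF assms]
    by (auto simp: image_iff)
  then show ?thesis by (simp add: rel_index_def)
qed

text \<open>A coset of \<open>C\<close> in \<open>A\<close> is \<open>C b a\<close> with \<open>a\<close> the chosen representative of a coset of \<open>B\<close> and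
  \<open>C b\<close> a coset of \<open>C\<close> in \<open>B\<close>.\<close>

lemma rel_index_trans:
  assumes A: "subgroup A G" and B: "subgroup B G" and C: "subgroup C G"
    and "C \<subseteq> B" "B \<subseteq> A"
  shows "rel_index G A C = rel_index G A B * rel_index G B C"
proof -
  define rep where "rep = (\<lambda>V. SOME a. a \<in> A \<and> B #> a = V)"
  have rep: "rep V \<in> A" "B #> rep V = V" if V: "V \<in> (\<lambda>a. B #> a) ` A" for V
  proof -
    have "\<exists>a. a \<in> A \<and> B #> a = V" using V by auto
    from someI_ex[OF this] show "rep V \<in> A" "B #> rep V = V" by (auto simp: rep_def)
  qed
  have Ac: "a \<in> A \<Longrightarrow> a \<in> carrier G" for a using subgroup.mem_carrier[OF A] .
  have Bc: "a \<in> B \<Longrightarrow> a \<in> carrier G" for a using subgroup.mem_carrier[OF B] .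
  have inj: "V = V' \<and> Y = Y'"
    if V: "V \<in> (\<lambda>a. B #> a) ` A" and V': "V' \<in> (\<lambda>a. B #> a) ` A"
     and Y: "Y \<in> (\<lambda>a. C #> a) ` B" and Y': "Y' \<in> (\<lambda>a. C #> a) ` B"
     and eq: "Y #> rep V = Y' #> rep V'" for V V' Y Y'
  proof -
    obtain b where b: "b \<in> B" "Y = C #> b" using Y by auto
    obtain b' where b': "b' \<in> B" "Y' = C #> b'" using Y' by auto
    note r = rep[OF V] and r' = rep[OF V']
    have "C #> (b \<otimes> rep V) = C #> (b' \<otimes> rep V')"
      using eq b b' r r' Ac Bc by (simp add: coset_mult_assoc subgroup.subset[OF C])
    then have m: "(b \<otimes> rep V) \<otimes> inv (b' \<otimes> rep V') \<in> C"
      using r_coset_eq_iff[OF C, of "b \<otimes> rep V" "b' \<otimes> rep V'"] b b' r r' Ac Bc by simp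
    have mB: "(b \<otimes> rep V) \<otimes> inv (b' \<otimes> rep V') \<in> B" using m assms by auto
    have "B #> (b \<otimes> rep V) = B #> (b' \<otimes> rep V')"
      using r_coset_eq_iff[OF B, of "b \<otimes> rep V" "b' \<otimes> rep V'"] b b' r r' Ac Bc mB by simp
    then have XX: "V = V'"
      using r_coset_mult_subgroup[OF B] b b' r r' Ac by simp
    then have "(b \<otimes> rep V) \<otimes> inv (b' \<otimes> rep V) \<in> C" using m by simp
    moreover have "(b \<otimes> rep V) \<otimes> inv (b' \<otimes> rep V) = b \<otimes> inv b'"
      using b b' r Ac Bc by (simp add: inv_mult_group m_assoc) (simp add: m_assoc[symmetric])
    ultimately have "Y = Y'" using r_coset_eq_iff[OF C, of b b'] b b' Bc by simp
    with XX show ?thesis by simp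
  qed
  have "bij_betw (\<lambda>(V, Y). Y #> rep V) (((\<lambda>a. B #> a) ` A) \<times> ((\<lambda>a. C #> a) ` B)) ((\<lambda>a. C #> a) ` A)"
    unfolding bij_betw_def
  proof
    show "inj_on (\<lambda>(V, Y). Y #> rep V) (((\<lambda>a. B #> a) ` A) \<times> ((\<lambda>a. C #> a) ` B))"
    proof (rule inj_onI)
      fix u v
      assume u: "u \<in> (\<lambda>a. B #> a) ` A \<times> (\<lambda>a. C #> a) ` B"
        and v: "v \<in> (\<lambda>a. B #> a) ` A \<times> (\<lambda>a. C #> a) ` B"
        and eq: "(\<lambda>(V, Y). Y #> rep V) u = (\<lambda>(V, Y). Y #> rep V) v"
      have "fst u = fst v \<and> snd u = snd v"
        by (rule inj) (use u v eq in \<open>simp_all add: mem_Times_iff case_prod_beta del: image_iff\<close>)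
      then show "u = v" by (simp add: prod_eq_iff)
    qed
    show "(\<lambda>(V, Y). Y #> rep V) ` (((\<lambda>a. B #> a) ` A) \<times> ((\<lambda>a. C #> a) ` B)) = (\<lambda>a. C #> a) ` A"
    proof (intro equalityI subsetI)
      fix S assume "S \<in> (\<lambda>(V, Y). Y #> rep V) ` (((\<lambda>a. B #> a) ` A) \<times> ((\<lambda>a. C #> a) ` B))"
      then obtain V b where V: "V \<in> (\<lambda>a. B #> a) ` A" and b: "b \<in> B" and S: "S = (C #> b) #> rep V"
        by auto
      have "S = C #> (b \<otimes> rep V)"
        using S b rep[OF V] Ac Bc by (simp add: coset_mult_assoc subgroup.subset[OF C])
      moreover have "b \<otimes> rep V \<in> A" using b rep[OF V] assms subgroup.m_closed[OF A] by auto
      ultimately show "S \<in> (\<lambda>a. C #> a) ` A" by auto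
    next
      fix S assume "S \<in> (\<lambda>a. C #> a) ` A"
      then obtain a where a: "a \<in> A" "S = C #> a" by auto
      let ?V = "B #> a"
      have V: "?V \<in> (\<lambda>a. B #> a) ` A" using a by auto
      have b: "a \<otimes> inv (rep ?V) \<in> B"
        using rep[OF V] a Ac r_coset_eq_iff[OF B, of a "rep ?V"] by auto
      have "(C #> (a \<otimes> inv (rep ?V))) #> rep ?V = C #> a"
        using rep[OF V] a Ac by (simp add: coset_mult_assoc subgroup.subset[OF C] m_assoc)
      then have "S = (\<lambda>(V, Y). Y #> rep V) (?V, C #> (a \<otimes> inv (rep ?V)))" using a by simp
      then show "S \<in> (\<lambda>(V, Y). Y #> rep V) ` (((\<lambda>a. B #> a) ` A) \<times> ((\<lambda>a. C #> a) ` B))"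
        using V b by blast
    qed
  qed
  from bij_betw_same_card[OF this] show ?thesis
    by (simp add: rel_index_def card_cartesian_product)
qed

text \<open>Every coset of \<open>B\<close> in \<open>B D\<close> has a representative in \<open>D\<close>, unique up to \<open>B \<inter> D\<close>.\<close>

lemma rel_index_second_iso:
  assumes B: "subgroup B G" and D: "subgroup D G"
  shows "rel_index G (B <#> D) B = rel_index G D (B \<inter> D)"
proof -
  have BD: "subgroup (B \<inter> D) G" using subgroups_Inter_pair[OF B D] .
  have Dc: "a \<in> D \<Longrightarrow> a \<in> carrier G" for a using subgroup.mem_carrier[OF D] .
  have im: "(\<lambda>a. B #> a) ` (B <#> D) = (\<lambda>a. B #> a) ` D"
  proof (intro equalityI subsetI)
    fix S assume "S \<in> (\<lambda>a. B #> a) ` (B <#> D)"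
    then obtain b d where "b \<in> B" "d \<in> D" "S = B #> (b \<otimes> d)"
      by (auto simp: set_mult_def)
    then show "S \<in> (\<lambda>a. B #> a) ` D" using r_coset_mult_subgroup[OF B] Dc by auto
  next
    fix S assume "S \<in> (\<lambda>a. B #> a) ` D"
    then obtain d where "d \<in> D" "S = B #> d" by auto
    moreover have "d = \<one> \<otimes> d" using Dc[OF \<open>d \<in> D\<close>] by simp
    ultimately show "S \<in> (\<lambda>a. B #> a) ` (B <#> D)"
      using subgroup.one_closed[OF B] unfolding set_mult_def by blast
  qed
  define h where "h = (\<lambda>V. B #> (SOME d. d \<in> D \<and> (B \<inter> D) #> d = V))"
  have h: "h ((B \<inter> D) #> d) = B #> d" if d: "d \<in> D" for d
  proof -
    let ?d = "SOME d'. d' \<in> D \<and> (B \<inter> D) #> d' = (B \<inter> D) #> d"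
    have "?d \<in> D \<and> (B \<inter> D) #> ?d = (B \<inter> D) #> d"
      by (rule someI[of _ d]) (use d in auto)
    then have "?d \<in> D" "?d \<otimes> inv d \<in> B"
      using r_coset_eq_iff[OF BD, of ?d d] d Dc by auto
    then show ?thesis using r_coset_eq_iff[OF B, of ?d d] d Dc by (simp add: h_def)
  qed
  have "bij_betw h ((\<lambda>a. (B \<inter> D) #> a) ` D) ((\<lambda>a. B #> a) ` D)"
    unfolding bij_betw_def
  proof
    show "inj_on h ((\<lambda>a. (B \<inter> D) #> a) ` D)"
    proof (rule inj_onI)
      fix V Y assume "V \<in> (\<lambda>a. (B \<inter> D) #> a) ` D" "Y \<in> (\<lambda>a. (B \<inter> D) #> a) ` D" and eq: "h V = h Y"
      then obtain x y where x: "x \<in> D" "V = (B \<inter> D) #> x" and y: "y \<in> D" "Y = (B \<inter> D) #> y" by auto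
      then have "x \<otimes> inv y \<in> B" using eq h r_coset_eq_iff[OF B, of x y] Dc by auto
      moreover have "x \<otimes> inv y \<in> D" using x y subgroup.m_closed[OF D] subgroup.m_inv_closed[OF D] by auto
      ultimately show "V = Y" using r_coset_eq_iff[OF BD, of x y] x y Dc by auto
    qed
    show "h ` (\<lambda>a. (B \<inter> D) #> a) ` D = (\<lambda>a. B #> a) ` D"
      using h by (simp add: image_image cong: image_cong)
  qed
  from bij_betw_same_card[OF this] show ?thesis by (simp add: rel_index_def im)
qed

end

lemma (in group_hom) rel_index_image:
  assumes A: "subgroup A G" and B: "subgroup B G" and "B \<subseteq> A" and ker: "kernel G H h \<subseteq> B"
  shows "rel_index H (h ` A) (h ` B) = rel_index G A B"
proof -
  have hB: "subgroup (h ` B) H" using subgroup_img_is_subgroup[OF B] .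
  have Ac: "a \<in> A \<Longrightarrow> a \<in> carrier G" for a using subgroup.mem_carrier[OF A] .
  have Bc: "a \<in> B \<Longrightarrow> a \<in> carrier G" for a using subgroup.mem_carrier[OF B] .
  have img: "h ` (B #> a) = h ` B #>\<^bsub>H\<^esub> h a" if "a \<in> A" for a
    using that Ac Bc by (auto simp: r_coset_def image_iff)
  have inB: "x \<in> B" if xc: "x \<in> carrier G" and hx: "h x \<in> h ` B" for x
  proof -
    obtain b where b: "b \<in> B" "h x = h b" using hx by (elim imageE) blast
    have "x \<otimes> inv b \<in> kernel G H h" using b that Bc by (simp add: kernel_def)
    then have "x \<otimes> inv b \<otimes> b \<in> B" using ker b subgroup.m_closed[OF B] by auto
    then show ?thesis using that b Bc by (simp add: G.m_assoc)
  qed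
  have "bij_betw ((`) h) ((\<lambda>a. B #> a) ` A) ((\<lambda>a. h ` B #>\<^bsub>H\<^esub> a) ` (h ` A))"
    unfolding bij_betw_def
  proof
    show "inj_on ((`) h) ((\<lambda>a. B #> a) ` A)"
    proof (rule inj_onI)
      fix V Y assume "V \<in> (\<lambda>a. B #> a) ` A" "Y \<in> (\<lambda>a. B #> a) ` A" and eq: "h ` V = h ` Y"
      then obtain x y where x: "x \<in> A" "V = B #> x" and y: "y \<in> A" "Y = B #> y" by auto
      then have "h ` B #>\<^bsub>H\<^esub> h x = h ` B #>\<^bsub>H\<^esub> h y" using eq img by simp
      then have "h (x \<otimes> inv y) \<in> h ` B"
        using H.r_coset_eq_iff[OF hB, of "h x" "h y"] x y Ac by simp
      then show "V = Y" using inB[of "x \<otimes> inv y"] x y Ac G.r_coset_eq_iff[OF B, of x y] by simp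
    qed
    show "(`) h ` (\<lambda>a. B #> a) ` A = (\<lambda>a. h ` B #>\<^bsub>H\<^esub> a) ` h ` A"
      using img by (simp add: image_image cong: image_cong)
  qed
  from bij_betw_same_card[OF this] show ?thesis by (simp add: rel_index_def)
qed

section \<open>Complements of a subgroup of order p\<close>

text \<open>This is the statement that \<open>A\<close> is abelian modulo \<open>E\<close>, expressed without forming a quotient.\<close>

definition commutators_in :: "('a, 'b) monoid_scheme \<Rightarrow> 'a set \<Rightarrow> 'a set \<Rightarrow> bool" where
  "commutators_in G A E \<longleftrightarrow> (\<forall>a\<in>A. \<forall>b\<in>A. a \<otimes>\<^bsub>G\<^esub> b \<otimes>\<^bsub>G\<^esub> inv\<^bsub>G\<^esub> a \<otimes>\<^bsub>G\<^esub> inv\<^bsub>G\<^esub> b \<in> E)"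

context group
begin

lemma normal_if_commutators_in:
  assumes "subgroup E G" "commutators_in G (carrier G) E"
  shows "E \<lhd> G"
proof (rule normal_invI[OF assms(1)])
  fix x h assume x: "x \<in> carrier G" and h: "h \<in> E"
  have hc: "h \<in> carrier G" using subgroup.mem_carrier[OF assms(1) h] .
  have "(x \<otimes> h \<otimes> inv x \<otimes> inv h) \<otimes> h \<in> E"
    using assms x h hc subgroup.m_closed[OF assms(1)] by (auto simp: commutators_in_def)
  then show "x \<otimes> h \<otimes> inv x \<in> E" using x hc by (simp add: m_assoc)
qed

lemma commutators_in_mono:
  "commutators_in G A E \<Longrightarrow> E \<subseteq> E' \<Longrightarrow> A' \<subseteq> A \<Longrightarrow> commutators_in G A' E'"
  unfolding commutators_in_def by blast

lemma set_mult_normal_subgroup: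
  assumes N: "N \<lhd> G" and H: "subgroup H G"
  shows "subgroup (N <#> H) G"
proof -
  have Ns: "subgroup N G" using N by (simp add: normal_imp_subgroup)
  have Nc: "a \<in> N \<Longrightarrow> a \<in> carrier G" for a using subgroup.mem_carrier[OF Ns] .
  have Hc: "a \<in> H \<Longrightarrow> a \<in> carrier G" for a using subgroup.mem_carrier[OF H] .
  have conj: "x \<otimes> h \<otimes> inv x \<in> N" if "x \<in> carrier G" "h \<in> N" for x h
    using N that by (simp add: normal_inv_iff)
  show ?thesis
  proof (rule subgroupI)
    show "N <#> H \<subseteq> carrier G" using Nc Hc by (auto simp: set_mult_def)
    show "N <#> H \<noteq> {}" using subgroup.one_closed[OF Ns] subgroup.one_closed[OF H]
      by (auto simp: set_mult_def)
  next
    fix a assume "a \<in> N <#> H"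
    then obtain n h where a: "n \<in> N" "h \<in> H" "a = n \<otimes> h" by (auto simp: set_mult_def)
    have "inv a = (inv h \<otimes> inv n \<otimes> inv (inv h)) \<otimes> inv h"
      using a Nc Hc by (simp add: inv_mult_group m_assoc)
    moreover have "inv h \<otimes> inv n \<otimes> inv (inv h) \<in> N"
      by (rule conj) (use a Hc subgroup.m_inv_closed[OF Ns] in auto)
    ultimately show "inv a \<in> N <#> H"
      using subgroup.m_inv_closed[OF H a(2)] unfolding set_mult_def by blast
  next
    fix a b assume "a \<in> N <#> H" "b \<in> N <#> H"
    then obtain n h n' h' where a: "n \<in> N" "h \<in> H" "a = n \<otimes> h"
      and b: "n' \<in> N" "h' \<in> H" "b = n' \<otimes> h'" by (auto simp: set_mult_def)
    have "a \<otimes> b = (n \<otimes> (h \<otimes> n' \<otimes> inv h)) \<otimes> (h \<otimes> h')"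
      using a b Nc Hc by (simp add: m_assoc) (simp add: m_assoc[symmetric])
    moreover have "h \<otimes> n' \<otimes> inv h \<in> N" by (rule conj) (use a b Hc in auto)
    then have "n \<otimes> (h \<otimes> n' \<otimes> inv h) \<in> N" using a subgroup.m_closed[OF Ns] by auto
    ultimately show "a \<otimes> b \<in> N <#> H"
      using subgroup.m_closed[OF H a(2) b(2)] unfolding set_mult_def by blast
  qed
qed

lemma set_mult_superset:
  assumes "subgroup B G" "subgroup D G"
  shows "B \<subseteq> B <#> D" "D \<subseteq> B <#> D"
proof -
  show "B \<subseteq> B <#> D"
  proof
    fix b assume "b \<in> B"
    moreover then have "b = b \<otimes> \<one>" using subgroup.mem_carrier[OF assms(1)] by simp
    ultimately show "b \<in> B <#> D" using subgroup.one_closed[OF assms(2)] unfolding set_mult_def by blast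
  qed
  show "D \<subseteq> B <#> D"
  proof
    fix b assume "b \<in> D"
    moreover then have "b = \<one> \<otimes> b" using subgroup.mem_carrier[OF assms(2)] by simp
    ultimately show "b \<in> B <#> D" using subgroup.one_closed[OF assms(1)] unfolding set_mult_def by blast
  qed
qed

lemma set_mult_least:
  assumes "subgroup C G" "B \<subseteq> C" "D \<subseteq> C"
  shows "B <#> D \<subseteq> C"
  using assms subgroup.m_closed[OF assms(1)] by (auto simp: set_mult_def)

lemma subgroup_nat_pow_closed:
  assumes "subgroup H G" "h \<in> H"
  shows "h [^] (k :: nat) \<in> H"
  using subgroup_int_pow_closed[OF assms, of "int k"] by (simp add: int_pow_int)

text \<open>The exponents that bring \<open>v\<close> into \<open>D\<close> are closed under integer combinations, so they
  contain \<open>1\<close> as soon as one of them is coprime to \<open>p\<close>.\<close>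

lemma int_pow_mem_prime:
  assumes D: "subgroup D G" and v: "v \<in> carrier G" "v \<notin> D" and p: "Factorial_Ring.prime (p::nat)"
    and vp: "v [^] p \<in> D" and vk: "v [^] (k::int) \<in> D"
  shows "int p dvd k"
proof (rule ccontr)
  assume "\<not> int p dvd k"
  moreover have "Factorial_Ring.prime (int p)" using p by simp
  ultimately have "coprime (int p) k" using prime_imp_coprime by blast
  then obtain x y where xy: "x * int p + y * k = 1"
    using bezout_int[of "int p" k] by (auto simp: coprime_iff_gcd_eq_1)
  have "v = v [^] (int p * x + k * y)" using xy v by (simp add: mult.commute)
  also have "\<dots> = (v [^] int p) [^] x \<otimes> (v [^] k) [^] y"
    using v by (simp add: int_pow_mult int_pow_pow)
  also have "\<dots> \<in> D"
    using vp vk subgroup_int_pow_closed[OF D] subgroup.m_closed[OF D] by (simp add: int_pow_int)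
  finally show False using v by simp
qed

lemma rel_index_cyclic_extension:
  assumes F: "F \<lhd> G" and v: "v \<in> carrier G" "v \<notin> F" and p: "Factorial_Ring.prime (p::nat)"
    and vp: "v [^] p \<in> F"
  shows "rel_index G (F <#> generate G {v}) F = p"
proof -
  have Fs: "subgroup F G" using F by (simp add: normal_imp_subgroup)
  have p0: "p > 0" using p by (simp add: prime_gt_0_nat)
  have gv: "subgroup (generate G {v}) G" using v by (intro generate_is_subgroup) auto
  have red: "F #> (v [^] (k::int)) = F #> (v [^] nat (k mod int p))" for k
  proof -
    have "v [^] k = v [^] (int p * (k div int p) + k mod int p)" by simp
    also have "\<dots> = (v [^] int p) [^] (k div int p) \<otimes> v [^] (k mod int p)"
      using v by (simp only: int_pow_mult int_pow_pow)
    also have "v [^] (k mod int p) = v [^] nat (k mod int p)"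
      using p0 by (metis int_pow_int nat_0_le pos_mod_sign of_nat_0_less_iff)
    finally have "v [^] k = (v [^] int p) [^] (k div int p) \<otimes> v [^] nat (k mod int p)" .
    moreover have "(v [^] int p) [^] (k div int p) \<in> F"
      using vp subgroup_int_pow_closed[OF Fs] by (simp add: int_pow_int)
    ultimately show ?thesis using r_coset_mult_subgroup[OF Fs] v by simp
  qed
  have im: "(\<lambda>a. F #> a) ` (F <#> generate G {v}) = (\<lambda>i. F #> (v [^] (i::nat))) ` {..<p}"
  proof (intro equalityI subsetI)
    fix S assume "S \<in> (\<lambda>a. F #> a) ` (F <#> generate G {v})"
    then obtain f k where "f \<in> F" "S = F #> (f \<otimes> v [^] (k::int))"
      unfolding generate_pow[OF v(1)] by (auto simp: set_mult_def)
    then have "S = F #> (v [^] nat (k mod int p))"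
      using r_coset_mult_subgroup[OF Fs] v red by simp
    moreover have "nat (k mod int p) < p" using p0 by (simp add: nat_less_iff)
    ultimately show "S \<in> (\<lambda>i. F #> (v [^] (i::nat))) ` {..<p}"
      by (intro image_eqI[where x = "nat (k mod int p)"]) auto
  next
    fix S assume "S \<in> (\<lambda>i. F #> (v [^] (i::nat))) ` {..<p}"
    then obtain i :: nat where "S = F #> (v [^] i)" by auto
    moreover have "v [^] i \<in> generate G {v}"
      using subgroup_nat_pow_closed[OF gv] by (simp add: generate.incl)
    ultimately show "S \<in> (\<lambda>a. F #> a) ` (F <#> generate G {v})"
      using set_mult_superset(2)[OF Fs gv] by auto
  qed
  have "inj_on (\<lambda>i. F #> (v [^] (i::nat))) {..<p}"
  proof (rule inj_onI)
    fix i j assume i: "i \<in> {..<p}" and j: "j \<in> {..<p}" and "F #> (v [^] i) = F #> (v [^] j)"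
    then have "v [^] i \<otimes> inv (v [^] j) \<in> F" using r_coset_eq_iff[OF Fs] v by simp
    then have "v [^] (int i - int j) \<in> F" using v by (simp add: int_pow_diff int_pow_int)
    from int_pow_mem_prime[OF Fs v p vp this] have "int p dvd int i - int j" .
    then show "i = j" using i j dvd_imp_le_int[of "int i - int j" "int p"] by (cases "i = j") auto
  qed
  then show ?thesis by (simp add: rel_index_def im card_image)
qed

lemma complement_unique_if_full:
  assumes D: "D = carrier G" and B: "subgroup B G" "B \<inter> D = F"
  shows "B = F"
  using assms subgroup.subset by blast

lemma rel_index_eq_1:
  assumes A: "subgroup A G" and B: "subgroup B G" "B \<subseteq> A" and "rel_index G A B = 1"
  shows "A = B"
proof
  show "A \<subseteq> B"
  proof
    fix a assume a: "a \<in> A"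
    obtain S where "(\<lambda>a. B #> a) ` A = {S}"
      using assms(4) by (auto simp: rel_index_def card_1_singleton_iff)
    then have "B #> a = B #> \<one>" using a subgroup.one_closed[OF A] by blast
    then show "a \<in> B" using r_coset_eq_iff[OF B(1), of a \<one>] subgroup.mem_carrier[OF A a] by simp
  qed
qed (rule B(2))

text \<open>In terms of the quotient by \<open>F\<close>, these are the subgroups complementary to \<open>D\<close>.\<close>

definition complements :: "'a set \<Rightarrow> 'a set \<Rightarrow> 'a set set" where
  "complements F D = {B. subgroup B G \<and> F \<subseteq> B \<and> B <#> D = carrier G \<and> B \<inter> D = F}"

text \<open>Passing from \<open>E\<close> to a larger normal subgroup \<open>F\<close> that meets \<open>D\<close> in \<open>E\<close> leaves the problem of
  complements unchanged, as long as attention is restricted to complements containing \<open>F\<close>. Such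
  an \<open>F\<close> arises by prescribing an element of the complement, or as the part that is forced to lie
  in every complement.\<close>

lemma complements_containing:
  assumes F: "F \<lhd> G" and D: "subgroup D G" and E: "F \<inter> D = E"
  shows "{B \<in> complements E D. F \<subseteq> B} = complements F (F <#> D)"
proof -
  have Fs: "subgroup F G" using F by (simp add: normal_imp_subgroup)
  have FDs: "subgroup (F <#> D) G" using set_mult_normal_subgroup[OF F D] .
  note sup = set_mult_superset[OF Fs D]
  show ?thesis
  proof (intro equalityI subsetI)
    fix B assume "B \<in> {B \<in> complements E D. F \<subseteq> B}"
    then have B: "subgroup B G" "B <#> D = carrier G" "B \<inter> D = E" "F \<subseteq> B"
      by (auto simp: complements_def)
    have "carrier G \<subseteq> B <#> (F <#> D)" using B(2) sup mono_set_mult[of B B D "F <#> D"] by blast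
    then have 1: "B <#> (F <#> D) = carrier G"
      using set_mult_closed subgroup.subset B(1) FDs by blast
    have "B \<inter> (F <#> D) \<subseteq> F"
    proof
      fix x assume x: "x \<in> B \<inter> (F <#> D)"
      then obtain f d where fd: "f \<in> F" "d \<in> D" "x = f \<otimes> d" by (auto simp: set_mult_def)
      have c: "f \<in> carrier G" "d \<in> carrier G"
        using fd subgroup.mem_carrier[OF Fs] subgroup.mem_carrier[OF D] by auto
      have "inv f \<otimes> x \<in> B" using fd x B(4) subgroup.m_closed[OF B(1)] subgroup.m_inv_closed[OF B(1)] by auto
      then have "d \<in> B" using fd c by (simp add: m_assoc[symmetric])
      then have "d \<in> F" using fd B(3) E by blast
      then show "x \<in> F" using fd subgroup.m_closed[OF Fs] by simp
    qed
    then have "B \<inter> (F <#> D) = F" using B(4) sup by blast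
    with 1 B show "B \<in> complements F (F <#> D)" by (simp add: complements_def)
  next
    fix B assume "B \<in> complements F (F <#> D)"
    then have B: "subgroup B G" "F \<subseteq> B" "B <#> (F <#> D) = carrier G" "B \<inter> (F <#> D) = F"
      by (auto simp: complements_def)
    have "B <#> (F <#> D) = (B <#> F) <#> D"
      using set_mult_assoc B(1) Fs D subgroup.subset by metis
    moreover have "B <#> F = B"
      using set_mult_subgroup_idem[OF B(1) subgroup_incl[OF Fs B(1,2)]] .
    ultimately have 1: "B <#> D = carrier G" using B by simp
    have "B \<inter> D = B \<inter> (F <#> D) \<inter> D" using sup by blast
    then have "B \<inter> D = E" using B E by simp
    then show "B \<in> {B \<in> complements E D. F \<subseteq> B}" using 1 B E by (auto simp: complements_def)
  qed
qed

text \<open>Here the group modulo \<open>F\<close> is a vector space over the field with \<open>p\<close> elements and \<open>D\<close> is a line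
  in it, so the complements are the hyperplanes that do not contain a given line. Instead of using linear
  algebra one fixes \<open>v\<close> outside \<open>D\<close>: a complement contains exactly one of the \<open>p\<close> cosets \<open>v d F\<close>
  with \<open>d\<close> in \<open>D\<close>, and those containing \<open>v d\<close> are the complements for the situation in which
  \<open>v d\<close> has been adjoined to \<open>F\<close>, where the index of \<open>D\<close> has dropped by the factor \<open>p\<close>.\<close>

lemma card_complements_elementary:
  assumes p: "Factorial_Ring.prime (p::nat)"
    and "subgroup F G" and "subgroup D G" and "F \<subseteq> D"
    and "commutators_in G (carrier G) F"
    and "\<And>a. a \<in> carrier G \<Longrightarrow> a [^] p \<in> F"
    and "rel_index G D F = p"
    and "rel_index G (carrier G) D \<noteq> 0"
  shows "finite (complements F D) \<and> card (complements F D) = rel_index G (carrier G) D"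
  using assms(2-)
proof (induction "rel_index G (carrier G) D" arbitrary: F D rule: less_induct)
  case less
  note F = less.prems(1) and D = less.prems(2) and FD = less.prems(3) and comm = less.prems(4)
    and pow = less.prems(5) and DF = less.prems(6) and nz = less.prems(7)
  have Dc: "a \<in> D \<Longrightarrow> a \<in> carrier G" for a using subgroup.mem_carrier[OF D] .
  have Fc: "a \<in> F \<Longrightarrow> a \<in> carrier G" for a using subgroup.mem_carrier[OF F] .
  have Fn: "F \<lhd> G" using normal_if_commutators_in[OF F comm] .
  have Gs: "subgroup (carrier G) G" by (rule subgroup_self)
  show ?case
  proof (cases "D = carrier G")
    case True
    have "F <#> D = carrier G"
      using True set_mult_superset(2)[OF F D] set_mult_least[OF Gs, of F D] FD by auto
    then have "complements F D = {F}"
      using complement_unique_if_full[OF True, of _ F] F FD by (auto simp: complements_def)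
    then show ?thesis using True rel_index_refl[OF Gs] by simp
  next
    case False
    then obtain v where v: "v \<in> carrier G" "v \<notin> D" using subgroup.subset[OF D] by blast
    define C where "C = (\<lambda>a. F #> a) ` D"
    have finC: "finite C" and cardC: "card C = p"
      using DF p prime_gt_0_nat[OF p] unfolding rel_index_def C_def
      by (auto intro: card_ge_0_finite)
    define rep where "rep = (\<lambda>S. SOME d. d \<in> D \<and> F #> d = S)"
    have rep: "rep S \<in> D" "F #> rep S = S" if S: "S \<in> C" for S
    proof -
      have "\<exists>a. a \<in> D \<and> F #> a = S" using S by (auto simp: C_def)
      from someI_ex[OF this] show "rep S \<in> D" "F #> rep S = S" by (auto simp: rep_def)
    qed
    \<comment> \<open>The \<open>p\<close> candidates of which every complement contains exactly one.\<close>
    define w where "w = (\<lambda>S. v \<otimes> rep S)"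
    have each: "finite {B \<in> complements F D. w S \<in> B} \<and>
        p * card {B \<in> complements F D. w S \<in> B} = rel_index G (carrier G) D" if S: "S \<in> C" for S
    proof -
      have wc: "w S \<in> carrier G" using v rep[OF S] Dc by (simp add: w_def)
      have wD: "w S \<notin> D"
      proof
        assume "w S \<in> D"
        then have "w S \<otimes> inv (rep S) \<in> D"
          using rep[OF S] subgroup.m_closed[OF D] subgroup.m_inv_closed[OF D] by auto
        then show False using v rep[OF S] Dc by (simp add: w_def m_assoc)
      qed
      define F' where "F' = F <#> generate G {w S}"
      have gw: "subgroup (generate G {w S}) G" using wc by (intro generate_is_subgroup) auto
      have F's: "subgroup F' G" unfolding F'_def using set_mult_normal_subgroup[OF Fn gw] .
      have FF': "F \<subseteq> F'" unfolding F'_def using set_mult_superset(1)[OF F gw] .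
      have comm': "commutators_in G (carrier G) F'" using commutators_in_mono[OF comm FF'] by auto
      have F'n: "F' \<lhd> G" using normal_if_commutators_in[OF F's comm'] .
      have F'D: "F' \<inter> D = F"
      proof (intro equalityI subsetI)
        fix x assume x: "x \<in> F' \<inter> D"
        then obtain f k where fk: "f \<in> F" "x = f \<otimes> w S [^] (k::int)"
          unfolding F'_def generate_pow[OF wc] by (auto simp: set_mult_def)
        have "inv f \<otimes> x \<in> D" using fk x FD subgroup.m_closed[OF D] subgroup.m_inv_closed[OF D] by auto
        then have wk: "w S [^] k \<in> D" using fk wc Fc by (simp add: m_assoc[symmetric])
        have wp: "w S [^] p \<in> D" using pow[OF wc] FD by auto
        have "int p dvd k" by (rule int_pow_mem_prime[OF D wc wD p wp wk])
        then obtain j where "k = int p * j" by auto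
        then have "w S [^] k = (w S [^] p) [^] j" using wc by (simp add: int_pow_pow[symmetric] int_pow_int)
        then have "w S [^] k \<in> F" using pow[OF wc] subgroup_int_pow_closed[OF F] by simp
        then show "x \<in> F" using fk subgroup.m_closed[OF F] by simp
      qed (use FF' FD in auto)
      define D' where "D' = F' <#> D"
      have D's: "subgroup D' G" unfolding D'_def using set_mult_normal_subgroup[OF F'n D] .
      note sup = set_mult_superset[OF F's D, folded D'_def]
      have D'F': "rel_index G D' F' = p"
        unfolding D'_def rel_index_second_iso[OF F's D] F'D by (rule DF)
      have F'F: "rel_index G F' F = p"
        unfolding F'_def by (rule rel_index_cyclic_extension[OF Fn wc _ p pow[OF wc]]) (use wD FD in auto)
      have "rel_index G D' F = rel_index G D' D * rel_index G D F"
        using rel_index_trans[OF D's D F FD] sup by auto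
      moreover have "rel_index G D' F = rel_index G D' F' * rel_index G F' F"
        using rel_index_trans[OF D's F's F FF'] sup by auto
      ultimately have D'D: "rel_index G D' D = p"
        using D'F' F'F DF prime_gt_0_nat[OF p] by simp
      have m: "rel_index G (carrier G) D = rel_index G (carrier G) D' * p"
        using rel_index_trans[OF Gs D's D] sup subgroup.subset[OF D's] D'D by auto
      have "finite (complements F' D') \<and> card (complements F' D') = rel_index G (carrier G) D'"
      proof (rule less.hyps)
        show "rel_index G (carrier G) D' < rel_index G (carrier G) D"
          using m nz prime_gt_1_nat[OF p] by simp
        show "a [^] p \<in> F'" if "a \<in> carrier G" for a using pow[OF that] FF' by auto
        show "rel_index G (carrier G) D' \<noteq> 0" using m nz by auto
      qed (use F's D's sup comm' D'F' in auto)
      moreover have "{B \<in> complements F D. w S \<in> B} = complements F' D'"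
      proof -
        have "w S \<in> F'" unfolding F'_def using set_mult_superset(2)[OF F gw] by (auto intro: generate.incl)
        moreover have "F' \<subseteq> B" if "subgroup B G" "F \<subseteq> B" "w S \<in> B" for B
          unfolding F'_def by (rule set_mult_least[OF that(1,2)]) (use generate_subgroup_incl[of "{w S}" B] that in auto)
        ultimately have "{B \<in> complements F D. w S \<in> B} = {B \<in> complements F D. F' \<subseteq> B}"
          by (auto simp: complements_def)
        then show ?thesis unfolding D'_def complements_containing[OF F'n D F'D] .
      qed
      ultimately show ?thesis using m by simp
    qed
    have cover: "complements F D = (\<Union>S\<in>C. {B \<in> complements F D. w S \<in> B})"
    proof (intro equalityI subsetI)
      fix B assume BB: "B \<in> complements F D"
      then have B: "subgroup B G" "F \<subseteq> B" "B <#> D = carrier G" "B \<inter> D = F"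
        by (auto simp: complements_def)
      have "v \<in> B <#> D" using v B(3) by simp
      then obtain b d where bd: "b \<in> B" "d \<in> D" "v = b \<otimes> d" by (auto simp: set_mult_def)
      have bc: "b \<in> carrier G" using bd subgroup.mem_carrier[OF B(1)] by auto
      let ?S = "F #> inv d"
      have S: "?S \<in> C" using bd subgroup.m_inv_closed[OF D] by (auto simp: C_def)
      have "rep ?S \<otimes> d \<in> F"
        using r_coset_eq_iff[OF F, of "rep ?S" "inv d"] rep[OF S] Dc bd by auto
      then have f: "d \<otimes> (rep ?S \<otimes> d) \<otimes> inv d \<in> F"
        using Fn bd Dc by (simp add: normal_inv_iff)
      have "w ?S = b \<otimes> (d \<otimes> (rep ?S \<otimes> d) \<otimes> inv d)"
        using bd bc Dc rep[OF S] by (simp add: w_def m_assoc)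
      also have "\<dots> \<in> B" using f B bd subgroup.m_closed[OF B(1)] by auto
      finally show "B \<in> (\<Union>S\<in>C. {B \<in> complements F D. w S \<in> B})" using S BB by auto
    qed auto
    have disj: "{B \<in> complements F D. w S \<in> B} \<inter> {B \<in> complements F D. w S' \<in> B} = {}"
      if S: "S \<in> C" and S': "S' \<in> C" and ne: "S \<noteq> S'" for S S'
    proof (rule ccontr)
      assume "\<not> ?thesis"
      then obtain B where BB: "B \<in> complements F D" "w S \<in> B" "w S' \<in> B" by auto
      then have B: "subgroup B G" "B \<inter> D = F" by (auto simp: complements_def)
      have "inv (w S) \<otimes> w S' \<in> B" using BB subgroup.m_closed[OF B(1)] subgroup.m_inv_closed[OF B(1)] by auto
      moreover have "inv (w S) \<otimes> w S' = inv (rep S) \<otimes> rep S'"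
        using v rep[OF S] rep[OF S'] Dc by (simp add: w_def inv_mult_group m_assoc) (simp add: m_assoc[symmetric])
      moreover have "inv (rep S) \<otimes> rep S' \<in> D"
        using rep[OF S] rep[OF S'] subgroup.m_closed[OF D] subgroup.m_inv_closed[OF D] by auto
      ultimately have "inv (rep S) \<otimes> rep S' \<in> F" using B by auto
      then have "rep S \<otimes> (inv (rep S) \<otimes> rep S') \<otimes> inv (rep S) \<in> F"
        using Fn rep[OF S] Dc by (simp add: normal_inv_iff)
      moreover have "rep S \<otimes> (inv (rep S) \<otimes> rep S') \<otimes> inv (rep S) = rep S' \<otimes> inv (rep S)"
        using rep[OF S] rep[OF S'] Dc by (simp add: m_assoc[symmetric])
      ultimately have "F #> rep S' = F #> rep S"
        using r_coset_eq_iff[OF F, of "rep S'" "rep S"] rep[OF S] rep[OF S'] Dc by auto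
      then show False using rep[OF S] rep[OF S'] ne by simp
    qed
    have fin: "finite (complements F D)" using cover finC each by (metis (no_types, lifting) finite_UN_I)
    have "card (complements F D) = (\<Sum>S\<in>C. card {B \<in> complements F D. w S \<in> B})"
      using card_UN_disjoint[OF finC, of "\<lambda>S. {B \<in> complements F D. w S \<in> B}"] each disj cover by auto
    then have "p * card (complements F D) = (\<Sum>S\<in>C. rel_index G (carrier G) D)"
      using each by (simp add: sum_distrib_left)
    then have "card (complements F D) = rel_index G (carrier G) D"
      using cardC prime_gt_0_nat[OF p] by simp
    with fin show ?thesis by simp
  qed
qed

text \<open>Modulo \<open>E\<close> the group is abelian.\<close>

lemma pow_mult_mod:
  assumes E: "subgroup E G" and comm: "commutators_in G (carrier G) E"
    and a: "a \<in> carrier G" and b: "b \<in> carrier G"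
  shows "\<exists>e\<in>E. (a \<otimes> b) [^] (n::nat) = e \<otimes> (a [^] n \<otimes> b [^] n)"
proof (induction n)
  case 0 show ?case using subgroup.one_closed[OF E] by (intro bexI[of _ \<one>]) auto
next
  case (Suc n)
  then obtain e where e: "e \<in> E" "(a \<otimes> b) [^] n = e \<otimes> (a [^] n \<otimes> b [^] n)" by blast
  have Ec: "x \<in> E \<Longrightarrow> x \<in> carrier G" for x using subgroup.mem_carrier[OF E] .
  define c where "c = b [^] n \<otimes> a \<otimes> inv (b [^] n) \<otimes> inv a"
  have c: "c \<in> E" using comm a b by (auto simp: commutators_in_def c_def)
  have ba: "b [^] n \<otimes> a = c \<otimes> a \<otimes> b [^] n" using a b by (simp add: c_def m_assoc)
  define c' where "c' = a [^] n \<otimes> c \<otimes> inv (a [^] n)"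
  have c': "c' \<in> E" using normal_if_commutators_in[OF E comm] a c by (auto simp: c'_def normal_inv_iff)
  have "(a \<otimes> b) [^] Suc n = e \<otimes> (a [^] n \<otimes> (b [^] n \<otimes> a) \<otimes> b)"
    using e a b Ec by (simp add: m_assoc)
  also have "a [^] n \<otimes> (b [^] n \<otimes> a) \<otimes> b = c' \<otimes> (a [^] Suc n \<otimes> b [^] Suc n)"
    unfolding ba using a b c Ec by (simp add: c'_def m_assoc) (simp add: m_assoc[symmetric])
  also have "e \<otimes> \<dots> = (e \<otimes> c') \<otimes> (a [^] Suc n \<otimes> b [^] Suc n)"
    using e c' Ec a b by (simp add: m_assoc)
  finally show ?case using e c' subgroup.m_closed[OF E] by blast
qed

lemma subgroup_powers_mod:
  assumes E: "subgroup E G" and comm: "commutators_in G (carrier G) E"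
  shows "subgroup (E <#> (\<lambda>a. a [^] (n::nat)) ` carrier G) G"
proof -
  have Ec: "x \<in> E \<Longrightarrow> x \<in> carrier G" for x using subgroup.mem_carrier[OF E] .
  have En: "E \<lhd> G" using normal_if_commutators_in[OF E comm] .
  have mem: "x \<in> E <#> (\<lambda>a. a [^] n) ` carrier G \<longleftrightarrow> (\<exists>e\<in>E. \<exists>a\<in>carrier G. x = e \<otimes> a [^] n)" for x
    by (auto simp: set_mult_def)
  show ?thesis
  proof (rule subgroupI)
    show "E <#> (\<lambda>a. a [^] n) ` carrier G \<subseteq> carrier G" using Ec by (auto simp: set_mult_def)
    show "E <#> (\<lambda>a. a [^] n) ` carrier G \<noteq> {}" using subgroup.one_closed[OF E]
      by (auto simp: set_mult_def)
  next
    fix x assume "x \<in> E <#> (\<lambda>a. a [^] n) ` carrier G"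
    then obtain e a where x: "e \<in> E" "a \<in> carrier G" "x = e \<otimes> a [^] n" by (auto simp: mem)
    have conj: "y \<otimes> h \<otimes> inv y \<in> E" if "y \<in> carrier G" "h \<in> E" for y h
      using En that by (simp add: normal_inv_iff)
    have "inv (a [^] n) \<otimes> inv e \<otimes> inv (inv (a [^] n)) \<in> E"
      by (rule conj) (use x subgroup.m_inv_closed[OF E] in auto)
    moreover have "inv x = (inv (a [^] n) \<otimes> inv e \<otimes> inv (inv (a [^] n))) \<otimes> (inv a) [^] n"
      using x Ec by (simp add: inv_mult_group nat_pow_inv m_assoc)
    ultimately show "inv x \<in> E <#> (\<lambda>a. a [^] n) ` carrier G"
      unfolding mem using x by blast
  next
    fix x y assume "x \<in> E <#> (\<lambda>a. a [^] n) ` carrier G" "y \<in> E <#> (\<lambda>a. a [^] n) ` carrier G"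
    then obtain e a e' a' where x: "e \<in> E" "a \<in> carrier G" "x = e \<otimes> a [^] n"
      and y: "e' \<in> E" "a' \<in> carrier G" "y = e' \<otimes> a' [^] n" by (auto simp: mem)
    obtain c where c: "c \<in> E" "(a \<otimes> a') [^] n = c \<otimes> (a [^] n \<otimes> a' [^] n)"
      using pow_mult_mod[OF E comm x(2) y(2)] by blast
    define e2 where "e2 = a [^] n \<otimes> e' \<otimes> inv (a [^] n)"
    have e2: "e2 \<in> E" using En x y by (auto simp: e2_def normal_inv_iff)
    have "a [^] n \<otimes> a' [^] n = inv c \<otimes> (a \<otimes> a') [^] n"
      using c x y Ec by (simp add: m_assoc[symmetric])
    then have "x \<otimes> y = (e \<otimes> e2 \<otimes> inv c) \<otimes> (a \<otimes> a') [^] n"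
      using x y Ec c e2 by (simp add: e2_def m_assoc) (simp add: m_assoc[symmetric])
    then show "x \<otimes> y \<in> E <#> (\<lambda>a. a [^] n) ` carrier G"
      unfolding mem using x y c e2 subgroup.m_closed[OF E] subgroup.m_inv_closed[OF E] by blast
  qed
qed

text \<open>Every complement contains all \<open>p\<close>-th powers: an element is \<open>b d\<close> with \<open>b\<close> in the complement and
  \<open>d\<close> in \<open>D\<close>, and \<open>d ^ p\<close> lies in \<open>E\<close> by the hypothesis on powers. Adjoining the powers to \<open>E\<close>
  and to \<open>D\<close> thus reduces the count to the elementary case.\<close>

lemma card_complements:
  assumes p: "Factorial_Ring.prime (p::nat)"
    and E: "subgroup E G" and D: "subgroup D G" and ED: "E \<subseteq> D"
    and comm: "commutators_in G (carrier G) E"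
    and pow: "\<And>a. a \<in> carrier G \<Longrightarrow> a [^] p \<in> D \<Longrightarrow> a [^] p \<in> E"
    and DE: "rel_index G D E = p"
    and nz: "rel_index G (carrier G) (D <#> (\<lambda>a. a [^] p) ` carrier G) \<noteq> 0"
  shows "finite (complements E D) \<and>
    card (complements E D) = rel_index G (carrier G) (D <#> (\<lambda>a. a [^] p) ` carrier G)"
proof -
  let ?P = "(\<lambda>a. a [^] p) ` carrier G"
  have Ec: "x \<in> E \<Longrightarrow> x \<in> carrier G" for x using subgroup.mem_carrier[OF E] .
  have Dc: "x \<in> D \<Longrightarrow> x \<in> carrier G" for x using subgroup.mem_carrier[OF D] .
  have commD: "commutators_in G (carrier G) D" using commutators_in_mono[OF comm ED] by auto
  define F where "F = E <#> ?P"
  define D' where "D' = D <#> ?P"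
  have F: "subgroup F G" unfolding F_def using subgroup_powers_mod[OF E comm] .
  have D's: "subgroup D' G" unfolding D'_def using subgroup_powers_mod[OF D commD] .
  have PF: "a [^] p \<in> F" if "a \<in> carrier G" for a
  proof -
    have "a [^] p = \<one> \<otimes> a [^] p" using that by simp
    then show ?thesis unfolding F_def set_mult_def using that subgroup.one_closed[OF E] by blast
  qed
  have EF: "E \<subseteq> F"
  proof
    fix e assume "e \<in> E"
    then have "e = e \<otimes> \<one> [^] p" using Ec by simp
    then show "e \<in> F" unfolding F_def set_mult_def using \<open>e \<in> E\<close> by blast
  qed
  have commF: "commutators_in G (carrier G) F" using commutators_in_mono[OF comm EF] by auto
  have Fn: "F \<lhd> G" using normal_if_commutators_in[OF F commF] .
  have FD: "F \<inter> D = E"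
  proof (intro equalityI subsetI)
    fix x assume x: "x \<in> F \<inter> D"
    then obtain e a where ea: "e \<in> E" "a \<in> carrier G" "x = e \<otimes> a [^] p"
      by (auto simp: F_def set_mult_def)
    have "inv e \<otimes> x \<in> D" using ea x ED subgroup.m_closed[OF D] subgroup.m_inv_closed[OF D] by auto
    then have "a [^] p \<in> D" using ea Ec by (simp add: m_assoc[symmetric])
    then have "a [^] p \<in> E" using pow ea by auto
    then show "x \<in> E" using ea subgroup.m_closed[OF E] by simp
  qed (use EF ED in auto)
  have D'F: "D' = F <#> D"
  proof (intro equalityI subsetI)
    fix x assume "x \<in> D'"
    then obtain d a where x: "d \<in> D" "a \<in> carrier G" "x = d \<otimes> a [^] p"
      by (auto simp: D'_def set_mult_def)
    have FDs: "subgroup (F <#> D) G" using set_mult_normal_subgroup[OF Fn D] .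
    have "d \<in> F <#> D" "a [^] p \<in> F <#> D"
      using x PF[of a] set_mult_superset[OF F D] by auto
    then show "x \<in> F <#> D" using x subgroup.m_closed[OF FDs] by simp
  next
    fix x assume "x \<in> F <#> D"
    moreover have "F \<subseteq> D'" unfolding F_def D'_def using ED by (intro mono_set_mult) auto
    moreover have "D \<subseteq> D'"
    proof
      fix e assume "e \<in> D"
      then have "e = e \<otimes> \<one> [^] p" using Dc by simp
      then show "e \<in> D'" unfolding D'_def set_mult_def using \<open>e \<in> D\<close> by blast
    qed
    ultimately show "x \<in> D'" using set_mult_least[OF D's] by blast
  qed
  have FD': "F \<subseteq> D'" and DD': "D \<subseteq> D'" unfolding D'F using set_mult_superset[OF F D] by auto
  have idx: "rel_index G D' F = p" unfolding D'F rel_index_second_iso[OF F D] FD by (rule DE)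
  have FB: "F \<subseteq> B" if "B \<in> complements E D" for B
  proof -
    have B: "subgroup B G" "E \<subseteq> B" "B <#> D = carrier G"
      using that by (auto simp: complements_def)
    have PB: "a [^] p \<in> B" if "a \<in> carrier G" for a
    proof -
      have "a \<in> B <#> D" using that B(3) by simp
      then obtain b d where bd: "b \<in> B" "d \<in> D" "a = b \<otimes> d" by (auto simp: set_mult_def)
      have bc: "b \<in> carrier G" using bd subgroup.mem_carrier[OF B(1)] by auto
      obtain e where e: "e \<in> E" "a [^] p = e \<otimes> (b [^] p \<otimes> d [^] p)"
        using pow_mult_mod[OF E comm bc, of d p] bd Dc by auto
      have "d [^] p \<in> D" using subgroup_nat_pow_closed[OF D bd(2)] .
      then have "d [^] p \<in> E" using pow bd Dc by auto
      then have "e \<in> B" "d [^] p \<in> B" using e(1) B(2) by blast+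
      then show ?thesis
        using e(2) subgroup_nat_pow_closed[OF B(1) bd(1), of p] subgroup.m_closed[OF B(1)] by simp
    qed
    show ?thesis unfolding F_def by (rule set_mult_least[OF B(1,2)]) (use PB in auto)
  qed
  then have same: "complements E D = complements F D'"
    unfolding D'F using complements_containing[OF Fn D FD] by blast
  show ?thesis unfolding same D'_def[symmetric]
    by (rule card_complements_elementary[OF p F D's FD' commF PF idx nz[folded D'_def]])
qed

end

section \<open>Gap sets and abaci\<close>

text \<open>Place the natural numbers on an abacus with \<open>d\<close> runners, one for each residue modulo \<open>d\<close>, and put
  beads at the elements of \<open>S\<close>: on every runner the beads are pushed to the bottom.\<close>

definition flush_set :: "nat \<Rightarrow> nat set \<Rightarrow> bool" where
  "flush_set d S \<longleftrightarrow> finite S \<and> (\<forall>i. i + d \<in> S \<longrightarrow> i \<in> S)"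

text \<open>For a flush set these are the first free positions, one on each runner.\<close>

definition corners :: "nat \<Rightarrow> nat set \<Rightarrow> nat set" where
  "corners d S = {i. i \<notin> S \<and> (i < d \<or> i - d \<in> S)}"

text \<open>This will be the exponent of \<open>p\<close> in the number of lattices with gap set \<open>S\<close>: a lattice with gaps below
  \<open>g\<close> has \<open>p ^ m\<close> sublattices with the one further gap \<open>g\<close>, where \<open>m\<close> is the summand of \<open>g\<close>.\<close>

definition gap_weight :: "nat \<Rightarrow> nat set \<Rightarrow> nat" where
  "gap_weight d S = (\<Sum>g\<in>S. card {i \<in> corners d S. i < g})"

lemma flush_set_remove_Max:
  assumes "flush_set d S" "S \<noteq> {}" "d > 0"
  shows "flush_set d (S - {Max S})"
proof -
  have fin: "finite S" using assms by (simp add: flush_set_def)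
  have "i \<in> S - {Max S}" if "i + d \<in> S - {Max S}" for i
  proof -
    have "i \<in> S" using that assms(1) by (auto simp: flush_set_def)
    moreover have "i + d \<le> Max S" using that fin by auto
    ultimately show ?thesis using assms(3) by auto
  qed
  then show ?thesis unfolding flush_set_def using fin by blast
qed

lemma gap_weight_remove_Max:
  assumes "flush_set d S" "S \<noteq> {}" "d > 0"
  defines "g \<equiv> Max S"
  shows "gap_weight d S = gap_weight d (S - {g}) + card {i \<in> corners d (S - {g}). i < g}"
proof -
  have fin: "finite S" using assms by (simp add: flush_set_def)
  have gS: "g \<in> S" using fin assms by (auto simp: g_def)
  have le: "h \<le> g" if "h \<in> S" for h using that fin by (auto simp: g_def)
  have same: "{i \<in> corners d S. i < h} = {i \<in> corners d (S - {g}). i < h}" if "h \<in> S" for h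
    using le[OF that] by (auto simp: corners_def)
  have "gap_weight d S = (\<Sum>h\<in>S. card {i \<in> corners d (S - {g}). i < h})"
    unfolding gap_weight_def by (rule sum.cong) (use same in auto)
  also have "\<dots> = gap_weight d (S - {g}) + card {i \<in> corners d (S - {g}). i < g}"
    unfolding gap_weight_def by (simp add: sum.remove[OF fin gS])
  finally show ?thesis .
qed

text \<open>The flush set with \<open>ms ! r\<close> beads on the runner \<open>r\<close>.\<close>

definition runner_gaps :: "nat list \<Rightarrow> nat set" where
  "runner_gaps ms = {r + length ms * j | r j. r < length ms \<and> j < ms ! r}"

text \<open>The number of beads of a runner beyond the first free position of another runner is the excess
  in length, diminished by one if the other runner stands to the right. The summand of \<open>x\<close> and \<open>y\<close>
  collects both orders of this pair of runners, of which at most one contributes.\<close>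

fun inv_weight :: "nat list \<Rightarrow> nat" where
  "inv_weight [] = 0"
| "inv_weight (x # xs) = (\<Sum>y\<leftarrow>xs. (y - x) + (x - y - 1)) + inv_weight xs"

lemma runner_unique:
  fixes d :: nat
  assumes "r < d" "r' < d" "r + d * j = r' + d * j'"
  shows "r = r' \<and> j = j'"
proof -
  have "r = (r + d * j) mod d" using assms(1) by simp
  also have "\<dots> = (r' + d * j') mod d" unfolding assms(3) ..
  also have "\<dots> = r'" using assms(2) by simp
  finally have "r = r'" .
  then show ?thesis using assms by auto
qed

text \<open>Positions on the abacus are ordered lexicographically, by height and then by runner.\<close>

lemma runner_less_iff:
  fixes n :: nat
  assumes "r < n" "r' < n"
  shows "r' + n * a < r + n * b \<longleftrightarrow> a < b \<or> a = b \<and> r' < r"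
proof (cases a b rule: linorder_cases)
  case less
  then obtain k where "b = Suc (a + k)" using less_imp_Suc_add by blast
  then have "n * b = n * a + n + n * k" by (simp add: algebra_simps)
  then have "r' + n * a < r + n * b" using assms by linarith
  then show ?thesis using less by blast
next
  case greater
  then obtain k where "a = Suc (b + k)" using less_imp_Suc_add by blast
  then have "n * a = n * b + n + n * k" by (simp add: algebra_simps)
  then have "\<not> r' + n * a < r + n * b" using assms by linarith
  then show ?thesis using greater by auto
qed simp

lemma runner_gaps_iff:
  assumes "r < length ms"
  shows "r + length ms * j \<in> runner_gaps ms \<longleftrightarrow> j < ms ! r"
proof
  assume "r + length ms * j \<in> runner_gaps ms"
  then obtain r' j' where e: "r + length ms * j = r' + length ms * j'" "r' < length ms" "j' < ms ! r'"
    by (auto simp: runner_gaps_def)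
  then show "j < ms ! r" using runner_unique[OF assms e(2,1)] by simp
qed (use assms in \<open>auto simp: runner_gaps_def\<close>)

lemma runner_gaps_eq_image:
  "runner_gaps ms = (\<lambda>(r, j). r + length ms * j) ` (SIGMA r:{..<length ms}. {..<ms ! r})"
  by (auto simp: runner_gaps_def image_iff)

lemma runner_inj: "inj_on (\<lambda>(r, j). r + d * j) (SIGMA r:{..<d}. A r)" for d :: nat
proof (rule inj_onI, clarify)
  fix r j r' j' assume "r < d" "r' < d" and eq: "r + d * j = r' + d * j'"
  then show "r = r' \<and> j = j'" by (rule runner_unique)
qed

lemma card_runner_gaps: "card (runner_gaps ms) = sum_list ms"
proof -
  have "card (runner_gaps ms) = (\<Sum>r<length ms. ms ! r)"
    unfolding runner_gaps_eq_image by (subst card_image[OF runner_inj]) (simp add: card_SigmaI)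
  then show ?thesis by (simp add: sum_list_sum_nth atLeast0LessThan)
qed

lemma flush_set_runner_gaps: "flush_set (length ms) (runner_gaps ms)"
proof -
  have "finite (runner_gaps ms)" unfolding runner_gaps_eq_image by auto
  moreover have "i \<in> runner_gaps ms" if i: "i + length ms \<in> runner_gaps ms" for i
  proof -
    obtain r j where e: "i + length ms = r + length ms * j" "r < length ms" "j < ms ! r"
      using i by (auto simp: runner_gaps_def)
    then obtain j' where "j = Suc j'" by (cases j) auto
    then have "i = r + length ms * j'" "j' < ms ! r" using e by auto
    then show ?thesis using e by (auto simp: runner_gaps_def)
  qed
  ultimately show ?thesis unfolding flush_set_def by blast
qed

lemma bij_betw_runner_gaps:
  assumes "d > 0"
  shows "bij_betw runner_gaps {ms. length ms = d} {S. flush_set d S}"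
  unfolding bij_betw_def
proof
  show "inj_on runner_gaps {ms. length ms = d}"
  proof (rule inj_onI)
    fix ms ns assume l: "ms \<in> {ms. length ms = d}" "ns \<in> {ms. length ms = d}"
      and eq: "runner_gaps ms = runner_gaps ns"
    have "ms ! r = ns ! r" if r: "r < d" for r
    proof -
      have "j < ms ! r \<longleftrightarrow> j < ns ! r" for j
        using runner_gaps_iff[of r ms j] runner_gaps_iff[of r ns j] l r eq by simp
      then show ?thesis by (metis less_irrefl linorder_neqE_nat)
    qed
    then show "ms = ns" using l by (auto intro: nth_equalityI)
  qed
  show "runner_gaps ` {ms. length ms = d} = {S. flush_set d S}"
  proof (intro equalityI subsetI)
    fix S assume "S \<in> {S. flush_set d S}"
    then have S: "finite S" "\<And>i. i + d \<in> S \<Longrightarrow> i \<in> S" by (auto simp: flush_set_def)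
    \<comment> \<open>The number of beads on a runner is the height of its first free position.\<close>
    define ms where "ms = map (\<lambda>r. LEAST j. r + d * j \<notin> S) [0..<d]"
    have len: "length ms = d" by (simp add: ms_def)
    have iff: "r + d * j \<in> S \<longleftrightarrow> j < ms ! r" if r: "r < d" for r j
    proof -
      have "\<exists>j. r + d * j \<notin> S"
      proof (rule ccontr)
        assume "\<not> ?thesis"
        then have "range (\<lambda>j. r + d * j) \<subseteq> S" by auto
        moreover have "infinite (range (\<lambda>j. r + d * j))"
          using assms by (intro range_inj_infinite) (auto simp: inj_def)
        ultimately show False using S finite_subset by blast
      qed
      then have "r + d * (LEAST j. r + d * j \<notin> S) \<notin> S" by (rule LeastI_ex)
      then have nL: "r + d * (ms ! r) \<notin> S" using r by (simp add: ms_def)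
      have up: "r + d * (m + i) \<notin> S" if "r + d * m \<notin> S" for m i
      proof (induction i)
        case (Suc i) then show ?case using S(2)[of "r + d * (m + i)"] by (auto simp: algebra_simps)
      qed (use that in auto)
      show ?thesis
      proof
        assume "r + d * j \<in> S"
        then show "j < ms ! r" using up[OF nL, of "j - ms ! r"] by (cases "j < ms ! r") auto
      next
        assume "j < ms ! r"
        then have "j < (LEAST j. r + d * j \<notin> S)" using r by (simp add: ms_def)
        then show "r + d * j \<in> S" using not_less_Least[of j "\<lambda>j. r + d * j \<notin> S"] by simp
      qed
    qed
    have decomp: "\<exists>r j. x = r + d * j \<and> r < d" for x
      using assms by (intro exI[of _ "x mod d"] exI[of _ "x div d"]) simp
    have "S = runner_gaps ms"
    proof (intro equalityI subsetI)
      fix x assume "x \<in> S"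
      moreover obtain r j where rj: "x = r + d * j" "r < d"
        using decomp[of x] by blast
      ultimately show "x \<in> runner_gaps ms"
        using iff[of r j] runner_gaps_iff[of r ms j] len by simp
    next
      fix x assume "x \<in> runner_gaps ms"
      then obtain r j where "x = r + d * j" "r < d" "j < ms ! r" by (auto simp: runner_gaps_def len)
      then show "x \<in> S" using iff by auto
    qed
    then show "S \<in> runner_gaps ` {ms. length ms = d}" using len by auto
  qed (use flush_set_runner_gaps in auto)
qed

lemma corners_runner_gaps:
  assumes "d = length ms" "d > 0"
  shows "corners d (runner_gaps ms) = (\<lambda>r. r + d * ms ! r) ` {..<d}"
proof (intro equalityI subsetI)
  fix i assume i: "i \<in> corners d (runner_gaps ms)"
  define r j where "r = i mod d" and "j = i div d"
  have ij: "i = r + d * j" "r < d" using assms by (auto simp: r_def j_def)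
  have 1: "\<not> j < ms ! r" using i ij runner_gaps_iff[of r ms j] assms by (auto simp: corners_def)
  have "j = ms ! r"
  proof (cases j)
    case 0 then show ?thesis using 1 by simp
  next
    case (Suc j')
    then have "i - d = r + d * j'" "\<not> i < d" using ij by auto
    then have "j' < ms ! r" using i ij runner_gaps_iff[of r ms j'] assms by (auto simp: corners_def)
    then show ?thesis using 1 Suc by simp
  qed
  then show "i \<in> (\<lambda>r. r + d * ms ! r) ` {..<d}" using ij by auto
next
  fix i assume "i \<in> (\<lambda>r. r + d * ms ! r) ` {..<d}"
  then obtain r where r: "r < d" "i = r + d * ms ! r" by auto
  have 1: "i \<notin> runner_gaps ms" using r runner_gaps_iff[of r ms "ms ! r"] assms by auto
  have 2: "i < d \<or> i - d \<in> runner_gaps ms"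
  proof (cases "ms ! r")
    case (Suc j)
    then have "i - d = r + d * j" using r by simp
    then show ?thesis using runner_gaps_iff[of r ms j] Suc r assms by auto
  qed (use r in auto)
  show "i \<in> corners d (runner_gaps ms)" using 1 2 by (auto simp: corners_def)
qed

text \<open>The corners are the first free positions, so the weight counts pairs consisting of a bead on a
  runner \<open>r\<close> and a runner \<open>r'\<close> whose first free position is smaller than that bead.\<close>

lemma gap_weight_runner_gaps_pairs:
  assumes d: "d = length ms" "d > 0"
  shows "gap_weight d (runner_gaps ms) =
    (\<Sum>r<d. \<Sum>r'<d. if r' < r then ms ! r - ms ! r' else if r < r' then ms ! r - ms ! r' - 1 else 0)"
proof -
  have inj: "inj_on (\<lambda>r. r + d * ms ! r) {..<d}"
  proof (rule inj_onI)
    fix r r' assume r: "r \<in> {..<d}" "r' \<in> {..<d}" and eq: "r + d * ms ! r = r' + d * ms ! r'"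
    show "r = r'" using runner_unique[OF _ _ eq] r by simp
  qed
  have c: "card {i \<in> corners d (runner_gaps ms). i < g} = (\<Sum>r'<d. if r' + d * ms ! r' < g then 1 else 0)" for g
  proof -
    have "{i \<in> corners d (runner_gaps ms). i < g} = (\<lambda>r. r + d * ms ! r) ` {r' \<in> {..<d}. r' + d * ms ! r' < g}"
      unfolding corners_runner_gaps[OF d] by auto
    then have "card {i \<in> corners d (runner_gaps ms). i < g} = card {r' \<in> {..<d}. r' + d * ms ! r' < g}"
      using inj by (auto intro!: card_image intro: inj_on_subset)
    also have "\<dots> = (\<Sum>r'<d. if r' + d * ms ! r' < g then 1 else 0)"
      unfolding card_eq_sum by (rule sum.inter_filter) simp
    finally show ?thesis .
  qed
  have pair: "(\<Sum>j<ms ! r. if r' + d * ms ! r' < r + d * j then 1 else 0::nat) =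
     (if r' < r then ms ! r - ms ! r' else if r < r' then ms ! r - ms ! r' - 1 else 0)"
    if r: "r < d" "r' < d" for r r'
  proof -
    have "(\<Sum>j<ms ! r. if r' + d * ms ! r' < r + d * j then 1 else 0::nat) =
      card {j \<in> {..<ms ! r}. ms ! r' < j \<or> ms ! r' = j \<and> r' < r}"
      unfolding runner_less_iff[OF r] card_eq_sum by (rule sum.inter_filter[symmetric]) simp
    also have "{j \<in> {..<ms ! r}. (ms ! r' < j \<or> ms ! r' = j \<and> r' < r)} =
      (if r' < r then {ms ! r'..<ms ! r} else {Suc (ms ! r')..<ms ! r})"
      by auto
    also have "card \<dots> = (if r' < r then ms ! r - ms ! r' else if r < r' then ms ! r - ms ! r' - 1 else 0)"
      using r by (cases r r' rule: linorder_cases) auto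
    finally show ?thesis .
  qed
  have "gap_weight d (runner_gaps ms) = (\<Sum>g\<in>runner_gaps ms. \<Sum>r'<d. if r' + d * ms ! r' < g then 1 else 0)"
    unfolding gap_weight_def c ..
  also have "\<dots> =
     (\<Sum>(r, j)\<in>(SIGMA r:{..<d}. {..<ms ! r}). \<Sum>r'<d. if r' + d * ms ! r' < r + d * j then 1 else 0)"
    unfolding runner_gaps_eq_image d(1)[symmetric]
    by (subst sum.reindex[OF runner_inj]) (simp add: case_prod_beta comp_def)
  also have "\<dots> = (\<Sum>r<d. \<Sum>j<ms ! r. \<Sum>r'<d. if r' + d * ms ! r' < r + d * j then 1 else 0)"
    by (subst sum.Sigma) auto
  also have "\<dots> = (\<Sum>r<d. \<Sum>r'<d. \<Sum>j<ms ! r. if r' + d * ms ! r' < r + d * j then 1 else 0)"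
    by (rule sum.cong[OF refl]) (rule sum.swap)
  also have "\<dots> = (\<Sum>r<d. \<Sum>r'<d. if r' < r then ms ! r - ms ! r' else if r < r' then ms ! r - ms ! r' - 1 else 0)"
    by (intro sum.cong refl pair) auto
  finally show ?thesis .
qed

lemma inv_weight_pairs:
  "inv_weight ms = (\<Sum>r<length ms. \<Sum>r'<length ms.
     if r' < r then ms ! r - ms ! r' else if r < r' then ms ! r - ms ! r' - 1 else 0)"
proof (induction ms)
  case (Cons x xs)
  let ?t = "\<lambda>ms r r'. if r' < r then ms ! r - ms ! r' else if r < r' then ms ! r - ms ! r' - 1 else 0::nat"
  let ?n = "length xs"
  have "(\<Sum>r<length (x # xs). \<Sum>r'<length (x # xs). ?t (x # xs) r r') =
    (\<Sum>r'<?n. x - xs ! r' - 1) + (\<Sum>r<?n. (xs ! r - x) + (\<Sum>r'<?n. ?t xs r r'))"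
    by (simp add: sum.lessThan_Suc_shift del: sum.lessThan_Suc cong: if_cong)
  also have "\<dots> = (\<Sum>r<?n. (xs ! r - x) + (x - xs ! r - 1)) + inv_weight xs"
    unfolding Cons.IH by (simp add: sum.distrib)
  also have "(\<Sum>r<?n. (xs ! r - x) + (x - xs ! r - 1)) = (\<Sum>y\<leftarrow>xs. (y - x) + (x - y - 1))"
    by (simp add: sum_list_sum_nth atLeast0LessThan)
  finally show ?case by simp
qed simp

lemma gap_weight_runner_gaps:
  "length ms > 0 \<Longrightarrow> gap_weight (length ms) (runner_gaps ms) = inv_weight ms"
  unfolding inv_weight_pairs by (rule gap_weight_runner_gaps_pairs) auto

lemma inv_weight_append1:
  "inv_weight (xs @ [m]) = inv_weight xs + (\<Sum>y\<leftarrow>xs. (m - y) + (y - m - 1))"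
  by (induction xs) (simp_all only: inv_weight.simps append.simps list.map sum_list.Cons sum_list.Nil
      map_append sum_list.append add_ac add_0)

text \<open>Moving an entry from the end to the front and raising it by one keeps all pairwise contributions:
  the truncated differences change sides exactly as the unit correction in \<open>inv_weight\<close> prescribes.\<close>

lemma inv_weight_Cons_Suc: "inv_weight (Suc m # xs) = inv_weight (xs @ [m])"
proof -
  have "(\<Sum>y\<leftarrow>xs. (y - Suc m) + (Suc m - y - 1)) = (\<Sum>y\<leftarrow>xs. (m - y) + (y - m - 1))"
    by (intro arg_cong[where f = sum_list] map_cong) auto
  then show ?thesis by (simp add: inv_weight_append1)
qed

lemma runner_gaps_subset_iff:
  assumes d: "d = length ms" "d > 0"
  shows "runner_gaps ms \<subseteq> {..<i} \<longleftrightarrow> (\<forall>r<d. r + d * ms ! r < i + d)"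
proof
  assume sub: "runner_gaps ms \<subseteq> {..<i}"
  show "\<forall>r<d. r + d * ms ! r < i + d"
  proof (intro allI impI)
    fix r assume r: "r < d"
    show "r + d * ms ! r < i + d"
    proof (cases "ms ! r")
      case (Suc j)
      then have "r + d * j \<in> runner_gaps ms" using runner_gaps_iff[of r ms j] r d by simp
      then have "r + d * j < i" using sub by auto
      then show ?thesis using Suc by simp
    qed (use r in simp)
  qed
next
  assume all: "\<forall>r<d. r + d * ms ! r < i + d"
  show "runner_gaps ms \<subseteq> {..<i}"
  proof
    fix x assume "x \<in> runner_gaps ms"
    then obtain r j where x: "x = r + d * j" "r < d" "j < ms ! r" by (auto simp: runner_gaps_def d)
    then obtain k where "ms ! r = Suc (j + k)" using less_imp_Suc_add by blast
    then have "d * ms ! r = d * j + d + d * k" by (simp add: algebra_simps)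
    moreover have "r + d * ms ! r < i + d" using all x by simp
    ultimately show "x \<in> {..<i}" using x by simp
  qed
qed

lemma card_by_fibres:
  assumes "finite T" "\<And>a. a \<in> A \<Longrightarrow> h a \<in> T"
    and "\<And>t. t \<in> T \<Longrightarrow> finite {a \<in> A. h a = t} \<and> card {a \<in> A. h a = t} = c t"
  shows "finite A \<and> card A = (\<Sum>t\<in>T. c t)"
proof -
  have A: "A = (\<Union>t\<in>T. {a \<in> A. h a = t})" using assms(2) by auto
  have "finite (\<Union>t\<in>T. {a \<in> A. h a = t})" using assms by blast
  moreover have "card (\<Union>t\<in>T. {a \<in> A. h a = t}) = (\<Sum>t\<in>T. card {a \<in> A. h a = t})"
    by (rule card_UN_disjoint) (use assms in auto)
  ultimately show ?thesis using A assms(3) by simp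
qed

context group
begin

lemma subgroup_carrier_update_iff:
  assumes "subgroup A G"
  shows "subgroup B (G\<lparr>carrier := A\<rparr>) \<longleftrightarrow> subgroup B G \<and> B \<subseteq> A"
proof
  assume B: "subgroup B (G\<lparr>carrier := A\<rparr>)"
  then show "subgroup B G \<and> B \<subseteq> A" using incl_subgroup[OF assms B] subgroup.subset[OF B] by simp
qed (use subgroup_incl[OF _ assms] in auto)

lemma commutators_in_carrier_update:
  assumes "subgroup A G"
  shows "commutators_in (G\<lparr>carrier := A\<rparr>) A E \<longleftrightarrow> commutators_in G A E"
  using m_inv_consistent[OF assms] by (simp add: commutators_in_def)

lemma card_complements_in_subgroup:
  assumes p: "Factorial_Ring.prime (p::nat)"
    and A: "subgroup A G" and E: "subgroup E G" and D: "subgroup D G" and ED: "E \<subseteq> D" and DA: "D \<subseteq> A"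
    and comm: "commutators_in G A E"
    and pow: "\<And>a. a \<in> A \<Longrightarrow> a [^] p \<in> D \<Longrightarrow> a [^] p \<in> E"
    and DE: "rel_index G D E = p"
    and nz: "rel_index G A (D <#> (\<lambda>a. a [^] p) ` A) \<noteq> 0"
  shows "finite {B. subgroup B G \<and> E \<subseteq> B \<and> B <#> D = A \<and> B \<inter> D = E} \<and>
    card {B. subgroup B G \<and> E \<subseteq> B \<and> B <#> D = A \<and> B \<inter> D = E} =
      rel_index G A (D <#> (\<lambda>a. a [^] p) ` A)"
proof -
  let ?A = "G\<lparr>carrier := A\<rparr>"
  interpret A: group ?A using subgroup_imp_group[OF A] .
  have ri: "rel_index ?A = rel_index G" by (intro ext) (simp add: rel_index_def r_coset_def)
  have pw: "x [^]\<^bsub>?A\<^esub> (n::nat) = x [^] n" for x n using nat_pow_consistent by metis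
  have sm: "S <#>\<^bsub>?A\<^esub> T = S <#> T" for S T by (simp add: set_mult_def)
  have "commutators_in ?A A E" using comm by (simp add: commutators_in_carrier_update[OF A])
  then have "finite (A.complements E D) \<and>
     card (A.complements E D) = rel_index ?A (carrier ?A) (D <#>\<^bsub>?A\<^esub> (\<lambda>a. a [^]\<^bsub>?A\<^esub> p) ` carrier ?A)"
    by (intro A.card_complements[OF p])
       (use pow DE nz E D ED DA in \<open>auto simp: subgroup_carrier_update_iff[OF A] ri pw sm\<close>)
  moreover have "A.complements E D = {B. subgroup B G \<and> E \<subseteq> B \<and> B <#> D = A \<and> B \<inter> D = E}"
    using set_mult_superset(1)[OF _ D]
    by (auto simp: A.complements_def subgroup_carrier_update_iff[OF A] sm)
  ultimately show ?thesis by (simp add: ri pw sm)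
qed

end

section \<open>Lattices in a filtered abelian group\<close>

text \<open>The model is the additive group of \<open>R\<close>, written multiplicatively, with a filtration that refines the
  powers of the maximal ideal. The ring structure is left out so that \<open>R \<times> R\<close> is covered as well; what
  remains of it is that the filtration is periodic under the \<open>p\<close>-th power map.\<close>

locale lattice_chain = comm_group L for L (structure) +
  fixes p d :: nat and F :: "nat \<Rightarrow> 'a set"
  assumes prime_p: "Factorial_Ring.prime p"
    and d_pos: "0 < d"
    and F_0: "F 0 = carrier L"
    and F_subgroup: "subgroup (F i) L"
    and F_Suc: "F (Suc i) \<subseteq> F i"
    and F_index: "rel_index L (F i) (F (Suc i)) = p"
    and F_shift: "F (i + d) = (\<lambda>x. x [^] p) ` F i"
    and pow_p_eq_one: "x \<in> carrier L \<Longrightarrow> x [^] p = \<one> \<Longrightarrow> x = \<one>"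
begin

definition lattices :: "'a set set" where
  "lattices = {M. subgroup M L \<and> (\<exists>k. F k \<subseteq> M)}"

text \<open>The positions at which \<open>M\<close> has no element of exactly that depth in the filtration.\<close>

definition gaps :: "'a set \<Rightarrow> nat set" where
  "gaps M = {i. M \<inter> F i \<subseteq> F (Suc i)}"

lemma F_antimono: "i \<le> j \<Longrightarrow> F j \<subseteq> F i"
  by (rule lift_Suc_antimono_le[of F]) (use F_Suc in auto)

lemma F_carrier: "x \<in> F i \<Longrightarrow> x \<in> carrier L"
  using subgroup.mem_carrier[OF F_subgroup] .

lemma pow_p_inj:
  assumes "x \<in> carrier L" "y \<in> carrier L" "x [^] p = y [^] p"
  shows "x = y"
proof -
  have "(x \<otimes> inv y) [^] p = x [^] p \<otimes> inv (y [^] p)"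
    using assms by (simp add: nat_pow_distrib nat_pow_inv)
  then have "(x \<otimes> inv y) [^] p = \<one>" using assms by simp
  then have "x \<otimes> inv y = \<one>" by (rule pow_p_eq_one[rotated]) (use assms in auto)
  then have "x = inv (inv y)" using assms by (intro inv_equality[symmetric]) auto
  then show ?thesis using assms by simp
qed

lemma pow_p_mem_iff:
  assumes "x \<in> carrier L"
  shows "x [^] p \<in> F (i + d) \<longleftrightarrow> x \<in> F i"
  using pow_p_inj[OF assms] F_carrier by (auto simp: F_shift)

lemma F_not_subset: "\<not> F i \<subseteq> F (Suc i)"
proof
  assume "F i \<subseteq> F (Suc i)"
  then have "F i = F (Suc i)" using F_Suc by blast
  then have "rel_index L (F i) (F (Suc i)) = 1" using rel_index_refl[OF F_subgroup[of i]] by simp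
  then show False using F_index[of i] prime_p by auto
qed

text \<open>An index that is prime leaves no room for a subgroup strictly in between.\<close>

lemma between_F:
  assumes "subgroup T L" "F (Suc i) \<subseteq> T" "T \<subseteq> F i"
  shows "T = F i \<or> T = F (Suc i)"
proof -
  have "p = rel_index L (F i) T * rel_index L T (F (Suc i))"
    using rel_index_trans[OF F_subgroup assms(1) F_subgroup assms(2,3)] F_index by simp
  then have "rel_index L (F i) T = 1 \<or> rel_index L T (F (Suc i)) = 1"
    using prime_p prime_product by metis
  then show ?thesis
    using rel_index_eq_1[OF F_subgroup assms(1,3)] rel_index_eq_1[OF assms(1) F_subgroup assms(2)] by blast
qed

lemma subgroup_set_mult_F:
  assumes "subgroup M L" shows "subgroup (M <#> F i) L"
  using mult_subgroups[OF assms F_subgroup] .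

text \<open>The subgroup of \<open>F i\<close> cut out by \<open>M F (Suc i)\<close> lies between two neighbours of the filtration, and
  it is all of \<open>F i\<close> precisely if \<open>M\<close> has an element of depth \<open>i\<close>.\<close>

lemma rel_index_step:
  assumes M: "subgroup M L"
  shows "rel_index L (M <#> F i) (M <#> F (Suc i)) = (if i \<in> gaps M then p else 1)"
proof -
  let ?N = "M <#> F (Suc i)"
  have N: "subgroup ?N L" using subgroup_set_mult_F[OF M] .
  have Mc: "x \<in> M \<Longrightarrow> x \<in> carrier L" for x using subgroup.mem_carrier[OF M] .
  have NF: "M <#> F i = ?N <#> F i"
  proof
    show "M <#> F i \<subseteq> ?N <#> F i"
      using set_mult_superset(1)[OF M F_subgroup] by (intro mono_set_mult) auto
    have "?N \<subseteq> M <#> F i" using F_Suc by (intro mono_set_mult) auto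
    then show "?N <#> F i \<subseteq> M <#> F i"
      by (rule set_mult_least[OF subgroup_set_mult_F[OF M] _ set_mult_superset(2)[OF M F_subgroup]])
  qed
  define T where "T = ?N \<inter> F i"
  have T: "subgroup T L" unfolding T_def using subgroups_Inter_pair[OF N F_subgroup] .
  have FT: "F (Suc i) \<subseteq> T" unfolding T_def
    using set_mult_superset(2)[OF M F_subgroup] F_Suc by blast
  have TF: "T \<subseteq> F i" unfolding T_def by blast
  have eq: "rel_index L (M <#> F i) ?N = rel_index L (F i) T"
    unfolding NF T_def by (rule rel_index_second_iso[OF N F_subgroup])
  show ?thesis
  proof (cases "i \<in> gaps M")
    case True
    have "T \<subseteq> F (Suc i)"
    proof
      fix x assume x: "x \<in> T"
      then obtain m f where mf: "m \<in> M" "f \<in> F (Suc i)" "x = m \<otimes> f" by (auto simp: T_def set_mult_def)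
      have "x \<otimes> inv f \<in> F i"
        using x TF mf F_Suc subgroup.m_closed[OF F_subgroup] subgroup.m_inv_closed[OF F_subgroup] by blast
      then have "m \<in> F i" using mf Mc F_carrier by (simp add: m_assoc)
      then have "m \<in> F (Suc i)" using True mf by (auto simp: gaps_def)
      then show "x \<in> F (Suc i)" using mf subgroup.m_closed[OF F_subgroup] by simp
    qed
    then have "T = F (Suc i)" using FT by blast
    then show ?thesis using eq F_index True by simp
  next
    case False
    then obtain x where "x \<in> M" "x \<in> F i" "x \<notin> F (Suc i)" by (auto simp: gaps_def)
    then have "x \<in> T" using set_mult_superset(1)[OF M F_subgroup] by (auto simp: T_def)
    then have "T = F i" using between_F[OF T FT TF] \<open>x \<notin> F (Suc i)\<close> by auto
    then show ?thesis using eq rel_index_refl[OF F_subgroup] False by simp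
  qed
qed

lemma set_mult_carrier: "subgroup M L \<Longrightarrow> M <#> carrier L = carrier L"
  using set_mult_superset(2)[OF _ subgroup_self, of M] set_mult_least[OF subgroup_self, of M "carrier L"]
    subgroup.subset by blast

lemma rel_index_upto:
  assumes M: "subgroup M L"
  shows "rel_index L (carrier L) (M <#> F k) = p ^ card (gaps M \<inter> {..<k})"
proof (induction k)
  case 0
  then show ?case using set_mult_carrier[OF M] rel_index_refl[OF subgroup_self] by (simp add: F_0)
next
  case (Suc k)
  have "rel_index L (carrier L) (M <#> F (Suc k)) =
     rel_index L (carrier L) (M <#> F k) * rel_index L (M <#> F k) (M <#> F (Suc k))"
    by (rule rel_index_trans[OF subgroup_self subgroup_set_mult_F[OF M] subgroup_set_mult_F[OF M]
          mono_set_mult[OF order.refl F_Suc] subgroup.subset[OF subgroup_set_mult_F[OF M]]])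
  also have "\<dots> = p ^ card (gaps M \<inter> {..<k}) * (if k \<in> gaps M then p else 1)"
    using Suc rel_index_step[OF M] by simp
  also have "\<dots> = p ^ card (gaps M \<inter> {..<Suc k})"
  proof (cases "k \<in> gaps M")
    case True
    then have "gaps M \<inter> {..<Suc k} = insert k (gaps M \<inter> {..<k})" by auto
    then show ?thesis using True by simp
  next
    case False
    then have "gaps M \<inter> {..<Suc k} = gaps M \<inter> {..<k}" by (auto simp: less_Suc_eq)
    then show ?thesis using False by simp
  qed
  finally show ?case .
qed

lemma set_mult_absorb: "subgroup M L \<Longrightarrow> D \<subseteq> M \<Longrightarrow> subgroup D L \<Longrightarrow> M <#> D = M"
  using set_mult_subgroup_idem subgroup_incl by blast

lemma gaps_bounded: "F k \<subseteq> M \<Longrightarrow> gaps M \<subseteq> {..<k}"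
proof
  fix i assume kM: "F k \<subseteq> M" and i: "i \<in> gaps M"
  show "i \<in> {..<k}"
  proof (rule ccontr)
    assume "i \<notin> {..<k}"
    then have "F i \<subseteq> M" using F_antimono[of k i] kM by auto
    then show False using i F_not_subset[of i] by (auto simp: gaps_def)
  qed
qed

text \<open>From \<open>k\<close> on \<open>M\<close> has elements of every depth, so it contains \<open>F i\<close> together with \<open>F (Suc i)\<close>; the
  descent starts from some \<open>F K\<close> that \<open>M\<close> contains as a lattice.\<close>

lemma F_subset_if_gaps_bounded:
  assumes M: "M \<in> lattices" and g: "gaps M \<subseteq> {..<k}"
  shows "F k \<subseteq> M"
proof -
  obtain K where K: "F K \<subseteq> M" and Ms: "subgroup M L" using M by (auto simp: lattices_def)
  have step: "F i \<subseteq> M" if "F (Suc i) \<subseteq> M" "k \<le> i" for i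
  proof -
    have "i \<notin> gaps M" using g that by auto
    then obtain x where "x \<in> M" "x \<in> F i" "x \<notin> F (Suc i)" by (auto simp: gaps_def)
    moreover have "subgroup (M \<inter> F i) L" using subgroups_Inter_pair[OF Ms F_subgroup] .
    ultimately have "M \<inter> F i = F i" using between_F[of "M \<inter> F i" i] that F_Suc by blast
    then show ?thesis by blast
  qed
  show ?thesis
  proof (cases "k \<le> K")
    case True
    then show ?thesis using K step by (induction rule: inc_induct) auto
  next
    case False
    then show ?thesis using K F_antimono[of K k] by auto
  qed
qed

lemma finite_gaps: "M \<in> lattices \<Longrightarrow> finite (gaps M)"
  unfolding lattices_def using finite_subset[OF gaps_bounded finite_lessThan] by blast

text \<open>If \<open>x\<close> in \<open>M\<close> has depth \<open>i\<close>, then \<open>x ^ p\<close> in \<open>M\<close> has depth \<open>i + d\<close>.\<close>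

lemma flush_set_gaps:
  assumes M: "M \<in> lattices"
  shows "flush_set d (gaps M)"
proof -
  have "i \<in> gaps M" if i: "i + d \<in> gaps M" for i
    unfolding gaps_def
  proof (intro CollectI subsetI)
    fix x assume x: "x \<in> M \<inter> F i"
    have "x [^] p \<in> M \<inter> F (i + d)"
      using x M subgroup_nat_pow_closed by (auto simp: lattices_def F_shift)
    then have "x [^] p \<in> F (Suc i + d)" using i by (auto simp: gaps_def)
    then show "x \<in> F (Suc i)" using pow_p_mem_iff[of x "Suc i"] x F_carrier by auto
  qed
  then show ?thesis unfolding flush_set_def using finite_gaps[OF M] by blast
qed

lemma rel_index_lattice:
  assumes M: "M \<in> lattices"
  shows "rel_index L (carrier L) M = p ^ card (gaps M)"
proof -
  obtain k where k: "F k \<subseteq> M" and Ms: "subgroup M L" using M by (auto simp: lattices_def)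
  have "M <#> F k = M" using set_mult_absorb[OF Ms k F_subgroup] .
  moreover have "gaps M \<inter> {..<k} = gaps M" using gaps_bounded[OF k] by blast
  ultimately show ?thesis using rel_index_upto[OF Ms, of k] by simp
qed

text \<open>Adding \<open>F k\<close> fills the gaps from \<open>k\<close> on and creates no elements of smaller depth.\<close>

lemma gaps_set_mult_F:
  assumes M: "subgroup M L"
  shows "gaps (M <#> F k) = gaps M \<inter> {..<k}"
proof (intro equalityI subsetI)
  fix i assume i: "i \<in> gaps (M <#> F k)"
  have "i < k" using gaps_bounded[of k "M <#> F k"] set_mult_superset(2)[OF M F_subgroup] i by auto
  moreover have "i \<in> gaps M" using i set_mult_superset(1)[OF M F_subgroup, of k] by (auto simp: gaps_def)
  ultimately show "i \<in> gaps M \<inter> {..<k}" by simp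
next
  fix i assume i: "i \<in> gaps M \<inter> {..<k}"
  show "i \<in> gaps (M <#> F k)" unfolding gaps_def
  proof (intro CollectI subsetI)
    fix x assume x: "x \<in> (M <#> F k) \<inter> F i"
    then obtain m f where mf: "m \<in> M" "f \<in> F k" "x = m \<otimes> f" by (auto simp: set_mult_def)
    have f: "f \<in> F (Suc i)" using mf i F_antimono[of "Suc i" k] by auto
    then have "x \<otimes> inv f \<in> F i"
      using x F_Suc subgroup.m_closed[OF F_subgroup] subgroup.m_inv_closed[OF F_subgroup] by blast
    then have "m \<in> F i" using mf F_carrier subgroup.mem_carrier[OF M] by (simp add: m_assoc)
    then have "m \<in> F (Suc i)" using i mf by (auto simp: gaps_def)
    then show "x \<in> F (Suc i)" using mf f subgroup.m_closed[OF F_subgroup] by simp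
  qed
qed

lemma subgroup_powers:
  assumes M: "subgroup M L"
  shows "subgroup ((\<lambda>x. x [^] p) ` M) L"
proof (rule subgroupI)
  show "inv a \<in> (\<lambda>x. x [^] p) ` M" if "a \<in> (\<lambda>x. x [^] p) ` M" for a
    using that subgroup.mem_carrier[OF M] subgroup.m_inv_closed[OF M] by (auto simp: nat_pow_inv[symmetric])
  show "a \<otimes> b \<in> (\<lambda>x. x [^] p) ` M" if "a \<in> (\<lambda>x. x [^] p) ` M" "b \<in> (\<lambda>x. x [^] p) ` M" for a b
    using that subgroup.mem_carrier[OF M] subgroup.m_closed[OF M] by (auto simp: nat_pow_distrib[symmetric])
qed (use subgroup.mem_carrier[OF M] subgroup.one_closed[OF M] in auto)

text \<open>Below \<open>g\<close> the elements of \<open>F g M ^ p\<close> have the depths of \<open>p\<close>-th powers, which are the depths in \<open>M\<close>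
  shifted by \<open>d\<close>.\<close>

lemma gaps_powers:
  assumes M: "M \<in> lattices" and g: "F g \<subseteq> M"
  defines "N \<equiv> F g <#> (\<lambda>x. x [^] p) ` M"
  shows "N \<in> lattices" "N \<subseteq> M" "gaps N = {i. i < g \<and> (i < d \<or> i - d \<in> gaps M)}"
proof -
  have Ms: "subgroup M L" using M by (auto simp: lattices_def)
  have Mc: "x \<in> M \<Longrightarrow> x \<in> carrier L" for x using subgroup.mem_carrier[OF Ms] .
  have P: "subgroup ((\<lambda>x. x [^] p) ` M) L" by (rule subgroup_powers[OF Ms])
  have Ns: "subgroup N L" unfolding N_def using mult_subgroups[OF F_subgroup P] .
  note sup = set_mult_superset[OF F_subgroup P, of g, folded N_def]
  show NL: "N \<in> lattices" using Ns sup by (auto simp: lattices_def)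
  show "N \<subseteq> M" unfolding N_def
    by (rule set_mult_least[OF Ms g]) (use subgroup_nat_pow_closed[OF Ms] in auto)
  have "i \<in> gaps N \<longleftrightarrow> i < d \<or> i - d \<in> gaps M" if i: "i < g" for i
  proof -
    have *: "i \<in> gaps N \<longleftrightarrow> (\<forall>a\<in>M. a [^] p \<in> F i \<longrightarrow> a [^] p \<in> F (Suc i))"
    proof
      assume "i \<in> gaps N" then show "\<forall>a\<in>M. a [^] p \<in> F i \<longrightarrow> a [^] p \<in> F (Suc i)"
        using sup by (auto simp: gaps_def)
    next
      assume a: "\<forall>a\<in>M. a [^] p \<in> F i \<longrightarrow> a [^] p \<in> F (Suc i)"
      show "i \<in> gaps N" unfolding gaps_def
      proof (intro CollectI subsetI)
        fix x assume x: "x \<in> N \<inter> F i"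
        then obtain f m where mf: "m \<in> M" "f \<in> F g" "x = f \<otimes> m [^] p" by (auto simp: N_def set_mult_def)
        have f: "f \<in> F (Suc i)" using mf i F_antimono[of "Suc i" g] by auto
        then have "inv f \<otimes> x \<in> F i"
          using x F_Suc subgroup.m_closed[OF F_subgroup] subgroup.m_inv_closed[OF F_subgroup] by blast
        then have "m [^] p \<in> F i" using mf F_carrier Mc by (simp add: m_assoc[symmetric])
        then have "m [^] p \<in> F (Suc i)" using a mf by auto
        then show "x \<in> F (Suc i)" using mf f subgroup.m_closed[OF F_subgroup] by simp
      qed
    qed
    show ?thesis
    proof (cases "i < d")
      case True
      have "a [^] p \<in> F (Suc i)" if "a \<in> M" for a
        using pow_p_mem_iff[of a 0] Mc[OF that] F_0 F_antimono[of "Suc i" d] True by auto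
      then show ?thesis using * True by auto
    next
      case False
      then obtain j where j: "i = j + d" by (metis add.commute le_Suc_ex not_less)
      have "(\<forall>a\<in>M. a [^] p \<in> F i \<longrightarrow> a [^] p \<in> F (Suc i)) \<longleftrightarrow> (\<forall>a\<in>M. a \<in> F j \<longrightarrow> a \<in> F (Suc j))"
        unfolding j using pow_p_mem_iff[of _ j] pow_p_mem_iff[of _ "Suc j"] Mc by (metis add_Suc)
      then show ?thesis using * j by (auto simp: gaps_def)
    qed
  qed
  moreover have "i < g" if "i \<in> gaps N" for i using gaps_bounded[of g N] sup that by auto
  ultimately show "gaps N = {i. i < g \<and> (i < d \<or> i - d \<in> gaps M)}" by blast
qed

lemma rel_index_between_lattices:
  assumes M: "M \<in> lattices" and N: "N \<in> lattices" and "N \<subseteq> M"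
  shows "rel_index L M N = p ^ card (gaps N - gaps M)"
proof -
  have sub: "gaps M \<subseteq> gaps N" using assms(3) by (auto simp: gaps_def)
  have p0: "p > 0" using prime_p by (simp add: prime_gt_0_nat)
  have Ms: "subgroup M L" "subgroup N L" using M N by (auto simp: lattices_def)
  have "p ^ card (gaps N) = p ^ card (gaps M) * rel_index L M N"
    using rel_index_trans[OF subgroup_self Ms(1,2) assms(3) subgroup.subset[OF Ms(1)]]
      rel_index_lattice[OF M] rel_index_lattice[OF N] by simp
  moreover have "card (gaps N) = card (gaps M) + card (gaps N - gaps M)"
    using sub finite_gaps[OF N] finite_gaps[OF M] by (metis card_Diff_subset card_mono le_add_diff_inverse)
  ultimately show ?thesis using p0 by (simp add: power_add)
qed

text \<open>A lattice \<open>N\<close> with largest gap \<open>g\<close> is a complement of \<open>F g\<close> over \<open>F (Suc g)\<close> in the lattice \<open>M = N F g\<close>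
  in which the gap \<open>g\<close> is filled. The number of complements is the index of \<open>F g M ^ p\<close> in \<open>M\<close>, and the
  gaps of this subgroup that are not gaps of \<open>M\<close> are the corners of \<open>S - {g}\<close> below \<open>g\<close>.\<close>

lemma card_lattices_above:
  assumes S: "flush_set d S" "S \<noteq> {}" and g: "g = Max S"
    and M: "M \<in> lattices" and gM: "gaps M = S - {g}"
  shows "finite {N \<in> lattices. gaps N = S \<and> N <#> F g = M} \<and>
    card {N \<in> lattices. gaps N = S \<and> N <#> F g = M} = p ^ card {i \<in> corners d (S - {g}). i < g}"
proof -
  have fin: "finite S" using S by (simp add: flush_set_def)
  have gS: "g \<in> S" using fin S by (simp add: g)
  have le: "h \<le> g" if "h \<in> S" for h using that fin by (simp add: g)
  have Ms: "subgroup M L" using M by (auto simp: lattices_def)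
  have gb: "gaps M \<subseteq> {..<g}" using gM le by force
  have FM: "F g \<subseteq> M" using F_subset_if_gaps_bounded[OF M gb] .
  have pow: "a [^] p \<in> F (Suc g)" if a: "a \<in> M" "a [^] p \<in> F g" for a
  proof (cases "g < d")
    case True
    have ac: "a \<in> carrier L" using a subgroup.mem_carrier[OF Ms] by auto
    show ?thesis using pow_p_mem_iff[OF ac, of 0] F_0 ac F_antimono[of "Suc g" d] True by auto
  next
    case False
    have ac: "a \<in> carrier L" using a subgroup.mem_carrier[OF Ms] by auto
    obtain i where i: "g = i + d" using False by (metis add.commute le_Suc_ex not_less)
    have "i \<in> gaps M" using S gS d_pos unfolding gM i by (auto simp: flush_set_def)
    moreover have "a \<in> F i" using pow_p_mem_iff[OF ac, of i] a i by simp
    ultimately have "a \<in> F (Suc i)" using a by (auto simp: gaps_def)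
    then show ?thesis using pow_p_mem_iff[OF ac, of "Suc i"] i by simp
  qed
  have comm: "commutators_in L M (F (Suc g))"
    unfolding commutators_in_def
  proof (intro ballI)
    fix a b assume "a \<in> M" "b \<in> M"
    then have ab: "a \<in> carrier L" "b \<in> carrier L" using subgroup.mem_carrier[OF Ms] by auto
    then have "a \<otimes> b \<otimes> inv a \<otimes> inv b = b \<otimes> a \<otimes> inv a \<otimes> inv b" by (simp add: m_comm)
    also have "\<dots> = \<one>" using ab by (simp add: m_assoc)
    finally have "a \<otimes> b \<otimes> inv a \<otimes> inv b = \<one>" .
    then show "a \<otimes> b \<otimes> inv a \<otimes> inv b \<in> F (Suc g)" using subgroup.one_closed[OF F_subgroup] by simp
  qed
  note P = gaps_powers[OF M FM]
  have "rel_index L M (F g <#> (\<lambda>x. x [^] p) ` M) = p ^ card ({i. i < g \<and> (i < d \<or> i - d \<in> gaps M)} - gaps M)"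
    using rel_index_between_lattices[OF M P(1,2)] P(3) by simp
  also have "{i. i < g \<and> (i < d \<or> i - d \<in> gaps M)} - gaps M = {i \<in> corners d (S - {g}). i < g}"
    unfolding gM by (auto simp: corners_def)
  finally have idx: "rel_index L M (F g <#> (\<lambda>x. x [^] p) ` M) = p ^ card {i \<in> corners d (S - {g}). i < g}" .
  have eq: "{N \<in> lattices. gaps N = S \<and> N <#> F g = M} =
    {B. subgroup B L \<and> F (Suc g) \<subseteq> B \<and> B <#> F g = M \<and> B \<inter> F g = F (Suc g)}"
  proof (intro equalityI subsetI)
    fix N assume "N \<in> {N \<in> lattices. gaps N = S \<and> N <#> F g = M}"
    then have N: "N \<in> lattices" "gaps N = S" "N <#> F g = M" by auto
    have "gaps N \<subseteq> {..<Suc g}" using N le by (auto simp: less_Suc_eq_le)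
    then have 1: "F (Suc g) \<subseteq> N" using F_subset_if_gaps_bounded[OF N(1)] by blast
    moreover have "N \<inter> F g \<subseteq> F (Suc g)" using N gS by (auto simp: gaps_def)
    ultimately show "N \<in> {B. subgroup B L \<and> F (Suc g) \<subseteq> B \<and> B <#> F g = M \<and> B \<inter> F g = F (Suc g)}"
      using N F_Suc by (auto simp: lattices_def)
  next
    fix B assume "B \<in> {B. subgroup B L \<and> F (Suc g) \<subseteq> B \<and> B <#> F g = M \<and> B \<inter> F g = F (Suc g)}"
    then have B: "subgroup B L" "F (Suc g) \<subseteq> B" "B <#> F g = M" "B \<inter> F g = F (Suc g)" by auto
    have BL: "B \<in> lattices" using B by (auto simp: lattices_def)
    have gB: "gaps B \<subseteq> {..<Suc g}" "g \<in> gaps B"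
      using gaps_bounded[OF B(2)] B by (auto simp: gaps_def)
    have "gaps B = insert g (gaps B \<inter> {..<g})"
      using subsetD[OF gB(1)] gB(2) by (auto simp: less_Suc_eq)
    also have "gaps B \<inter> {..<g} = S - {g}" using gaps_set_mult_F[OF B(1), of g] B gM by simp
    finally have "gaps B = S" using gS by (simp add: insert_absorb)
    then show "B \<in> {N \<in> lattices. gaps N = S \<and> N <#> F g = M}" using B BL by auto
  qed
  show ?thesis
    unfolding eq idx[symmetric]
  proof (rule card_complements_in_subgroup[OF prime_p Ms F_subgroup F_subgroup F_Suc FM comm pow F_index])
    show "rel_index L M (F g <#> (\<lambda>a. a [^] p) ` M) \<noteq> 0"
      using idx prime_p by (simp add: prime_gt_0_nat)
  qed
qed

text \<open>Remove the gaps one by one, starting from the largest.\<close>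

theorem card_lattices_with_gaps:
  assumes "flush_set d S"
  shows "finite {M \<in> lattices. gaps M = S} \<and> card {M \<in> lattices. gaps M = S} = p ^ gap_weight d S"
  using assms
proof (induction "card S" arbitrary: S rule: less_induct)
  case less
  have fin: "finite S" using less.prems by (simp add: flush_set_def)
  show ?case
  proof (cases "S = {}")
    case True
    have "{M \<in> lattices. gaps M = S} = {carrier L}"
    proof (intro equalityI subsetI)
      fix M assume M: "M \<in> {M \<in> lattices. gaps M = S}"
      then have "F 0 \<subseteq> M" using F_subset_if_gaps_bounded[of M 0] True by auto
      moreover have "subgroup M L" using M by (auto simp: lattices_def)
      ultimately show "M \<in> {carrier L}" using F_0 subgroup.subset[of M L] by blast
    next
      fix M assume "M \<in> {carrier L}"
      moreover have "gaps (carrier L) = {}" using gaps_bounded[of 0 "carrier L"] F_0 by auto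
      ultimately show "M \<in> {M \<in> lattices. gaps M = S}"
        using True subgroup_self F_0 by (auto simp: lattices_def)
    qed
    then show ?thesis using True by (simp add: gap_weight_def)
  next
    case False
    define g where "g = Max S"
    have gS: "g \<in> S" using fin False by (simp add: g_def)
    let ?T = "{M \<in> lattices. gaps M = S - {g}}"
    have IH: "finite ?T \<and> card ?T = p ^ gap_weight d (S - {g})"
      by (rule less.hyps[OF card_Diff1_less[OF fin gS]])
         (use flush_set_remove_Max[OF less.prems False d_pos] in \<open>simp add: g_def\<close>)
    have "finite {N \<in> lattices. gaps N = S} \<and> card {N \<in> lattices. gaps N = S} =
       (\<Sum>M\<in>?T. p ^ card {i \<in> corners d (S - {g}). i < g})"
    proof (rule card_by_fibres[where h = "\<lambda>N. N <#> F g"])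
      show "finite ?T" using IH by simp
      show "N <#> F g \<in> ?T" if "N \<in> {N \<in> lattices. gaps N = S}" for N
      proof -
        have N: "subgroup N L" "gaps N = S" using that by (auto simp: lattices_def)
        have "S \<inter> {..<g} = S - {g}" using fin by (force simp: g_def order.strict_iff_order)
        then show ?thesis
          using gaps_set_mult_F[OF N(1), of g] N subgroup_set_mult_F[OF N(1), of g]
            set_mult_superset(2)[OF N(1) F_subgroup, of g] by (auto simp: lattices_def)
      qed
      show "finite {N \<in> {N \<in> lattices. gaps N = S}. N <#> F g = M} \<and>
         card {N \<in> {N \<in> lattices. gaps N = S}. N <#> F g = M} = p ^ card {i \<in> corners d (S - {g}). i < g}"
        if M: "M \<in> ?T" for M
      proof -
        have "{N \<in> {N \<in> lattices. gaps N = S}. N <#> F g = M} = {N \<in> lattices. gaps N = S \<and> N <#> F g = M}"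
          by auto
        then show ?thesis
          using card_lattices_above[OF less.prems False g_def] M by simp
      qed
    qed
    moreover have "(\<Sum>M\<in>?T. p ^ card {i \<in> corners d (S - {g}). i < g}) = p ^ gap_weight d S"
      using gap_weight_remove_Max[OF less.prems False d_pos] IH by (simp add: g_def power_add mult.commute)
    ultimately show ?thesis by simp
  qed
qed

end

section \<open>Subgroups with given image modulo a central subgroup\<close>

context group
begin

text \<open>The statement about the whole group is transported to the subgroup \<open>A\<close>, where alone the
  commutator condition holds.\<close>

lemma subgroup_powers_mod_in_subgroup:
  assumes A: "subgroup A G" and E: "subgroup E G" and "E \<subseteq> A" and comm: "commutators_in G A E"
  shows "subgroup (E <#> (\<lambda>a. a [^] (n::nat)) ` A) G"
proof -
  let ?A = "G\<lparr>carrier := A\<rparr>"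
  interpret A: group ?A using subgroup_imp_group[OF A] .
  have pw: "x [^]\<^bsub>?A\<^esub> (n::nat) = x [^] n" for x n using nat_pow_consistent by metis
  have sm: "S <#>\<^bsub>?A\<^esub> T = S <#> T" for S T by (simp add: set_mult_def)
  have "commutators_in ?A A E" using comm by (simp add: commutators_in_carrier_update[OF A])
  then have "subgroup (E <#>\<^bsub>?A\<^esub> (\<lambda>a. a [^]\<^bsub>?A\<^esub> n) ` carrier ?A) ?A"
    by (intro A.subgroup_powers_mod) (use E assms(3) in \<open>auto simp: subgroup_carrier_update_iff[OF A]\<close>)
  then show ?thesis by (simp add: pw sm subgroup_carrier_update_iff[OF A])
qed

lemma subgroup_set_mult_central:
  assumes N: "subgroup N G" and D: "subgroup D G"
    and central: "\<And>z g. z \<in> D \<Longrightarrow> g \<in> carrier G \<Longrightarrow> z \<otimes> g = g \<otimes> z"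
  shows "subgroup (N <#> D) G"
proof -
  have Dc: "z \<in> D \<Longrightarrow> z \<in> carrier G" for z using subgroup.mem_carrier[OF D] .
  have "D \<lhd> G"
  proof (rule normal_invI[OF D])
    fix x h assume "x \<in> carrier G" "h \<in> D"
    then show "x \<otimes> h \<otimes> inv x \<in> D" using central[of h x, symmetric] Dc by (simp add: m_assoc)
  qed
  then show ?thesis using set_mult_normal_subgroup[OF _ N] commut_normal[OF N] by simp
qed

lemma pow_mult_distrib_commuting:
  assumes "a \<in> carrier G" "z \<in> carrier G" "\<And>g. g \<in> carrier G \<Longrightarrow> z \<otimes> g = g \<otimes> z"
  shows "(a \<otimes> z) [^] (k::nat) = a [^] k \<otimes> z [^] k"
proof (induction k)
  case (Suc k)
  have "z [^] k \<otimes> a = a \<otimes> z [^] k"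
  proof (induction k)
    case (Suc k)
    have "z [^] Suc k \<otimes> a = z [^] k \<otimes> (z \<otimes> a)" using assms by (simp add: m_assoc)
    also have "\<dots> = (z [^] k \<otimes> a) \<otimes> z" using assms by (simp add: m_assoc)
    also have "\<dots> = a \<otimes> z [^] Suc k" using Suc assms by (simp add: m_assoc)
    finally show ?case .
  qed (use assms in simp)
  then have "a [^] k \<otimes> z [^] k \<otimes> (a \<otimes> z) = a [^] k \<otimes> a \<otimes> (z [^] k \<otimes> z)"
    using assms(1,2) by (simp add: m_assoc) (simp add: m_assoc[symmetric])
  then show ?case using Suc assms(1,2) by simp
qed simp

text \<open>A subgroup \<open>N\<close> with \<open>N Z = P\<close> is a lift of \<open>P / Z\<close> up to the ambiguity \<open>N \<inter> Z\<close>. The ambiguity is reduced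
  from \<open>E k = Z\<close>, where \<open>N = P\<close> is the only lift, to \<open>E 0\<close> in steps of index \<open>p\<close>. Given a lift \<open>N'\<close> with
  ambiguity \<open>E 1\<close>, the lifts inside it with ambiguity \<open>E 0\<close> are the complements of \<open>E 1\<close> over \<open>E 0\<close> in \<open>N'\<close>. As
  \<open>N' Z = P\<close>, the index in \<open>N'\<close> of the subgroup generated by \<open>E 1\<close> and the \<open>p\<close>-th powers is that of
  \<open>Z P ^ p\<close> in \<open>P\<close>, so each step multiplies the number of lifts by the same factor \<open>c\<close>. That \<open>P / Z\<close> has
  no \<open>p\<close>-torsion ensures that \<open>p\<close>-th powers in \<open>E 1\<close> come from \<open>E 1\<close> and so lie in \<open>E 0\<close>.\<close>

theorem card_extensions:
  assumes p: "Factorial_Ring.prime (p::nat)"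
    and Z: "subgroup Z G" and P: "subgroup P G" and ZP: "Z \<subseteq> P"
    and central: "\<And>z g. z \<in> Z \<Longrightarrow> g \<in> carrier G \<Longrightarrow> z \<otimes> g = g \<otimes> z"
    and tf: "\<And>x. x \<in> P \<Longrightarrow> x [^] p \<in> Z \<Longrightarrow> x \<in> Z"
    and idx: "rel_index G P (Z <#> (\<lambda>a. a [^] p) ` P) = c" "c \<noteq> 0"
    and E: "\<And>i. i \<le> k \<Longrightarrow> subgroup (E i) G" "\<And>i. i < k \<Longrightarrow> E i \<subseteq> E (Suc i)" "E k = Z"
    and Ei: "\<And>i. i < k \<Longrightarrow> rel_index G (E (Suc i)) (E i) = p"
    and Ep: "\<And>i x. i < k \<Longrightarrow> x \<in> E (Suc i) \<Longrightarrow> x [^] p \<in> E i"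
    and comm: "commutators_in G P (E 0)"
  shows "finite {N. subgroup N G \<and> N <#> Z = P \<and> N \<inter> Z = E 0} \<and>
    card {N. subgroup N G \<and> N <#> Z = P \<and> N \<inter> Z = E 0} = c ^ k \<and>
    (\<forall>N. subgroup N G \<and> N <#> Z = P \<and> N \<inter> Z = E 0 \<longrightarrow> rel_index G P N = p ^ k)"
  using E Ei Ep comm
proof (induction k arbitrary: E)
  case 0
  then have E0: "E 0 = Z" by simp
  have eq: "N = P" if N: "subgroup N G" "N <#> Z = P" "N \<inter> Z = Z" for N
  proof -
    have "Z \<subseteq> N" using N by blast
    then show ?thesis using N set_mult_subgroup_idem[OF N(1) subgroup_incl[OF Z N(1)]] by simp
  qed
  have "{N. subgroup N G \<and> N <#> Z = P \<and> N \<inter> Z = E 0} = {P}"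
    using eq E0 P ZP set_mult_subgroup_idem[OF P subgroup_incl[OF Z P ZP]] by auto
  moreover have "rel_index G P N = 1" if "subgroup N G \<and> N <#> Z = P \<and> N \<inter> Z = E 0" for N
    using eq[of N] that E0 rel_index_refl[OF P] by simp
  ultimately show ?case by simp
next
  case (Suc k)
  have E0: "subgroup (E 0) G" and E1: "subgroup (E 1) G" using Suc.prems(1)[of 0] Suc.prems(1)[of 1] by auto
  have E01: "E 0 \<subseteq> E 1" using Suc.prems(2)[of 0] by simp
  have EZ: "E (Suc i) \<subseteq> Z" if "i \<le> k" for i
    using that
  proof (induction rule: inc_induct)
    case base then show ?case using Suc.prems(3) by simp
  next
    case (step m) then show ?case using Suc.prems(2)[of "Suc m"] by auto
  qed
  have E1Z: "E 1 \<subseteq> Z" using EZ[of 0] by simp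
  have Zc: "z \<in> Z \<Longrightarrow> z \<in> carrier G" for z using subgroup.mem_carrier[OF Z] .
  have central1: "z \<otimes> g = g \<otimes> z" if "z \<in> E 1" "g \<in> carrier G" for z g using central E1Z that by auto
  let ?T = "{N. subgroup N G \<and> N <#> Z = P \<and> N \<inter> Z = E 1}"
  let ?S = "{N. subgroup N G \<and> N <#> Z = P \<and> N \<inter> Z = E 0}"
  have comm1: "commutators_in G P (E 1)" using commutators_in_mono[OF Suc.prems(6) E01] by auto
  have IH: "finite ?T \<and> card ?T = c ^ k \<and> (\<forall>N. subgroup N G \<and> N <#> Z = P \<and> N \<inter> Z = E 1 \<longrightarrow> rel_index G P N = p ^ k)"
    using Suc.IH[of "\<lambda>i. E (Suc i)"] Suc.prems comm1 by simp
  have up: "N <#> E 1 \<in> ?T" if N: "N \<in> ?S" for N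
  proof -
    have Ns: "subgroup N G" and NZ: "N <#> Z = P" and NE: "N \<inter> Z = E 0" using N by auto
    have Nc: "z \<in> N \<Longrightarrow> z \<in> carrier G" for z using subgroup.mem_carrier[OF Ns] .
    have sub: "subgroup (N <#> E 1) G" by (rule subgroup_set_mult_central[OF Ns E1 central1])
    have "N <#> E 1 <#> Z = N <#> (E 1 <#> Z)"
      using set_mult_assoc Ns E1 Z subgroup.subset by metis
    also have "E 1 <#> Z = Z"
      using set_mult_superset(2)[OF E1 Z] set_mult_least[OF Z E1Z order.refl] by blast
    finally have 1: "N <#> E 1 <#> Z = P" using NZ by simp
    have "(N <#> E 1) \<inter> Z \<subseteq> E 1"
    proof
      fix x assume x: "x \<in> (N <#> E 1) \<inter> Z"
      then obtain a b where ab: "a \<in> N" "b \<in> E 1" "x = a \<otimes> b" by (auto simp: set_mult_def)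
      have "x \<otimes> inv b \<in> Z" using x ab E1Z subgroup.m_closed[OF Z] subgroup.m_inv_closed[OF Z] by auto
      then have "a \<in> Z" using ab Nc Zc E1Z by (auto simp: m_assoc)
      then have "a \<in> E 1" using ab NE E01 by blast
      then show "x \<in> E 1" using ab subgroup.m_closed[OF E1] by simp
    qed
    then have "(N <#> E 1) \<inter> Z = E 1" using set_mult_superset(2)[OF Ns E1] E1Z by blast
    with sub 1 show ?thesis by simp
  qed
  have fib: "{N \<in> ?S. N <#> E 1 = N'} = {B. subgroup B G \<and> E 0 \<subseteq> B \<and> B <#> E 1 = N' \<and> B \<inter> E 1 = E 0}"
    if N': "N' \<in> ?T" for N'
  proof (intro equalityI subsetI)
    fix N assume "N \<in> {N \<in> ?S. N <#> E 1 = N'}"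
    moreover then have "N \<inter> E 1 = E 0" using E1Z E01 by blast
    ultimately show "N \<in> {B. subgroup B G \<and> E 0 \<subseteq> B \<and> B <#> E 1 = N' \<and> B \<inter> E 1 = E 0}" by blast
  next
    fix B assume "B \<in> {B. subgroup B G \<and> E 0 \<subseteq> B \<and> B <#> E 1 = N' \<and> B \<inter> E 1 = E 0}"
    then have B: "subgroup B G" "E 0 \<subseteq> B" "B <#> E 1 = N'" "B \<inter> E 1 = E 0" by auto
    have "B <#> E 1 <#> Z = B <#> (E 1 <#> Z)"
      using set_mult_assoc B(1) E1 Z subgroup.subset by metis
    also have "E 1 <#> Z = Z"
      using set_mult_superset(2)[OF E1 Z] set_mult_least[OF Z E1Z order.refl] by blast
    finally have 1: "B <#> Z = P" using N' B by simp
    have "B \<subseteq> N'" using B set_mult_superset(1)[OF B(1) E1] by simp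
    then have "B \<inter> Z = B \<inter> (N' \<inter> Z)" by blast
    also have "\<dots> = E 0" using N' B by simp
    finally show "B \<in> {N \<in> ?S. N <#> E 1 = N'}" using 1 B by simp
  qed
  have cardfib: "finite {N \<in> ?S. N <#> E 1 = N'} \<and> card {N \<in> ?S. N <#> E 1 = N'} = c"
    if N': "N' \<in> ?T" for N'
  proof -
    have N's: "subgroup N' G" and N'Z: "N' <#> Z = P" and N'E: "N' \<inter> Z = E 1" using N' by auto
    have N'c: "z \<in> N' \<Longrightarrow> z \<in> carrier G" for z using subgroup.mem_carrier[OF N's] .
    have N'P: "N' \<subseteq> P" using set_mult_superset(1)[OF N's Z] N'Z by simp
    have E1N': "E 1 \<subseteq> N'" using N'E by blast
    define Q where "Q = Z <#> (\<lambda>a. a [^] p) ` P"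
    have commZ: "commutators_in G P Z" using commutators_in_mono[OF comm1 E1Z] by auto
    have Q: "subgroup Q G" unfolding Q_def by (rule subgroup_powers_mod_in_subgroup[OF P Z ZP commZ])
    have ZQ: "Z \<subseteq> Q"
    proof
      fix z assume "z \<in> Z"
      then have "z = z \<otimes> \<one> [^] p" using Zc by simp
      then show "z \<in> Q" unfolding Q_def set_mult_def using \<open>z \<in> Z\<close> subgroup.one_closed[OF P] by blast
    qed
    have QP: "Q \<subseteq> P" unfolding Q_def
      by (rule set_mult_least[OF P ZP]) (use subgroup_nat_pow_closed[OF P] in auto)
    have QN: "Q <#> N' = P"
    proof
      show "Q <#> N' \<subseteq> P" by (rule set_mult_least[OF P QP N'P])
      show "P \<subseteq> Q <#> N'"
      proof
        fix x assume "x \<in> P"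
        then have "x \<in> N' <#> Z" using N'Z by simp
        then obtain a z where az: "a \<in> N'" "z \<in> Z" "x = a \<otimes> z" by (auto simp: set_mult_def)
        then have "x = z \<otimes> a" using central N'c by simp
        then show "x \<in> Q <#> N'" using az ZQ unfolding set_mult_def by blast
      qed
    qed
    have QiN: "Q \<inter> N' = E 1 <#> (\<lambda>a. a [^] p) ` N'"
    proof (intro equalityI subsetI)
      fix x assume x: "x \<in> Q \<inter> N'"
      then obtain z a where za: "z \<in> Z" "a \<in> P" "x = z \<otimes> a [^] p" by (auto simp: Q_def set_mult_def)
      have "a \<in> N' <#> Z" using za N'Z by simp
      then obtain b y where b: "b \<in> N'" "y \<in> Z" "a = b \<otimes> y" by (auto simp: set_mult_def)
      have bp: "b [^] p \<in> N'" using subgroup_nat_pow_closed[OF N's b(1)] .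
      have yp: "y [^] p \<in> Z" using subgroup_nat_pow_closed[OF Z b(2)] .
      have "a [^] p = y [^] p \<otimes> b [^] p"
        using pow_mult_distrib_commuting[of b y p] b N'c Zc central central[OF yp, of "b [^] p"] by simp
      then have xe: "x = (z \<otimes> y [^] p) \<otimes> b [^] p" using za b N'c Zc by (simp add: m_assoc)
      have "x \<otimes> inv (b [^] p) \<in> N'"
        using x bp subgroup.m_closed[OF N's] subgroup.m_inv_closed[OF N's] by auto
      then have "z \<otimes> y [^] p \<in> N'" using xe za b N'c Zc by (simp add: m_assoc)
      moreover have "z \<otimes> y [^] p \<in> Z" using za yp subgroup.m_closed[OF Z] by simp
      ultimately have "z \<otimes> y [^] p \<in> E 1" using N'E by blast
      then show "x \<in> E 1 <#> (\<lambda>a. a [^] p) ` N'" using xe b unfolding set_mult_def by blast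
    next
      fix x assume "x \<in> E 1 <#> (\<lambda>a. a [^] p) ` N'"
      then obtain z b where zb: "z \<in> E 1" "b \<in> N'" "x = z \<otimes> b [^] p" by (auto simp: set_mult_def)
      have "x \<in> N'" using zb E1N' subgroup.m_closed[OF N's] subgroup_nat_pow_closed[OF N's] by auto
      moreover have "x \<in> Q" unfolding Q_def set_mult_def using zb E1Z N'P by blast
      ultimately show "x \<in> Q \<inter> N'" by simp
    qed
    have ci: "rel_index G N' (E 1 <#> (\<lambda>a. a [^] p) ` N') = c"
      using rel_index_second_iso[OF Q N's] idx(1) unfolding QN QiN Q_def[symmetric] by simp
    have pow0: "a [^] p \<in> E 0" if a: "a \<in> N'" "a [^] p \<in> E 1" for a
    proof -
      have "a \<in> Z" using tf a N'P E1Z by blast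
      then have "a \<in> E 1" using a N'E by blast
      then show ?thesis using Suc.prems(5)[of 0 a] by simp
    qed
    have comm0: "commutators_in G N' (E 0)" using commutators_in_mono[OF Suc.prems(6) order.refl N'P] .
    have i0: "rel_index G (E 1) (E 0) = p" using Suc.prems(4)[of 0] by simp
    show ?thesis unfolding fib[OF N']
      using card_complements_in_subgroup[OF p N's E0 E1 E01 E1N' comm0 pow0 i0] ci idx(2) by simp
  qed
  have "finite ?S \<and> card ?S = (\<Sum>N'\<in>?T. c)"
    by (rule card_by_fibres[where h = "\<lambda>N. N <#> E 1"]) (use IH up cardfib in blast)+
  moreover have "(\<Sum>N'\<in>?T. c) = c ^ Suc k" using IH by simp
  moreover have "rel_index G P N = p ^ Suc k" if N: "subgroup N G \<and> N <#> Z = P \<and> N \<inter> Z = E 0" for N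
  proof -
    have N1: "N <#> E 1 \<in> ?T" using up N by blast
    then have N1s: "subgroup (N <#> E 1) G" and "rel_index G P (N <#> E 1) = p ^ k" using IH by blast+
    moreover have "rel_index G P N = rel_index G P (N <#> E 1) * rel_index G (N <#> E 1) N"
      by (rule rel_index_trans[OF P N1s]) (use N N1 set_mult_superset(1)[OF _ E1, of N] set_mult_superset(1)[OF N1s Z] in auto)
    moreover have "rel_index G (N <#> E 1) N = rel_index G (E 1) (N \<inter> E 1)"
      using rel_index_second_iso[OF _ E1] N by blast
    moreover have "N \<inter> E 1 = E 0" using N E1Z E01 by blast
    ultimately show ?thesis using Suc.prems(4)[of 0] by simp
  qed
  ultimately show ?case by simp
qed

end

section \<open>The filtration of a finite extension of the p-adic integers\<close>

text \<open>Such a set consists of the multiples of its least positive element, by division with remainder.\<close>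

lemma Gcd_mem_if_closed:
  fixes S :: "nat set"
  assumes "0 \<in> S" and add: "\<And>k l. k \<in> S \<Longrightarrow> l \<in> S \<Longrightarrow> k + l \<in> S"
    and diff: "\<And>k l. k + l \<in> S \<Longrightarrow> l \<in> S \<Longrightarrow> k \<in> S"
  shows "k \<in> S \<longleftrightarrow> Gcd S dvd k"
proof
  assume "k \<in> S" then show "Gcd S dvd k" by (rule Gcd_dvd)
next
  assume k: "Gcd S dvd k"
  have mult: "c * m \<in> S" if "c \<in> S" for c m
    by (induction m) (use assms(1) add that in auto)
  show "k \<in> S"
  proof (cases "S \<subseteq> {0}")
    case True
    then have "S = {0}" using assms(1) by auto
    then show ?thesis using k by simp
  next
    case False
    define c where "c = (LEAST c. c \<in> S \<and> c > 0)"
    have "\<exists>c. c \<in> S \<and> c > 0" using False by auto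
    from LeastI_ex[OF this] have c: "c \<in> S" "c > 0" by (auto simp: c_def)
    have "c dvd l" if l: "l \<in> S" for l
    proof -
      have "l mod c + c * (l div c) \<in> S" using l by simp
      then have "l mod c \<in> S" using diff mult c by blast
      moreover have "l mod c < c" using c by simp
      ultimately have "l mod c = 0" using not_less_Least[of "l mod c" "\<lambda>c. c \<in> S \<and> c > 0"] by (auto simp: c_def)
      then show ?thesis by auto
    qed
    then have "c dvd Gcd S" by (rule Gcd_greatest)
    then have "c dvd k" using k by (rule dvd_trans)
    then show ?thesis using mult[OF c(1)] by (auto elim!: dvdE)
  qed
qed

lemma (in ring) add_pow_one_eq_zero_iff: "[(k::nat)] \<cdot> \<one> = \<zero> \<longleftrightarrow> ring_char R dvd k"
proof -
  have "k \<in> {k::nat. [k] \<cdot> \<one> = \<zero>} \<longleftrightarrow> Gcd {k::nat. [k] \<cdot> \<one> = \<zero>} dvd k"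
  proof (rule Gcd_mem_if_closed)
    fix k l :: nat assume a: "k + l \<in> {k::nat. [k] \<cdot> \<one> = \<zero>}" "l \<in> {k::nat. [k] \<cdot> \<one> = \<zero>}"
    have "[k] \<cdot> \<one> \<oplus> [l] \<cdot> \<one> = [(k + l)] \<cdot> \<one>" by (simp add: add.nat_pow_mult)
    then show "k \<in> {k::nat. [k] \<cdot> \<one> = \<zero>}" using a by simp
  qed (auto simp: add.nat_pow_mult[symmetric])
  then show ?thesis by (simp add: ring_char_def)
qed

text \<open>The multiples of \<open>1\<close> already form a field: multiplication by a nonzero one of them is injective on
  a finite set, which provides inverses.\<close>

lemma (in field) card_prime_subfield:
  assumes p: "ring_char R = p" "p > 0"
  shows "card (generate_field R {}) = p"
proof -
  define g where "g = (\<lambda>k::nat. [k] \<cdot> \<one>)"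
  have g_add: "g (k + l) = g k \<oplus> g l" for k l by (simp add: g_def add.nat_pow_mult)
  have g_c: "g k \<in> carrier R" for k by (simp add: g_def)
  have g_mult: "g (k * l) = g k \<otimes> g l" for k l
    by (induction k) (simp_all add: g_def add.nat_pow_mult[symmetric] l_distr a_comm)
  have g_zero: "g k = \<zero> \<longleftrightarrow> p dvd k" for k using add_pow_one_eq_zero_iff p by (simp add: g_def)
  have g_mod: "g k = g (k mod p)" for k
  proof -
    have "g k = g (p * (k div p) + k mod p)" by simp
    also have "\<dots> = g (p * (k div p)) \<oplus> g (k mod p)" by (rule g_add)
    also have "g (p * (k div p)) = \<zero>" using g_zero by simp
    finally show ?thesis using g_c by simp
  qed
  let ?K = "g ` {..<p}"
  have gK: "g k \<in> ?K" for k using g_mod[of k] p by (intro image_eqI[of _ _ "k mod p"]) auto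
  have "h \<in> ?K" if "h \<in> generate_field R {}" for h
    using that
  proof (induction rule: generate_field.induct)
    case one show ?case using gK[of 1] by (simp add: g_def)
  next
    case (a_inv h)
    then obtain k where k: "h = g k" by auto
    have "g ((p - 1) * k) \<oplus> g k = g ((p - 1) * k + k)" by (simp only: g_add)
    also have "(p - 1) * k + k = p * k" using p by (cases p) auto
    also have "g (p * k) = \<zero>" using g_zero by simp
    finally have "\<ominus> h = g ((p - 1) * k)" using k g_c minus_equality by metis
    then show ?case using gK by simp
  next
    case (m_inv h)
    then obtain k where k: "h = g k" by auto
    have hU: "h \<in> Units R" using m_inv k g_c field_Units by auto
    have "(\<lambda>x. h \<otimes> x) ` ?K = ?K"
    proof (rule endo_inj_surj)
      show "(\<lambda>x. h \<otimes> x) ` ?K \<subseteq> ?K" using k g_mult[symmetric] gK by auto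
      show "inj_on (\<lambda>x. h \<otimes> x) ?K"
        using hU g_c Units_l_cancel by (auto simp: inj_on_def)
    qed simp
    moreover have "\<one> \<in> ?K" using gK[of 1] by (simp add: g_def)
    ultimately obtain l where "\<one> = h \<otimes> g l" by auto
    then have "inv h = g l" using k g_c comm_inv_char by metis
    then show ?case using gK by simp
  next
    case (eng_add h1 h2)
    then show ?case using g_add[symmetric] gK by auto
  next
    case (eng_mult h1 h2)
    then show ?case using g_mult[symmetric] gK by auto
  qed simp
  moreover have "g k \<in> generate_field R {}" for k
  proof (induction k)
    case 0 then show ?case using zero_in_generate by (simp add: g_def)
  next
    case (Suc k)
    then show ?case using generate_field.eng_add[OF Suc generate_field.one] by (simp add: g_def)
  qed
  ultimately have K: "generate_field R {} = ?K" by blast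
  have "inj_on g {..<p}"
  proof -
    have "k = l" if "k < p" "l < p" "g k = g l" "k \<le> l" for k l
    proof -
      have "g (k + (l - k)) = g k \<oplus> g (l - k)" by (rule g_add)
      then have "g k = g k \<oplus> g (l - k)" using that by simp
      then have "g (l - k) = \<zero>" using g_c by simp
      then have "p dvd l - k" using g_zero by simp
      then show ?thesis using that by (meson diff_is_0_eq dvd_imp_le less_imp_diff_less not_less le_antisym not_gr_zero)
    qed
    then show ?thesis by (metis inj_onI lessThan_iff nat_le_linear)
  qed
  then show ?thesis unfolding K by (simp add: card_image)
qed

text \<open>Add the vectors of a basis one at a time; the cosets of \<open>E\<close> in \<open>K v + E\<close> are represented by the
  multiples of \<open>v\<close>.\<close>

lemma (in field) dimension_chain:
  assumes K: "subfield K R" and "dimension n K E"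
  shows "\<exists>S. S 0 = {\<zero>} \<and> S n = E \<and> (\<forall>i::nat. subgroup (S i) (add_monoid R)) \<and>
    (\<forall>i<n. S i \<subseteq> S (Suc i) \<and> rel_index (add_monoid R) (S (Suc i)) (S i) = card K)"
  using assms(2,1)
proof (induction rule: dimension.induct)
  case (zero_dim K)
  have "subgroup {\<zero>} (add_monoid R)" using add.one_is_normal normal_imp_subgroup by blast
  then show ?case by (intro exI[of _ "\<lambda>i. {\<zero>}"]) auto
next
  case (Suc_dim v E n K)
  note K = Suc_dim.prems
  from Suc_dim obtain S where S: "S 0 = {\<zero>}" "S n = E" "\<And>i::nat. subgroup (S i) (add_monoid R)"
    "\<And>i. i < n \<Longrightarrow> S i \<subseteq> S (Suc i) \<and> rel_index (add_monoid R) (S (Suc i)) (S i) = card K" by auto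
  obtain Vs where Vs: "set Vs \<subseteq> carrier R" "Span K Vs = E" using exists_base[OF K Suc_dim(3)] by auto
  let ?A = "add_monoid R"
  have E: "subgroup E ?A" using S(2,3) by metis
  have Ec: "x \<in> E \<Longrightarrow> x \<in> carrier R" for x using subgroup.mem_carrier[OF E] by simp
  have Kc: "k \<in> K \<Longrightarrow> k \<in> carrier R" for k using subringE(1)[OF subfieldE(1)[OF K]] by auto
  have smult: "k \<otimes> x \<in> E" if "k \<in> K" "x \<in> E" for k x
    using Span_smult_closed[OF K Vs(1)] Vs(2) that by auto
  let ?E' = "line_extension K v E"
  have E': "subgroup ?E' ?A" using line_extension_is_subgroup[OF K E Suc_dim(1)] .
  have mem: "u \<in> ?E' \<longleftrightarrow> (\<exists>k\<in>K. \<exists>w\<in>E. u = k \<otimes> v \<oplus> w)" for u by (rule line_extension_mem_iff)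
  have zK: "\<zero> \<in> K" using subringE(2)[OF subfieldE(1)[OF K]] .
  have EE': "E \<subseteq> ?E'"
  proof
    fix x assume "x \<in> E"
    moreover then have "x = \<zero> \<otimes> v \<oplus> x" using Ec Suc_dim(1) by simp
    ultimately show "x \<in> ?E'" using mem zK by blast
  qed
  have "(\<lambda>a. E #>\<^bsub>?A\<^esub> a) ` ?E' = (\<lambda>k. E #>\<^bsub>?A\<^esub> (k \<otimes> v)) ` K"
  proof (intro equalityI subsetI)
    fix T assume "T \<in> (\<lambda>a. E #>\<^bsub>?A\<^esub> a) ` ?E'"
    then obtain k w where kw: "k \<in> K" "w \<in> E" "T = E #>\<^bsub>?A\<^esub> (k \<otimes> v \<oplus> w)" using mem by auto
    have "k \<otimes> v \<oplus> w = w \<otimes>\<^bsub>?A\<^esub> (k \<otimes> v)" using kw Kc Ec Suc_dim(1) by (simp add: a_comm)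
    then have "T = E #>\<^bsub>?A\<^esub> (k \<otimes> v)"
      using kw group.r_coset_mult_subgroup[OF a_group E kw(2), of "k \<otimes> v"] Kc Suc_dim(1) by simp
    then show "T \<in> (\<lambda>k. E #>\<^bsub>?A\<^esub> (k \<otimes> v)) ` K" using kw by auto
  next
    fix T assume "T \<in> (\<lambda>k. E #>\<^bsub>?A\<^esub> (k \<otimes> v)) ` K"
    then obtain k where k: "k \<in> K" "T = E #>\<^bsub>?A\<^esub> (k \<otimes> v)" by auto
    have "\<zero> \<in> E" using subgroup.one_closed[OF E] by simp
    moreover have "k \<otimes> v = k \<otimes> v \<oplus> \<zero>" using k Kc Suc_dim(1) by simp
    ultimately have "k \<otimes> v \<in> ?E'" using mem k by blast
    then show "T \<in> (\<lambda>a. E #>\<^bsub>?A\<^esub> a) ` ?E'" using k by auto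
  qed
  moreover have "inj_on (\<lambda>k. E #>\<^bsub>?A\<^esub> (k \<otimes> v)) K"
  proof (rule inj_onI, rule ccontr)
    fix k l assume k: "k \<in> K" and l: "l \<in> K" and eq: "E #>\<^bsub>?A\<^esub> (k \<otimes> v) = E #>\<^bsub>?A\<^esub> (l \<otimes> v)" and ne: "k \<noteq> l"
    have "(k \<otimes> v) \<otimes>\<^bsub>?A\<^esub> inv\<^bsub>?A\<^esub> (l \<otimes> v) \<in> E"
      using eq group.r_coset_eq_iff[OF a_group E, of "k \<otimes> v" "l \<otimes> v"] k l Kc Suc_dim(1) by simp
    then have 1: "(k \<ominus> l) \<otimes> v \<in> E"
      using k l Kc Suc_dim(1) by (simp add: a_minus_def a_inv_def[symmetric] l_distr l_minus)
    have kl: "k \<ominus> l \<in> K" using k l subringE(5,7)[OF subfieldE(1)[OF K]] by (auto simp: a_minus_def)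
    have "k \<ominus> l \<noteq> \<zero>" using ne k l Kc by (simp add: r_right_minus_eq)
    then have i: "inv (k \<ominus> l) \<in> K" "inv (k \<ominus> l) \<otimes> (k \<ominus> l) = \<one>" using subfield_m_inv[OF K, of "k \<ominus> l"] kl by auto
    have "inv (k \<ominus> l) \<otimes> ((k \<ominus> l) \<otimes> v) \<in> E" using smult i 1 by blast
    moreover have "inv (k \<ominus> l) \<otimes> ((k \<ominus> l) \<otimes> v) = v"
      using i kl Kc Suc_dim(1) by (simp add: m_assoc[symmetric])
    ultimately show False using Suc_dim(2) by simp
  qed
  ultimately have idx: "rel_index ?A ?E' E = card K" by (simp add: rel_index_def card_image)
  show ?case
  proof (intro exI[of _ "\<lambda>i. if i \<le> n then S i else ?E'"] conjI allI impI)
    fix i assume i: "i < Suc n"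
    show "(if i \<le> n then S i else ?E') \<subseteq> (if Suc i \<le> n then S (Suc i) else ?E')"
      using i S(2) S(4)[of i] EE' by (cases "i = n") auto
    show "rel_index ?A (if Suc i \<le> n then S (Suc i) else ?E') (if i \<le> n then S i else ?E') = card K"
      using i S(2) S(4)[of i] idx by (cases "i = n") auto
  qed (use S E' in auto)
qed

lemma (in cring) mem_cgenideal_iff: "y \<in> PIdl a \<longleftrightarrow> (\<exists>x\<in>carrier R. y = x \<otimes> a)"
  by (auto simp: cgenideal_def)

lemma (in cring) cgenideal_one: "PIdl \<one> = carrier R"
proof (intro equalityI subsetI)
  fix x assume "x \<in> carrier R"
  then show "x \<in> PIdl \<one>" unfolding mem_cgenideal_iff by (intro bexI[of _ x]) auto
qed (auto simp: mem_cgenideal_iff)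

lemma (in cring) cgenideal_zero: "PIdl \<zero> = {\<zero>}"
proof (intro equalityI subsetI)
  fix x assume "x \<in> {\<zero>}"
  then show "x \<in> PIdl \<zero>" unfolding mem_cgenideal_iff by (intro bexI[of _ \<zero>]) auto
qed (auto simp: mem_cgenideal_iff)

lemma (in cring) ideal_prod_cgenideal:
  assumes a: "a \<in> carrier R" and b: "b \<in> carrier R"
  shows "ideal_prod R (PIdl a) (PIdl b) = PIdl (a \<otimes> b)"
proof (intro equalityI subsetI)
  fix y assume "y \<in> ideal_prod R (PIdl a) (PIdl b)"
  then show "y \<in> PIdl (a \<otimes> b)"
  proof (induction rule: ideal_prod.induct)
    case (prod i j)
    then obtain x y where "x \<in> carrier R" "y \<in> carrier R" "i = x \<otimes> a" "j = y \<otimes> b"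
      by (auto simp: mem_cgenideal_iff)
    then have "i \<otimes> j = (x \<otimes> y) \<otimes> (a \<otimes> b)" using a b by (simp add: m_ac)
    then show ?case using \<open>x \<in> carrier R\<close> \<open>y \<in> carrier R\<close> mem_cgenideal_iff by blast
  next
    case (sum s t)
    then obtain x y where "x \<in> carrier R" "y \<in> carrier R" "s = x \<otimes> (a \<otimes> b)" "t = y \<otimes> (a \<otimes> b)"
      by (auto simp: mem_cgenideal_iff)
    then have "s \<oplus> t = (x \<oplus> y) \<otimes> (a \<otimes> b)" using a b by (simp add: l_distr)
    then show ?case using \<open>x \<in> carrier R\<close> \<open>y \<in> carrier R\<close> mem_cgenideal_iff by blast
  qed
next
  fix y assume "y \<in> PIdl (a \<otimes> b)"
  then obtain x where x: "x \<in> carrier R" "y = x \<otimes> (a \<otimes> b)" by (auto simp: mem_cgenideal_iff)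
  then have "y = (x \<otimes> a) \<otimes> (\<one> \<otimes> b)" using a b by (simp add: m_ac)
  moreover have "x \<otimes> a \<in> PIdl a" "\<one> \<otimes> b \<in> PIdl b" using x by (auto simp: mem_cgenideal_iff)
  ultimately show "y \<in> ideal_prod R (PIdl a) (PIdl b)" using ideal_prod.prod by metis
qed

lemma (in cring) ideal_power_cgenideal:
  assumes a: "a \<in> carrier R"
  shows "ideal_power R (PIdl a) k = PIdl (a [^] k)"
proof (induction k)
  case 0
  show ?case using cgenideal_one by (simp add: ideal_power_def nat_pow_def ideals_set_def)
next
  case (Suc k)
  have "ideal_power R (PIdl a) (Suc k) = ideal_prod R (ideal_power R (PIdl a) k) (PIdl a)"
    by (simp add: ideal_power_def nat_pow_def ideals_set_def)
  then show ?case using Suc ideal_prod_cgenideal[of "a [^] k" a] a by simp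
qed

lemma (in domain) scaling_group_hom:
  assumes "c \<in> carrier R"
  shows "group_hom (add_monoid R) (add_monoid R) ((\<otimes>) c)"
  unfolding group_hom_def group_hom_axioms_def hom_def
  using a_group assms by (auto simp: r_distr)

lemma (in domain) rel_index_scaling:
  assumes c: "c \<in> carrier R" "c \<noteq> \<zero>"
    and A: "subgroup A (add_monoid R)" and B: "subgroup B (add_monoid R)" and BA: "B \<subseteq> A"
  shows "rel_index (add_monoid R) ((\<otimes>) c ` A) ((\<otimes>) c ` B) = rel_index (add_monoid R) A B"
proof -
  interpret h: group_hom "add_monoid R" "add_monoid R" "(\<otimes>) c" by (rule scaling_group_hom[OF c(1)])
  have "kernel (add_monoid R) (add_monoid R) ((\<otimes>) c) \<subseteq> B"
    using c integral subgroup.one_closed[OF B] by (auto simp: kernel_def)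
  then show ?thesis using h.rel_index_image[OF A B BA] by blast
qed

lemma (in domain) subgroup_scaling:
  assumes "c \<in> carrier R" "subgroup A (add_monoid R)"
  shows "subgroup ((\<otimes>) c ` A) (add_monoid R)"
  using group_hom.subgroup_img_is_subgroup[OF scaling_group_hom[OF assms(1)] assms(2)] .

text \<open>The filtration refines the powers of the maximal ideal, which occur at the multiples of \<open>f\<close>. The last
  condition is what remains of the valuation: an element outside \<open>\<pi> ^ (k + 1) R\<close> has valuation at most
  \<open>k\<close>, so it divides \<open>\<pi> ^ k\<close>.\<close>

locale padic_chain = domain R for R (structure) +
  fixes p n f :: nat and \<pi> :: 'a and L :: "nat \<Rightarrow> 'a set"
  assumes chain: "lattice_chain (add_monoid R) p n L"
    and f_pos: "0 < f"
    and unif: "\<pi> \<in> carrier R" "\<pi> \<noteq> \<zero>"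
    and L_multiple: "L (f * k) = PIdl (\<pi> [^] k)"
    and ideal_below: "x \<in> carrier R \<Longrightarrow> x \<notin> L (f * Suc k) \<Longrightarrow> L (f * k) \<subseteq> PIdl x"

text \<open>The residue field has a flag of subspaces over its prime field. The preimage of the flag refines the
  step from \<open>R\<close> to the maximal ideal, multiplication by \<open>\<pi> ^ j\<close> with \<open>j < e\<close> refines the steps down to
  \<open>p R = \<pi> ^ e R\<close>, and from there on everything is repeated by multiplication with \<open>p\<close>. Repeating with
  \<open>p\<close> and not with \<open>\<pi> ^ e\<close>, from which it differs by a unit, makes the filtration
  periodic under the map \<open>x \<mapsto> p x\<close> itself.\<close>

theorem padic_chain_exists:
  fixes R :: "('a, 'b) ring_scheme" (structure)
  assumes p: "Factorial_Ring.prime (p::nat)" and R: "finite_extension_Zp p R"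
    and f: "has_inertia_degree R f" and e: "has_ramification_index p R e"
  shows "0 < e \<and> (\<exists>\<pi> L. padic_chain R p (e * f) f \<pi> L \<and> (\<forall>k. ideal_power R (max_ideal R) k = L (f * k)))"
proof -
  have dvr: "principal_domain R" "\<not> field R" "\<exists>!M. maximalideal M R"
    using R by (auto simp: finite_extension_Zp_def discrete_valuation_ring_def)
  interpret principal_domain R by (rule dvr(1))
  define m where "m = max_ideal R"
  have mm: "maximalideal m R" using theI'[OF dvr(3)] by (simp add: m_def max_ideal_def)
  have munique: "M = m" if "maximalideal M R" for M using dvr(3) that mm by blast
  interpret m: maximalideal m R by (rule mm)
  obtain \<pi> where pi: "\<pi> \<in> carrier R" "m = PIdl \<pi>" using exists_gen[OF m.is_ideal] by blast
  have pi0: "\<pi> \<noteq> \<zero>"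
  proof
    assume "\<pi> = \<zero>"
    then have "m = {\<zero>}" unfolding pi(2) using cgenideal_zero by simp
    then show False using mm dvr(2) zeromaximalideal_eq_field by simp
  qed
  have nonunit: "x \<in> m" if x: "x \<in> carrier R" "x \<notin> Units R" for x
  proof (cases "x = \<zero>")
    case True then show ?thesis using m.zero_closed by simp
  next
    case False
    obtain b where b: "b \<in> carrier R" "ring_irreducible b" "b divides x"
      using exists_irreducible_divisor[OF _ x(2)] x(1) False by blast
    have "PIdl b = m" using munique[OF irreducible_imp_maximalideal[OF b(1,2)]] .
    moreover obtain c where "c \<in> carrier R" "x = b \<otimes> c" using b(3) by (auto simp: factor_def)
    ultimately show ?thesis using m_comm[OF b(1)] mem_cgenideal_iff[of x b] by auto
  qed
  have ipow: "ideal_power R m k = PIdl (\<pi> [^] k)" for k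
    unfolding pi(2) by (rule ideal_power_cgenideal[OF pi(1)])
  interpret F: field "R Quot m" using m.quotient_is_field[OF is_cring] .
  let ?F = "R Quot m"
  have charF: "ring_char ?F = p" using R by (simp add: finite_extension_Zp_def m_def)
  let ?h = "(+>) m"
  interpret h: ring_hom_ring R ?F ?h by (rule m.rcos_ring_hom_ring)
  define P where "P = [p] \<cdot> \<one>"
  have Pc: "P \<in> carrier R" by (simp add: P_def)
  have P0: "P \<noteq> \<zero>"
    using add_pow_one_eq_zero_iff[of p] R p by (auto simp: P_def finite_extension_Zp_def)
  have powP: "[p] \<cdot> x = P \<otimes> x" if "x \<in> carrier R" for x
    using add_pow_ldistr[of \<one> x p] that by (simp add: P_def)
  have Pe: "PIdl P = PIdl (\<pi> [^] e)"
    using e ipow[of e] by (simp add: has_ramification_index_def P_def m_def)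
  have mem_m: "x \<in> m \<longleftrightarrow> ?h x = \<zero>\<^bsub>?F\<^esub>" if "x \<in> carrier R" for x
  proof -
    have "?h x = \<zero>\<^bsub>?F\<^esub> \<longleftrightarrow> m #>\<^bsub>add_monoid R\<^esub> x = m #>\<^bsub>add_monoid R\<^esub> \<zero>"
      using h.hom_zero by (simp add: a_r_coset_def)
    also have "\<dots> \<longleftrightarrow> x \<otimes>\<^bsub>add_monoid R\<^esub> inv\<^bsub>add_monoid R\<^esub> \<zero> \<in> m"
      by (rule group.r_coset_eq_iff[OF a_group m.a_subgroup]) (use that in auto)
    also have "\<dots> \<longleftrightarrow> x \<in> m" using that by (simp add: a_inv_def[symmetric])
    finally show ?thesis by simp
  qed
  have Pm: "P \<in> m"
  proof -
    have "?h ([k] \<cdot> \<one>) = [k] \<cdot>\<^bsub>?F\<^esub> \<one>\<^bsub>?F\<^esub>" for k :: nat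
      by (induction k) simp_all
    then have "?h P = \<zero>\<^bsub>?F\<^esub>" using F.add_pow_one_eq_zero_iff[of p] charF by (simp add: P_def)
    then show ?thesis using mem_m Pc by simp
  qed
  have e0: "0 < e"
  proof (rule ccontr)
    assume "\<not> 0 < e"
    then have "PIdl P = carrier R" using Pe cgenideal_one by simp
    moreover have "PIdl P \<subseteq> m" using Pm cgenideal_minimal[OF m.is_ideal] by simp
    ultimately show False using m.I_notcarr m.a_subset by blast
  qed
  define K where "K = generate_field ?F {}"
  have K: "subfield K ?F" unfolding K_def by (rule F.generate_field_is_subfield) simp
  have cK: "card K = p" unfolding K_def by (rule F.card_prime_subfield[OF charF]) (use p prime_gt_0_nat in auto)
  have dim: "F.dimension f K (carrier ?F)" using f by (simp add: has_inertia_degree_def K_def m_def)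
  obtain S where S: "S 0 = {\<zero>\<^bsub>?F\<^esub>}" "S f = carrier ?F" "\<And>i::nat. subgroup (S i) (add_monoid ?F)"
    "\<And>i. i < f \<Longrightarrow> S i \<subseteq> S (Suc i) \<and> rel_index (add_monoid ?F) (S (Suc i)) (S i) = p"
    using F.dimension_chain[OF K dim] unfolding cK by blast
  have f0: "0 < f"
  proof (rule ccontr)
    assume "\<not> 0 < f"
    then have "carrier ?F = {\<zero>\<^bsub>?F\<^esub>}" using S by simp
    then show False using F.one_not_zero F.one_closed by blast
  qed
  let ?A = "add_monoid R"
  have gh: "group_hom ?A (add_monoid ?F) ?h" by (rule h.a_group_hom)
  \<comment> \<open>The flag ascends in the residue field, whereas the filtration descends.\<close>
  define M where "M = (\<lambda>i. {x \<in> carrier R. ?h x \<in> S (f - i)})"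
  have M_iff: "x \<in> M i \<longleftrightarrow> x \<in> carrier R \<and> ?h x \<in> S (f - i)" for x i
    unfolding M_def by (rule mem_Collect_eq)
  have Mc: "x \<in> M i \<Longrightarrow> x \<in> carrier R" for x i unfolding M_iff by (rule conjunct1)
  have hc: "?h x \<in> carrier ?F" if "x \<in> carrier R" for x using that by (rule h.hom_closed)
  have M0: "M 0 = carrier R" unfolding set_eq_iff M_iff diff_zero S(2) using hc by blast
  have Mf: "M f = m" unfolding set_eq_iff M_iff diff_self_eq_0 S(1) using mem_m m.a_subset by blast
  have Ssub: "\<zero>\<^bsub>?F\<^esub> \<in> S i" for i using subgroup.one_closed[OF S(3)[of i]] by simp
  have Sadd: "a \<oplus>\<^bsub>?F\<^esub> b \<in> S i" if "a \<in> S i" "b \<in> S i" for a b i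
    using subgroup.m_closed[OF S(3)[of i] that] by simp
  have Sinv: "\<ominus>\<^bsub>?F\<^esub> a \<in> S i" if "a \<in> S i" for a i
    using subgroup.m_inv_closed[OF S(3)[of i] that] unfolding a_inv_def .
  have Msub: "subgroup (M i) ?A" for i
  proof (rule group.subgroupI[OF a_group])
    show "M i \<subseteq> carrier ?A" using Mc by auto
    have "\<zero> \<in> M i" unfolding M_iff h.hom_zero using Ssub by blast
    then show "M i \<noteq> {}" by blast
    fix a assume a: "a \<in> M i"
    have "\<ominus> a \<in> M i"
      unfolding M_iff using h.hom_a_inv[OF Mc[OF a]] Sinv a[unfolded M_iff] by simp
    then show "inv\<^bsub>?A\<^esub> a \<in> M i" unfolding a_inv_def .
    fix b assume b: "b \<in> M i"
    have "a \<oplus> b \<in> M i"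
      unfolding M_iff using h.hom_add[OF Mc[OF a] Mc[OF b]] Sadd a[unfolded M_iff] b[unfolded M_iff] by simp
    then show "a \<otimes>\<^bsub>?A\<^esub> b \<in> M i" by simp
  qed
  have Mstep: "M (Suc i) \<subseteq> M i \<and> rel_index ?A (M i) (M (Suc i)) = p" if i: "i < f" for i
  proof -
    have fi: "f - i = Suc (f - Suc i)" using i by simp
    have sub: "S (f - Suc i) \<subseteq> S (f - i)" "rel_index (add_monoid ?F) (S (f - i)) (S (f - Suc i)) = p"
      using S(4)[of "f - Suc i"] i unfolding fi by simp_all
    have MM: "M (Suc i) \<subseteq> M i" using sub(1) M_iff by blast
    have img: "?h ` M j = S (f - j)" for j
    proof (intro equalityI subsetI)
      fix y assume y: "y \<in> S (f - j)"
      have "y \<in> carrier ?F" using subgroup.mem_carrier[OF S(3)[of "f - j"] y] by simp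
      then obtain x where "x \<in> carrier R" "y = ?h x" unfolding FactRing_def A_RCOSETS_def' by auto
      then show "y \<in> ?h ` M j" using y M_iff by blast
    next
      fix y assume "y \<in> ?h ` M j" then show "y \<in> S (f - j)" using M_iff by blast
    qed
    have ker: "kernel ?A (add_monoid ?F) ?h \<subseteq> M (Suc i)"
    proof
      fix x assume "x \<in> kernel ?A (add_monoid ?F) ?h"
      then have "x \<in> carrier R" "?h x = \<zero>\<^bsub>?F\<^esub>" unfolding kernel_def by simp_all
      then show "x \<in> M (Suc i)" unfolding M_iff using Ssub by simp
    qed
    have "rel_index (add_monoid ?F) (?h ` M i) (?h ` M (Suc i)) = rel_index ?A (M i) (M (Suc i))"
      by (rule group_hom.rel_index_image[OF gh Msub Msub MM ker])
    then show ?thesis using sub(2) MM unfolding img by simp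
  qed
  define n where "n = e * f"
  have n0: "0 < n" using e0 f0 by (simp add: n_def)
  \<comment> \<open>Positions \<open>r < n\<close>: the quotient by \<open>f\<close> counts powers of \<open>\<pi>\<close>, the remainder
    is the place in the flag.\<close>
  define B where "B = (\<lambda>r. (\<otimes>) (\<pi> [^] (r div f)) ` M (r mod f))"
  have pik: "\<pi> [^] k \<in> carrier R" "\<pi> [^] k \<noteq> \<zero>" for k :: nat
    using pi(1) pi0 by (induction k) (auto simp: integral_iff)
  have Pk: "P [^] k \<in> carrier R" "P [^] k \<noteq> \<zero>" for k :: nat
    using Pc P0 by (induction k) (auto simp: integral_iff)
  have comp: "(\<otimes>) a ` (\<otimes>) b ` U = (\<otimes>) (a \<otimes> b) ` U"
    if "a \<in> carrier R" "b \<in> carrier R" "U \<subseteq> carrier R" for a b U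
  proof -
    have "a \<otimes> (b \<otimes> x) = a \<otimes> b \<otimes> x" if "x \<in> U" for x
      using that \<open>a \<in> carrier R\<close> \<open>b \<in> carrier R\<close> \<open>U \<subseteq> carrier R\<close> by (simp add: m_assoc subset_iff)
    then show ?thesis unfolding image_image by (rule image_cong[OF refl])
  qed
  have PIdl_img: "PIdl a = (\<otimes>) a ` carrier R" if "a \<in> carrier R" for a
    unfolding set_eq_iff mem_cgenideal_iff image_iff using m_comm[OF that] by auto
  have Bsub: "subgroup (B r) ?A" for r unfolding B_def by (rule subgroup_scaling[OF pik(1) Msub])
  have Bc: "B r \<subseteq> carrier R" for r using subgroup.subset[OF Bsub] by simp
  have BSuc: "B (Suc r) = (\<otimes>) (\<pi> [^] (r div f)) ` M (Suc (r mod f))" for r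
  proof (cases "Suc (r mod f) = f")
    case True
    then have "Suc r mod f = 0" "Suc r div f = Suc (r div f)" by (simp_all add: mod_Suc div_Suc)
    then have "B (Suc r) = (\<otimes>) (\<pi> [^] (r div f) \<otimes> \<pi>) ` carrier R" by (simp add: B_def M0)
    also have "\<dots> = (\<otimes>) (\<pi> [^] (r div f)) ` (\<otimes>) \<pi> ` carrier R" using comp[OF pik(1) pi(1)] by simp
    also have "(\<otimes>) \<pi> ` carrier R = M f" using Mf pi PIdl_img by simp
    finally show ?thesis using True by simp
  next
    case False
    then have "Suc r mod f = Suc (r mod f)" "Suc r div f = r div f" by (simp_all add: mod_Suc div_Suc)
    then show ?thesis by (simp add: B_def)
  qed
  have Bstep: "B (Suc r) \<subseteq> B r \<and> rel_index ?A (B r) (B (Suc r)) = p" for r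
  proof -
    have "r mod f < f" using f0 by simp
    from Mstep[OF this] show ?thesis
      unfolding BSuc using rel_index_scaling[OF pik Msub Msub] by (auto simp: B_def)
  qed
  have Bf: "B (f * j) = PIdl (\<pi> [^] j)" for j
    using f0 PIdl_img[OF pik(1)] by (simp add: B_def M0)
  have PB: "(\<otimes>) P ` (PIdl (\<pi> [^] j)) = PIdl (\<pi> [^] (e + j))" for j
  proof -
    have "(\<otimes>) P ` (PIdl (\<pi> [^] j)) = (\<otimes>) (\<pi> [^] j) ` (\<otimes>) P ` carrier R"
      using comp[OF Pc pik(1), of "carrier R" j] comp[OF pik(1) Pc, of "carrier R" j] PIdl_img[OF pik(1)] Pc pik(1)
      by (simp add: m_comm)
    also have "(\<otimes>) P ` carrier R = (\<otimes>) (\<pi> [^] e) ` carrier R"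
      using Pe PIdl_img[OF Pc] PIdl_img[OF pik(1)] by simp
    also have "(\<otimes>) (\<pi> [^] j) ` \<dots> = PIdl (\<pi> [^] (e + j))"
      using comp[OF pik(1) pik(1), of "carrier R" j e] PIdl_img[OF pik(1)] pi(1)
      by (simp add: nat_pow_mult add.commute)
    finally show ?thesis .
  qed
  have PkB: "(\<otimes>) (P [^] a) ` (PIdl (\<pi> [^] j)) = PIdl (\<pi> [^] (e * a + j))" for a j
  proof (induction a arbitrary: j)
    case 0
    have sub: "PIdl (\<pi> [^] j) \<subseteq> carrier R"
      by (rule subsetI) (rule ideal.Icarr[OF cgenideal_ideal[OF pik(1)]])
    have "(\<otimes>) (P [^] (0::nat)) ` (PIdl (\<pi> [^] j)) = (\<lambda>x. x) ` (PIdl (\<pi> [^] j))"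
      by (rule image_cong) (use sub in \<open>auto simp: subset_iff\<close>)
    then show ?case by simp
  next
    case (Suc a)
    have sub: "PIdl (\<pi> [^] j) \<subseteq> carrier R"
      by (rule subsetI) (rule ideal.Icarr[OF cgenideal_ideal[OF pik(1)]])
    have "(\<otimes>) (P [^] Suc a) ` (PIdl (\<pi> [^] j)) = (\<otimes>) (P [^] a) ` (\<otimes>) P ` (PIdl (\<pi> [^] j))"
      using comp[OF Pk(1) Pc sub] by simp
    also have "\<dots> = PIdl (\<pi> [^] (e * a + (e + j)))" unfolding PB by (rule Suc)
    finally show ?case by (simp add: algebra_simps)
  qed
  \<comment> \<open>All positions: the quotient by \<open>n\<close> counts multiplications by \<open>p\<close>.\<close>
  define L where "L = (\<lambda>k. (\<otimes>) (P [^] (k div n)) ` B (k mod n))"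
  have Lsub: "subgroup (L k) ?A" for k unfolding L_def by (rule subgroup_scaling[OF Pk(1) Bsub])
  have Lc: "L k \<subseteq> carrier R" for k using subgroup.subset[OF Lsub] by simp
  have LSuc: "L (Suc k) = (\<otimes>) (P [^] (k div n)) ` B (Suc (k mod n))" for k
  proof (cases "Suc (k mod n) = n")
    case True
    then have *: "Suc k mod n = 0" "Suc k div n = Suc (k div n)" by (simp_all add: mod_Suc div_Suc)
    have B0: "B 0 = PIdl (\<pi> [^] (0::nat))" using Bf[of 0] by simp
    have "L (Suc k) = (\<otimes>) (P [^] (k div n)) ` (\<otimes>) P ` B 0"
      using comp[OF Pk(1) Pc Bc] * by (simp add: L_def)
    also have "(\<otimes>) P ` B 0 = B n" unfolding B0 PB using Bf[of e] by (simp add: n_def mult.commute)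
    finally show ?thesis using True by simp
  next
    case False
    then have "Suc k mod n = Suc (k mod n)" "Suc k div n = k div n" by (simp_all add: mod_Suc div_Suc)
    then show ?thesis by (simp add: L_def)
  qed
  have Lstep: "L (Suc k) \<subseteq> L k \<and> rel_index ?A (L k) (L (Suc k)) = p" for k
    using Bstep[of "k mod n"] unfolding LSuc
    using rel_index_scaling[OF Pk Bsub Bsub] by (auto simp: L_def)
  have Lf: "L (f * k) = PIdl (\<pi> [^] k)" for k
  proof -
    have 1: "(f * k) div n = k div e" "(f * k) mod n = f * (k mod e)"
      using f0 by (simp_all add: n_def mult.commute[of f])
    then show ?thesis by (simp add: L_def Bf PkB)
  qed
  have powA: "x [^]\<^bsub>?A\<^esub> p = P \<otimes> x" if "x \<in> carrier R" for x
    using powP[OF that] by (simp add: add_pow_def)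
  have lc: "lattice_chain ?A p n L"
    unfolding lattice_chain_def lattice_chain_axioms_def
  proof (intro conjI allI impI)
    show "comm_group ?A" by (rule a_comm_group)
    show "L 0 = carrier ?A" using Lf[of 0] cgenideal_one by simp
    show "L (i + n) = (\<lambda>x. x [^]\<^bsub>?A\<^esub> p) ` L i" for i
    proof -
      have "L (i + n) = (\<otimes>) P ` L i"
        using comp[OF Pc Pk(1) Bc] n0 Pc by (simp add: L_def m_comm)
      also have "\<dots> = (\<lambda>x. x [^]\<^bsub>?A\<^esub> p) ` L i"
        by (rule image_cong[OF refl]) (rule powA[OF subsetD[OF Lc], symmetric])
      finally show ?thesis .
    qed
    show "x = \<one>\<^bsub>?A\<^esub>" if "x \<in> carrier ?A" "x [^]\<^bsub>?A\<^esub> p = \<one>\<^bsub>?A\<^esub>" for x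
      using that powA integral[OF _ Pc] P0 by auto
  qed (use p n0 Lsub Lstep in auto)
  have val: "PIdl (\<pi> [^] k) \<subseteq> PIdl x" if "x \<in> carrier R" "x \<notin> PIdl (\<pi> [^] Suc k)" for x k
    using that
  proof (induction k arbitrary: x)
    case 0
    have "x \<in> Units R" using nonunit[of x] 0 pi by auto
    then have "\<one> \<in> PIdl x" using Units_l_inv Units_inv_closed mem_cgenideal_iff by metis
    then have "PIdl \<one> \<subseteq> PIdl x" by (rule cgenideal_minimal[OF cgenideal_ideal[OF 0(1)]])
    then show ?case by simp
  next
    case (Suc k)
    show ?case
    proof (cases "x \<in> m")
      case True
      then obtain y where y: "y \<in> carrier R" "x = y \<otimes> \<pi>" using pi by (auto simp: mem_cgenideal_iff)
      have "y \<notin> PIdl (\<pi> [^] Suc k)"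
      proof
        assume "y \<in> PIdl (\<pi> [^] Suc k)"
        then obtain z where "z \<in> carrier R" "y = z \<otimes> \<pi> [^] Suc k" by (auto simp: mem_cgenideal_iff)
        then have "x = z \<otimes> \<pi> [^] Suc (Suc k)" using y pi(1) by (simp add: m_assoc)
        then show False using Suc.prems \<open>z \<in> carrier R\<close> mem_cgenideal_iff by blast
      qed
      then have "\<pi> [^] k \<in> PIdl y" using Suc.IH[OF y(1)] cgenideal_self[OF pik(1), of k] by blast
      then obtain z where z: "z \<in> carrier R" "\<pi> [^] k = z \<otimes> y" by (auto simp: mem_cgenideal_iff)
      then have "\<pi> [^] Suc k = z \<otimes> x" using y pi(1) by (simp add: m_assoc)
      then have "\<pi> [^] Suc k \<in> PIdl x" using z mem_cgenideal_iff by blast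
      then show ?thesis by (rule cgenideal_minimal[OF cgenideal_ideal[OF Suc.prems(1)]])
    next
      case False
      have "x \<in> Units R" using nonunit[of x] Suc.prems False by auto
      then have "\<one> \<in> PIdl x" using Units_l_inv Units_inv_closed mem_cgenideal_iff by metis
      then have "PIdl \<one> \<subseteq> PIdl x" by (rule cgenideal_minimal[OF cgenideal_ideal[OF Suc.prems(1)]])
      moreover note cgenideal_one
      moreover have "PIdl (\<pi> [^] Suc k) \<subseteq> carrier R"
        by (rule subsetI) (rule ideal.Icarr[OF cgenideal_ideal[OF pik(1)]])
      ultimately show ?thesis by blast
    qed
  qed
  have "padic_chain R p n f \<pi> L"
    unfolding padic_chain_def padic_chain_axioms_def
    unfolding Lf
    by (intro conjI allI impI domain_axioms lc f0 pi(1) pi0 refl val)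
  moreover have "\<forall>k. ideal_power R (max_ideal R) k = L (f * k)"
    using ipow Lf unfolding m_def by simp
  ultimately show ?thesis using e0 unfolding n_def by blast
qed

section \<open>The parabolic length as a value of the permutation\<close>

definition inversions :: "nat \<Rightarrow> (nat \<Rightarrow> nat) \<Rightarrow> (nat \<times> nat) set" where
  "inversions n w = {(i, j). i \<in> {1..n} \<and> j \<in> {1..n} \<and> i < j \<and> w j < w i}"

lemma perm_length_inversions: "perm_length n w = card (inversions n w)"
  by (simp add: perm_length_def inversions_def)

lemma finite_inversions: "finite (inversions n w)"
  by (rule finite_subset[of _ "{1..n} \<times> {1..n}"]) (auto simp: inversions_def)

text \<open>The transposition carries inversions to inversions and misses the one at the descent.\<close>

lemma perm_length_swap_less:
  assumes i: "1 \<le> i" "i < n" and desc: "u (Suc i) < u i"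
  shows "perm_length n (u \<circ> Transposition.transpose i (Suc i)) < perm_length n u"
proof -
  let ?s = "Transposition.transpose i (Suc i)"
  have sub: "(\<lambda>(a, b). (?s a, ?s b)) ` inversions n (u \<circ> ?s) \<subseteq> inversions n u - {(i, Suc i)}"
  proof
    fix q assume "q \<in> (\<lambda>(a, b). (?s a, ?s b)) ` inversions n (u \<circ> ?s)"
    then obtain a b where q: "q = (?s a, ?s b)"
      and ab: "a \<in> {1..n}" "b \<in> {1..n}" "a < b" "u (?s b) < u (?s a)"
      by (auto simp: inversions_def)
    have ne: "\<not> (a = i \<and> b = Suc i)" using ab(4) desc by auto
    have lt: "?s a < ?s b" using ab(3) ne unfolding Transposition.transpose_def by auto
    have "?s a \<in> {1..n}" "?s b \<in> {1..n}"
      using ab(1,2) i unfolding Transposition.transpose_def by auto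
    moreover have "(?s a, ?s b) \<noteq> (i, Suc i)"
    proof
      assume "(?s a, ?s b) = (i, Suc i)"
      then have "?s (?s a) = ?s i" "?s (?s b) = ?s (Suc i)" by auto
      then have "a = Suc i" "b = i" by auto
      then show False using ab(3) by simp
    qed
    ultimately show "q \<in> inversions n u - {(i, Suc i)}" using lt ab(4) q by (auto simp: inversions_def)
  qed
  have inj: "inj_on (\<lambda>(a, b). (?s a, ?s b)) (inversions n (u \<circ> ?s))"
  proof (rule inj_onI, clarify)
    fix a b c d assume "?s a = ?s c" "?s b = ?s d"
    then have "?s (?s a) = ?s (?s c)" "?s (?s b) = ?s (?s d)" by auto
    then show "a = c \<and> b = d" by simp
  qed
  have "card (inversions n (u \<circ> ?s)) \<le> card (inversions n u - {(i, Suc i)})"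
    using card_inj_on_le[OF inj sub] finite_inversions by auto
  also have "\<dots> < card (inversions n u)"
    using i desc by (intro card_Diff1_less finite_inversions) (auto simp: inversions_def)
  finally show ?thesis by (simp add: perm_length_inversions)
qed

lemma card_larger_than_last:
  assumes "u permutes {1..n}" "1 \<le> n"
  shows "card {i \<in> {1..<n}. u n < u i} = n - u n"
proof -
  have un: "u n \<in> {1..n}" using assms permutes_in_image[OF assms(1), of n] by auto
  have "u ` {i \<in> {1..<n}. u n < u i} = {u n<..n}"
  proof (intro equalityI subsetI)
    fix y assume y: "y \<in> {u n<..n}"
    then have "y \<in> u ` {1..n}" using permutes_image[OF assms(1)] un by auto
    then obtain i where i: "i \<in> {1..n}" "y = u i" by auto
    have "i \<noteq> n" using i y by auto
    then show "y \<in> u ` {i \<in> {1..<n}. u n < u i}" using i y by auto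
  next
    fix y assume "y \<in> u ` {i \<in> {1..<n}. u n < u i}"
    then obtain i where i: "i \<in> {1..<n}" "u n < u i" "y = u i" by auto
    have "u i \<in> {1..n}" using i permutes_in_image[OF assms(1), of i] by auto
    then show "y \<in> {u n<..n}" using i by auto
  qed
  moreover have "inj_on u {i \<in> {1..<n}. u n < u i}"
    using permutes_inj[OF assms(1)] by (rule inj_on_subset) simp
  ultimately have "card {i \<in> {1..<n}. u n < u i} = card {u n<..n}" by (metis card_image)
  then show ?thesis by simp
qed

text \<open>All inversions involve the last place.\<close>

lemma perm_length_increasing_prefix:
  assumes u: "u permutes {1..n}" "1 \<le> n" and nodesc: "\<And>i. i \<in> {1..n - 2} \<Longrightarrow> \<not> u (Suc i) < u i"
  shows "perm_length n u = n - u n"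
proof -
  have up: "i < j \<Longrightarrow> 1 \<le> i \<Longrightarrow> j < n \<Longrightarrow> u i < u j" for i j
  proof (induction j)
    case (Suc j)
    have "j \<in> {1..n - 2}" using Suc.prems by auto
    then have "u j \<le> u (Suc j)" using nodesc by fastforce
    moreover have "u j \<noteq> u (Suc j)" using permutes_inj[OF u(1)] by (metis injD n_not_Suc_n)
    ultimately have "u j < u (Suc j)" by simp
    then show ?case using Suc by (cases "i = j") auto
  qed simp
  have "inversions n u = (\<lambda>i. (i, n)) ` {i \<in> {1..<n}. u n < u i}"
  proof (intro equalityI subsetI)
    fix q assume "q \<in> inversions n u"
    then obtain i j where q: "q = (i, j)" "i \<in> {1..n}" "j \<in> {1..n}" "i < j" "u j < u i"
      by (auto simp: inversions_def)
    have "j = n" using up[of i j] q by fastforce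
    then show "q \<in> (\<lambda>i. (i, n)) ` {i \<in> {1..<n}. u n < u i}" using q by auto
  qed (auto simp: inversions_def)
  then show ?thesis
    using card_larger_than_last[OF u] by (simp add: perm_length_inversions card_image inj_on_def)
qed

lemma standard_parabolic_fixes_last:
  assumes "v \<in> standard_parabolic n (n - 2)"
  shows "v permutes {1..n} \<and> v n = n"
  using assms unfolding standard_parabolic_def
proof (induction rule: generate.induct)
  case one
  show ?case unfolding sym_group_one by (rule conjI[OF permutes_id]) simp
next
  case (incl h)
  then obtain i where i: "h = Transposition.transpose i (i + 1)" "i \<in> {1..n - 2}" by auto
  then show ?case by (auto intro: permutes_swap_id)
next
  case (inv h)
  then obtain i where i: "h = Transposition.transpose i (i + 1)" "i \<in> {1..n - 2}" by auto
  then have h: "h permutes {1..n}" "h n = n" by (auto intro: permutes_swap_id)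
  then have "inv\<^bsub>sym_group n\<^esub> h = inv' h" using sym_group_inv_equality sym_group_carrier by blast
  then show ?case using h permutes_inv[OF h(1)] permutes_inverses(2)[OF h(1), of n] by simp
next
  case (eng h1 h2)
  then have "h1 \<circ> h2 permutes {1..n}" using permutes_compose[of h2 "{1..n}" h1] by blast
  moreover have "(h1 \<circ> h2) n = n" using eng by simp
  ultimately show ?case unfolding sym_group_mult by (rule conjI)
qed

text \<open>The coset consists of rearrangements of \<open>w(1), \<dots>, w(n - 1)\<close> with \<open>w(n)\<close> kept in the last place. In a
  shortest one there is no descent among the first \<open>n - 1\<close> places, since swapping it would
  shorten the word, and so the only inversions left are those with the last place.\<close>

theorem parabolic_length_eq_last:
  assumes w: "w permutes {1..n}" and n: "1 \<le> n"
  shows "parabolic_length n (n - 2) w = n - w n"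
proof -
  let ?W = "standard_parabolic n (n - 2)"
  let ?C = "w <#\<^bsub>sym_group n\<^esub> ?W"
  have C: "u \<in> ?C \<longleftrightarrow> (\<exists>v\<in>?W. u = w \<circ> v)" for u by (auto simp: l_coset_def sym_group_mult)
  have Cp: "u permutes {1..n} \<and> u n = w n" if uC: "u \<in> ?C" for u
  proof -
    obtain v where v: "v \<in> ?W" "u = w \<circ> v" using uC unfolding C by blast
    show ?thesis using standard_parabolic_fixes_last[OF v(1)] permutes_compose[OF _ w, of v] v(2) by simp
  qed
  have fin: "finite (perm_length n ` ?C)"
  proof -
    have "?C \<subseteq> {u. u permutes {1..n}}" using Cp by blast
    then show ?thesis using finite_permutations[of "{1..n}"] finite_subset by blast
  qed
  have "id \<in> ?W" using generate.one[of "sym_group n"] by (simp add: standard_parabolic_def sym_group_one)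
  then have "w \<in> ?C" unfolding C by (rule bexI[rotated]) simp
  then have ne: "perm_length n ` ?C \<noteq> {}" by blast
  obtain u where u: "u \<in> ?C" "perm_length n u = parabolic_length n (n - 2) w"
    using Min_in[OF fin ne] unfolding parabolic_length_def by (metis imageE)
  have min: "parabolic_length n (n - 2) w \<le> perm_length n u'" if "u' \<in> ?C" for u'
    unfolding parabolic_length_def by (rule Min_le[OF fin]) (use that in auto)
  have "\<not> u (Suc i) < u i" if i: "i \<in> {1..n - 2}" for i
  proof
    assume d: "u (Suc i) < u i"
    obtain v where v: "v \<in> ?W" "u = w \<circ> v" using u(1) unfolding C by blast
    have sW: "Transposition.transpose i (Suc i) \<in> ?W"
      unfolding standard_parabolic_def by (rule generate.incl) (use i in auto)
    have "v \<otimes>\<^bsub>sym_group n\<^esub> Transposition.transpose i (Suc i) \<in> ?W"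
      unfolding standard_parabolic_def
      by (rule generate.eng[OF v(1)[unfolded standard_parabolic_def] sW[unfolded standard_parabolic_def]])
    then have "v \<circ> Transposition.transpose i (Suc i) \<in> ?W" by (simp only: sym_group_mult)
    then have "u \<circ> Transposition.transpose i (Suc i) \<in> ?C" unfolding C v(2) by (rule bexI[rotated]) (simp add: comp_assoc)
    moreover have "perm_length n (u \<circ> Transposition.transpose i (Suc i)) < perm_length n u"
      by (rule perm_length_swap_less) (use i d in auto)
    ultimately show False using min[of "u \<circ> Transposition.transpose i (Suc i)"] u(2) by simp
  qed
  then have "perm_length n u = n - u n"
    using perm_length_increasing_prefix[of u n] Cp[OF u(1)] n by blast
  then show ?thesis using u(2) Cp[OF u(1)] by simp
qed

section \<open>Rotation of runner lists\<close>

text \<open>Over the complex numbers summability is absolute, so the product of two families is summable.\<close>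

lemma has_sum_times:
  fixes f :: "'a \<Rightarrow> complex" and g :: "'b \<Rightarrow> complex"
  assumes f: "(f has_sum a) A" and g: "(g has_sum b) B"
  shows "((\<lambda>(x, y). f x * g y) has_sum (a * b)) (A \<times> B)"
proof (rule has_sum_SigmaI)
  show "((\<lambda>y. case (x, y) of (x, y) \<Rightarrow> f x * g y) has_sum (f x * b)) B" for x
    using has_sum_cmult_right[OF g, of "f x"] by simp
  show "((\<lambda>x. f x * b) has_sum a * b) A" using has_sum_cmult_left[OF f, of b] .
  have fa: "(\<lambda>x. norm (f x)) summable_on A" and ga: "(\<lambda>x. norm (g x)) summable_on B"
    using f g summable_on_iff_abs_summable_on_complex[of f A] summable_on_iff_abs_summable_on_complex[of g B]
    by (auto dest: has_sum_imp_summable)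
  have "(\<lambda>(x, y). norm (f x) * norm (g y)) summable_on A \<times> B"
  proof (rule summable_on_SigmaI)
    show "((\<lambda>y. case (x, y) of (x, y) \<Rightarrow> norm (f x) * norm (g y)) has_sum
        (norm (f x) * infsum (\<lambda>y. norm (g y)) B)) B" for x
      using has_sum_cmult_right[OF has_sum_infsum[OF ga], of "norm (f x)"] by simp
    show "(\<lambda>x. norm (f x) * infsum (\<lambda>y. norm (g y)) B) summable_on A"
      using summable_on_cmult_left[OF fa] .
  qed auto
  then have "(\<lambda>q. norm (case q of (x, y) \<Rightarrow> f x * g y)) summable_on A \<times> B"
    by (simp add: case_prod_beta' norm_mult)
  then show "(\<lambda>(x, y). f x * g y) summable_on A \<times> B" by (rule abs_summable_summable)
qed

lemma has_sum_geometric: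
  fixes z :: complex
  assumes "norm z < 1"
  shows "((\<lambda>k::nat. z ^ k) has_sum (1 / (1 - z))) UNIV"
  by (rule norm_summable_imp_has_sum)
     (use assms in \<open>auto simp: norm_power intro!: summable_geometric geometric_sums\<close>)

lemma has_sum_multigeometric:
  fixes z :: "nat \<Rightarrow> complex"
  assumes "\<And>i. i < d \<Longrightarrow> norm (z i) < 1"
  shows "((\<lambda>ds. \<Prod>i<d. z i ^ (ds ! i)) has_sum (\<Prod>i<d. 1 / (1 - z i))) {ds :: nat list. length ds = d}"
  using assms
proof (induction d arbitrary: z)
  case 0
  have "{ds :: nat list. length ds = 0} = {[]}" by auto
  then show ?case by (simp add: has_sum_finite_iff)
next
  case (Suc d)
  have bij: "bij_betw (\<lambda>(y, ys). y # ys) (UNIV \<times> {ds :: nat list. length ds = d}) {ds. length ds = Suc d}"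
    by (rule bij_betwI[where g = "\<lambda>ds. (hd ds, tl ds)"]) (auto simp: length_Suc_conv)
  have "((\<lambda>(y, ys). z 0 ^ y * (\<Prod>i<d. z (Suc i) ^ (ys ! i))) has_sum
      (1 / (1 - z 0) * (\<Prod>i<d. 1 / (1 - z (Suc i))))) (UNIV \<times> {ds :: nat list. length ds = d})"
    by (rule has_sum_times[OF has_sum_geometric Suc.IH]) (use Suc.prems in auto)
  also have "(\<lambda>(y, ys). z 0 ^ y * (\<Prod>i<d. z (Suc i) ^ (ys ! i))) =
      (\<lambda>q. (\<lambda>ds. \<Prod>i<Suc d. z i ^ (ds ! i)) ((\<lambda>(y, ys). y # ys) q))"
    by (auto simp: fun_eq_iff prod.lessThan_Suc_shift simp del: prod.lessThan_Suc)
  finally have "((\<lambda>ds. \<Prod>i<Suc d. z i ^ (ds ! i)) has_sum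
      (1 / (1 - z 0) * (\<Prod>i<d. 1 / (1 - z (Suc i))))) {ds. length ds = Suc d}"
    by (rule iffD1[OF has_sum_reindex_bij_betw[OF bij]])
  then show ?case by (simp add: prod.lessThan_Suc_shift del: prod.lessThan_Suc)
qed

text \<open>On the abacus this moves all beads up by one position and puts a new bead into the position \<open>0\<close>; the last
  runner becomes the first one, with one bead more.\<close>

definition rot :: "nat list \<Rightarrow> nat list" where
  "rot xs = Suc (last xs) # butlast xs"

lemma rot_snoc: "rot (xs @ [m]) = Suc m # xs"
  by (simp add: rot_def)

lemma rot_not_Nil: "rot xs \<noteq> []"
  by (simp add: rot_def)

lemma rot_props:
  assumes "xs \<noteq> []"
  shows "length (rot xs) = length xs" "sum_list (rot xs) = Suc (sum_list xs)"
    "inv_weight (rot xs) = inv_weight xs"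
proof -
  obtain ys m where "xs = ys @ [m]" using assms by (cases xs rule: rev_cases) auto
  then show "length (rot xs) = length xs" "sum_list (rot xs) = Suc (sum_list xs)"
    "inv_weight (rot xs) = inv_weight xs"
    by (simp_all add: rot_snoc inv_weight_Cons_Suc del: inv_weight.simps)
qed

lemma rot_pow_props:
  assumes "xs \<noteq> []"
  shows "(rot ^^ j) xs \<noteq> [] \<and> length ((rot ^^ j) xs) = length xs \<and> sum_list ((rot ^^ j) xs) = j + sum_list xs
    \<and> inv_weight ((rot ^^ j) xs) = inv_weight xs"
proof (induction j)
  case (Suc j)
  then show ?case using rot_props[of "(rot ^^ j) xs"] rot_not_Nil by simp
qed (use assms in simp)

lemma rot_inj: "xs \<noteq> [] \<Longrightarrow> ys \<noteq> [] \<Longrightarrow> rot xs = rot ys \<Longrightarrow> xs = ys"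
  by (metis append_butlast_last_id list.inject nat.inject rot_def)

lemma rot_pow_Cons_0_inj: "(rot ^^ j) (0 # ms) = (rot ^^ k) (0 # ns) \<Longrightarrow> j = k \<and> ms = ns"
proof (induction j arbitrary: k)
  case 0
  then show ?case by (cases k) (auto simp: rot_def)
next
  case (Suc j)
  then show ?case
  proof (cases k)
    case (Suc k')
    have "(rot ^^ j) (0 # ms) = (rot ^^ k') (0 # ns)"
      by (rule rot_inj) (use rot_pow_props[of "0 # ms" j] rot_pow_props[of "0 # ns" k'] Suc.prems Suc in auto)
    then show ?thesis using Suc.IH Suc by simp
  qed (auto simp: rot_def)
qed

lemma rot_pow_Cons_0_surj: "xs \<noteq> [] \<Longrightarrow> \<exists>j ms. xs = (rot ^^ j) (0 # ms)"
proof (induction "sum_list xs" arbitrary: xs rule: less_induct)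
  case less
  obtain x ys where xs: "xs = x # ys" using less.prems by (cases xs) auto
  show ?case
  proof (cases x)
    case 0
    then have "xs = (rot ^^ 0) (0 # ys)" using xs by simp
    then show ?thesis by blast
  next
    case (Suc m)
    have "\<exists>j ms. ys @ [m] = (rot ^^ j) (0 # ms)" by (rule less.hyps) (use xs Suc in auto)
    then obtain j ms where "ys @ [m] = (rot ^^ j) (0 # ms)" by blast
    then have "xs = (rot ^^ Suc j) (0 # ms)" using xs Suc rot_snoc[of ys m] by simp
    then show ?thesis by blast
  qed
qed

text \<open>A list that starts with a positive entry is a rotation, and undoing it lowers the sum; hence one
  arrives at a list that starts with \<open>0\<close> after a number of steps determined by the list.\<close>

lemma bij_betw_rot:
  "bij_betw (\<lambda>(j, ms). (rot ^^ j) (0 # ms)) (UNIV \<times> {ms. length ms = d}) {ms. length ms = Suc d}"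
  unfolding bij_betw_def
proof
  show "inj_on (\<lambda>(j, ms). (rot ^^ j) (0 # ms)) (UNIV \<times> {ms. length ms = d})"
  proof (rule inj_onI)
    fix u v :: "nat \<times> nat list"
    assume eq: "(\<lambda>(j, ms). (rot ^^ j) (0 # ms)) u = (\<lambda>(j, ms). (rot ^^ j) (0 # ms)) v"
    have "fst u = fst v \<and> snd u = snd v"
      by (rule rot_pow_Cons_0_inj) (use eq in \<open>simp add: case_prod_beta\<close>)
    then show "u = v" by (simp add: prod_eq_iff)
  qed
  show "(\<lambda>(j, ms). (rot ^^ j) (0 # ms)) ` (UNIV \<times> {ms. length ms = d}) = {ms. length ms = Suc d}"
  proof (intro equalityI subsetI)
    fix xs assume "xs \<in> (\<lambda>(j, ms). (rot ^^ j) (0 # ms)) ` (UNIV \<times> {ms. length ms = d})"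
    then obtain j ms where "length ms = d" "xs = (rot ^^ j) (0 # ms)" by auto
    then show "xs \<in> {ms. length ms = Suc d}" using rot_pow_props[of "0 # ms" j] by simp
  next
    fix xs assume xs: "xs \<in> {ms :: nat list. length ms = Suc d}"
    then have "xs \<noteq> []" by auto
    then obtain j ms where jm: "xs = (rot ^^ j) (0 # ms)" using rot_pow_Cons_0_surj by blast
    then have "length ms = d" using xs rot_pow_props[of "0 # ms" j] by simp
    then show "xs \<in> (\<lambda>(j, ms). (rot ^^ j) (0 # ms)) ` (UNIV \<times> {ms. length ms = d})" using jm by force
  qed
qed

text \<open>Rotations keep the weight and raise the sum by one, which accounts for the geometric series in \<open>t\<close>. A
  leading \<open>0\<close> adds to the weight the sum of the remaining entries, so the rest of the list is counted
  by the same series with \<open>P t\<close> in place of \<open>t\<close>.\<close>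

theorem has_sum_inv_weight:
  fixes P t :: complex
  assumes "\<And>i. i < d \<Longrightarrow> norm (P ^ i * t) < 1"
  shows "((\<lambda>ms. P ^ inv_weight ms * t ^ sum_list ms) has_sum (\<Prod>i<d. 1 / (1 - P ^ i * t))) {ms. length ms = d}"
  using assms
proof (induction d arbitrary: t)
  case 0
  have "{ms :: nat list. length ms = 0} = {[]}" by auto
  then show ?case by (simp add: has_sum_finite_iff)
next
  case (Suc d)
  have sh: "P ^ i * (P * t) = P ^ Suc i * t" for i by simp
  have t1: "norm t < 1" using Suc.prems[of 0] by simp
  have IH: "((\<lambda>ms. P ^ inv_weight ms * (P * t) ^ sum_list ms) has_sum (\<Prod>i<d. 1 / (1 - P ^ i * (P * t)))) {ms. length ms = d}"
    by (rule Suc.IH) (use Suc.prems[of "Suc i" for i] in \<open>simp only: sh Suc_less_eq\<close>)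
  have "((\<lambda>(j, ms). t ^ j * (P ^ inv_weight ms * (P * t) ^ sum_list ms)) has_sum
      (1 / (1 - t) * (\<Prod>i<d. 1 / (1 - P ^ i * (P * t))))) (UNIV \<times> {ms. length ms = d})"
    by (rule has_sum_times[OF has_sum_geometric[OF t1] IH])
  also have "(\<lambda>(j, ms). t ^ j * (P ^ inv_weight ms * (P * t) ^ sum_list ms)) =
     (\<lambda>q. (\<lambda>ms. P ^ inv_weight ms * t ^ sum_list ms) ((\<lambda>(j, ms). (rot ^^ j) (0 # ms)) q))"
  proof (rule ext, clarify)
    fix j ms
    have "inv_weight ((rot ^^ j) (0 # ms)) = sum_list ms + inv_weight ms"
      "sum_list ((rot ^^ j) (0 # ms)) = j + sum_list ms"
      using rot_pow_props[of "0 # ms" j] by simp_all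
    then show "t ^ j * (P ^ inv_weight ms * (P * t) ^ sum_list ms) =
      P ^ inv_weight ((rot ^^ j) (0 # ms)) * t ^ sum_list ((rot ^^ j) (0 # ms))"
      by (simp add: power_add power_mult_distrib)
  qed
  finally have "((\<lambda>ms. P ^ inv_weight ms * t ^ sum_list ms) has_sum
      (1 / (1 - t) * (\<Prod>i<d. 1 / (1 - P ^ i * (P * t))))) {ms. length ms = Suc d}"
    by (rule iffD1[OF has_sum_reindex_bij_betw[OF bij_betw_rot]])
  then show ?case unfolding sh by (simp add: prod.lessThan_Suc_shift del: prod.lessThan_Suc)
qed

section \<open>Powers, chains and squares of lattices\<close>

context lattice_chain
begin

lemma F_lattice: "F i \<in> lattices"
  unfolding lattices_def using F_subgroup by blast

lemma gaps_F: "gaps (F i) = {..<i}"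
proof (intro equalityI subsetI)
  fix j assume "j \<in> {..<i}"
  then have "F i \<subseteq> F (Suc j)" using F_antimono[of "Suc j" i] by simp
  then show "j \<in> gaps (F i)" by (auto simp: gaps_def)
qed (use gaps_bounded[of i "F i"] in auto)

lemma F_shift_iterate: "F (i + j * d) = (\<lambda>x. x [^] (p ^ j)) ` F i"
proof (induction j)
  case 0
  have "(\<lambda>x. x [^] (1::nat)) ` F i = (\<lambda>x. x) ` F i"
    by (rule image_cong[OF refl]) (use F_carrier in auto)
  then show ?case by simp
next
  case (Suc j)
  have "F (i + Suc j * d) = F ((i + j * d) + d)" by (simp add: algebra_simps)
  also have "\<dots> = (\<lambda>x. x [^] p) ` (\<lambda>x. x [^] (p ^ j)) ` F i" unfolding F_shift Suc ..
  also have "\<dots> = (\<lambda>x. x [^] (p ^ Suc j)) ` F i"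
    unfolding image_image by (rule image_cong[OF refl]) (use F_carrier in \<open>simp add: nat_pow_pow mult.commute\<close>)
  finally show ?case .
qed

text \<open>The gaps of \<open>M ^ p\<close> are \<open>0, \<dots>, d - 1\<close> and the gaps of \<open>M\<close> shifted by \<open>d\<close>.\<close>

lemma rel_index_powers:
  assumes M: "M \<in> lattices"
  shows "rel_index L M ((\<lambda>x. x [^] p) ` M) = p ^ d"
proof -
  obtain k where k: "F k \<subseteq> M" and Ms: "subgroup M L" using M by (auto simp: lattices_def)
  let ?g = "k + d" and ?P = "(\<lambda>x. x [^] p) ` M"
  have g: "F ?g \<subseteq> M" using k F_antimono[of k ?g] by auto
  note N = gaps_powers[OF M g]
  have FP: "F ?g \<subseteq> ?P" unfolding F_shift using k by blast
  have Ps: "subgroup ?P L" by (rule subgroup_powers[OF Ms])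
  have "F ?g <#> ?P = ?P"
    using set_mult_superset(2)[OF F_subgroup Ps, of ?g] set_mult_least[OF Ps FP order.refl] by (rule subset_antisym[rotated])
  then have NL: "?P \<in> lattices" "?P \<subseteq> M" "gaps ?P = {i. i < ?g \<and> (i < d \<or> i - d \<in> gaps M)}"
    using N by simp_all
  have "gaps ?P = {..<d} \<union> (\<lambda>i. i + d) ` gaps M"
  proof (intro equalityI subsetI)
    fix i assume "i \<in> gaps ?P"
    then have "i < d \<or> i - d \<in> gaps M" using NL(3) by auto
    then show "i \<in> {..<d} \<union> (\<lambda>i. i + d) ` gaps M" by (cases "i < d") (auto intro!: image_eqI[of _ _ "i - d"])
  next
    fix i assume "i \<in> {..<d} \<union> (\<lambda>i. i + d) ` gaps M"
    then show "i \<in> gaps ?P" using NL(3) gaps_bounded[OF k] by auto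
  qed
  then have "card (gaps ?P) = d + card (gaps M)"
    using finite_gaps[OF M] by (subst card_Un_disjoint[symmetric, THEN trans[rotated]])
      (auto simp: card_image card_Un_disjoint)
  moreover have "gaps M \<subseteq> gaps ?P" using NL(2) by (auto simp: gaps_def)
  ultimately have "card (gaps ?P - gaps M) = d"
    using finite_gaps[OF M] by (simp add: card_Diff_subset)
  then show ?thesis using rel_index_between_lattices[OF M NL(1,2)] by simp
qed

text \<open>Fill the largest gap \<open>g\<close> by passing to \<open>M F g\<close>. The \<open>p\<close>-th powers of \<open>F g\<close> lie
  beyond \<open>g\<close>, so they belong to \<open>M\<close>.\<close>

lemma chain_to_top:
  assumes "M \<in> lattices"
  shows "\<exists>E. E 0 = M \<and> E (card (gaps M)) = carrier L \<and> (\<forall>i::nat. subgroup (E i) L) \<and>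
    (\<forall>i<card (gaps M). E i \<subseteq> E (Suc i) \<and> rel_index L (E (Suc i)) (E i) = p \<and> (\<forall>x\<in>E (Suc i). x [^] p \<in> E i))"
  using assms
proof (induction "card (gaps M)" arbitrary: M)
  case 0
  then have "gaps M = {}" using finite_gaps by auto
  then have "M = carrier L"
    using F_subset_if_gaps_bounded[OF 0(2), of 0] F_0 0(2) subgroup.subset[of M L] by (auto simp: lattices_def)
  then show ?case using 0 subgroup_self by (intro exI[of _ "\<lambda>i. M"]) auto
next
  case (Suc k)
  have Ms: "subgroup M L" using Suc.prems by (auto simp: lattices_def)
  have fin: "finite (gaps M)" using finite_gaps[OF Suc.prems] .
  have ne: "gaps M \<noteq> {}" using Suc.hyps(2) by auto
  define g where "g = Max (gaps M)"
  have gM: "g \<in> gaps M" using fin ne by (simp add: g_def)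
  have le: "h \<le> g" if "h \<in> gaps M" for h using fin that by (simp add: g_def)
  let ?M' = "M <#> F g"
  have M's: "subgroup ?M' L" using subgroup_set_mult_F[OF Ms] .
  have M'L: "?M' \<in> lattices" using M's set_mult_superset(2)[OF Ms F_subgroup, of g] by (auto simp: lattices_def)
  have MM': "M \<subseteq> ?M'" using set_mult_superset(1)[OF Ms F_subgroup] .
  have "gaps M \<inter> {..<g} = gaps M - {g}" using le by (force simp: order.strict_iff_order)
  then have gM': "gaps ?M' = gaps M - {g}" using gaps_set_mult_F[OF Ms, of g] by simp
  have c': "card (gaps ?M') = k" using gM' gM fin Suc.hyps(2) by simp
  have idx: "rel_index L ?M' M = p"
  proof -
    have "gaps M - gaps ?M' = {g}" using gM' gM by auto
    then show ?thesis using rel_index_between_lattices[OF M'L Suc.prems MM'] by simp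
  qed
  have "gaps M \<subseteq> {..<Suc g}" using le by (auto simp: less_Suc_eq_le)
  then have Fg: "F (Suc g) \<subseteq> M" using F_subset_if_gaps_bounded[OF Suc.prems] by blast
  have pow: "x [^] p \<in> M" if x: "x \<in> ?M'" for x
  proof -
    obtain m f where mf: "m \<in> M" "f \<in> F g" "x = m \<otimes> f" using x by (auto simp: set_mult_def)
    have "f [^] p \<in> F (g + d)" unfolding F_shift using mf by blast
    moreover have "F (g + d) \<subseteq> F (Suc g)" using d_pos by (intro F_antimono) simp
    ultimately have "f [^] p \<in> M" using Fg by blast
    moreover have "x [^] p = m [^] p \<otimes> f [^] p"
      using mf F_carrier subgroup.mem_carrier[OF Ms] by (simp add: nat_pow_distrib)
    ultimately show ?thesis using subgroup_nat_pow_closed[OF Ms mf(1)] subgroup.m_closed[OF Ms] by simp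
  qed
  obtain E where E: "E 0 = ?M'" "E k = carrier L" "\<And>i::nat. subgroup (E i) L"
    "\<And>i. i < k \<Longrightarrow> E i \<subseteq> E (Suc i) \<and> rel_index L (E (Suc i)) (E i) = p \<and> (\<forall>x\<in>E (Suc i). x [^] p \<in> E i)"
    using Suc.hyps(1)[of ?M'] c' M'L by auto
  show ?case
  proof (rule exI[of _ "case_nat M E"], intro conjI allI impI)
    show "case_nat M E (card (gaps M)) = carrier L" using E(2) Suc.hyps(2)[symmetric] by simp
    fix i
    show "subgroup (case_nat M E i) L" using Ms E(3) by (cases i) auto
    assume i: "i < card (gaps M)"
    show "case_nat M E i \<subseteq> case_nat M E (Suc i)"
      using E(1) E(4) MM' i Suc.hyps(2) by (cases i) auto
    show "rel_index L (case_nat M E (Suc i)) (case_nat M E i) = p"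
      using E(1) E(4) idx i Suc.hyps(2) by (cases i) auto
    show "\<forall>x\<in>case_nat M E (Suc i). x [^] p \<in> case_nat M E i"
      using E(1) E(4) pow i Suc.hyps(2) by (cases i) auto
  qed simp
qed

end

lemma rel_index_Times:
  assumes G: "group G" and H: "group H"
    and A: "subgroup A G" "subgroup A' G" and B: "subgroup B H" "subgroup B' H"
  shows "rel_index (G \<times>\<times> H) (A \<times> B) (A' \<times> B') = rel_index G A A' * rel_index H B B'"
proof -
  interpret G: group G by (rule G)
  interpret H: group H by (rule H)
  let ?U = "(\<lambda>a. A' #>\<^bsub>G\<^esub> a) ` A" and ?V = "(\<lambda>b. B' #>\<^bsub>H\<^esub> b) ` B"
  have coset: "(A' \<times> B') #>\<^bsub>G \<times>\<times> H\<^esub> (a, b) = (A' #>\<^bsub>G\<^esub> a) \<times> (B' #>\<^bsub>H\<^esub> b)" for a b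
    by (auto simp: r_coset_def)
  have ne: "S \<noteq> {}" if "S \<in> ?U" for S
    using that subgroup.one_closed[OF A(2)] by (auto simp: r_coset_def)
  have ne': "T \<noteq> {}" if "T \<in> ?V" for T
    using that subgroup.one_closed[OF B(2)] by (auto simp: r_coset_def)
  have "(\<lambda>q. (A' \<times> B') #>\<^bsub>G \<times>\<times> H\<^esub> q) ` (A \<times> B) = (\<lambda>(S, T). S \<times> T) ` (?U \<times> ?V)"
  proof (intro equalityI subsetI)
    fix S assume "S \<in> (\<lambda>q. (A' \<times> B') #>\<^bsub>G \<times>\<times> H\<^esub> q) ` (A \<times> B)"
    then obtain a b where "a \<in> A" "b \<in> B" "S = (A' \<times> B') #>\<^bsub>G \<times>\<times> H\<^esub> (a, b)" by auto
    then show "S \<in> (\<lambda>(S, T). S \<times> T) ` (?U \<times> ?V)"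
      unfolding coset by (intro image_eqI[of _ _ "(A' #>\<^bsub>G\<^esub> a, B' #>\<^bsub>H\<^esub> b)"]) simp_all
  next
    fix S assume "S \<in> (\<lambda>(S, T). S \<times> T) ` (?U \<times> ?V)"
    then obtain a b where "a \<in> A" "b \<in> B" "S = (A' #>\<^bsub>G\<^esub> a) \<times> (B' #>\<^bsub>H\<^esub> b)" by auto
    then show "S \<in> (\<lambda>q. (A' \<times> B') #>\<^bsub>G \<times>\<times> H\<^esub> q) ` (A \<times> B)"
      unfolding coset[symmetric] by (intro image_eqI[of _ _ "(a, b)"]) simp_all
  qed
  moreover have "inj_on (\<lambda>(S, T). S \<times> T) (?U \<times> ?V)"
  proof (rule inj_onI)
    fix u v assume u: "u \<in> ?U \<times> ?V" and v: "v \<in> ?U \<times> ?V"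
      and eq: "(\<lambda>(S, T). S \<times> T) u = (\<lambda>(S, T). S \<times> T) v"
    obtain S T S' T' where e: "u = (S, T)" "v = (S', T')" by (cases u; cases v)
    have "S \<noteq> {}" "T \<noteq> {}" "S' \<noteq> {}" "T' \<noteq> {}" using u v ne ne' e by blast+
    then show "u = v" using eq unfolding e by (simp add: times_eq_iff)
  qed
  ultimately show ?thesis by (simp add: rel_index_def card_image card_cartesian_product)
qed

lemma DirProd_comm_group:
  assumes "comm_group G" "comm_group H"
  shows "comm_group (G \<times>\<times> H)"
proof -
  interpret G: comm_group G by fact
  interpret H: comm_group H by fact
  interpret GH: group "G \<times>\<times> H" using DirProd_group[OF G.is_group H.is_group] .
  show ?thesis by (rule GH.group_comm_groupI) (auto simp: G.m_comm H.m_comm)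
qed

lemma DirProd_nat_pow: "x [^]\<^bsub>G \<times>\<times> H\<^esub> (k::nat) = (fst x [^]\<^bsub>G\<^esub> k, snd x [^]\<^bsub>H\<^esub> k)"
  by (induction k) (simp_all add: nat_pow_def DirProd_def case_prod_beta)

text \<open>Interlace the two copies of the filtration: in each step one of the two factors moves on.\<close>

lemma (in lattice_chain) lattice_chain_square:
  "lattice_chain (L \<times>\<times> L) p (2 * d) (\<lambda>i. F (Suc i div 2) \<times> F (i div 2))"
  unfolding lattice_chain_def lattice_chain_axioms_def
proof (intro conjI allI impI)
  have cg: "comm_group L" by unfold_locales
  show "comm_group (L \<times>\<times> L)" by (rule DirProd_comm_group[OF cg cg])
  show "Factorial_Ring.prime p" "0 < 2 * d" using prime_p d_pos by auto
  show "F (Suc 0 div 2) \<times> F (0 div 2) = carrier (L \<times>\<times> L)" by (simp add: F_0)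
  fix i
  show "subgroup (F (Suc i div 2) \<times> F (i div 2)) (L \<times>\<times> L)"
    by (intro DirProd_subgroups group_axioms F_subgroup)
  have "(F (Suc (Suc i) div 2) \<times> F (Suc i div 2) \<subseteq> F (Suc i div 2) \<times> F (i div 2)) \<and>
    rel_index (L \<times>\<times> L) (F (Suc i div 2) \<times> F (i div 2)) (F (Suc (Suc i) div 2) \<times> F (Suc i div 2)) = p"
  proof (cases "even i")
    case True
    then obtain j where "i = 2 * j" by auto
    then have e: "Suc i div 2 = j" "i div 2 = j" "Suc (Suc i) div 2 = Suc j" by auto
    show ?thesis unfolding e rel_index_Times[OF group_axioms group_axioms F_subgroup F_subgroup F_subgroup F_subgroup]
      using F_Suc[of j] F_index[of j] rel_index_refl[OF F_subgroup[of j]] by auto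
  next
    case False
    then obtain j where "i = Suc (2 * j)" by (auto elim: oddE)
    then have e: "Suc i div 2 = Suc j" "i div 2 = j" "Suc (Suc i) div 2 = Suc j" by auto
    show ?thesis unfolding e rel_index_Times[OF group_axioms group_axioms F_subgroup F_subgroup F_subgroup F_subgroup]
      using F_Suc[of j] F_index[of j] rel_index_refl[OF F_subgroup[of "Suc j"]] by auto
  qed
  then show "F (Suc (Suc i) div 2) \<times> F (Suc i div 2) \<subseteq> F (Suc i div 2) \<times> F (i div 2)"
    "rel_index (L \<times>\<times> L) (F (Suc i div 2) \<times> F (i div 2)) (F (Suc (Suc i) div 2) \<times> F (Suc i div 2)) = p"
    by auto
  have e: "Suc (i + 2 * d) div 2 = Suc i div 2 + d" "(i + 2 * d) div 2 = i div 2 + d" by auto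
  show "F (Suc (i + 2 * d) div 2) \<times> F ((i + 2 * d) div 2) =
    (\<lambda>x. x [^]\<^bsub>L \<times>\<times> L\<^esub> p) ` (F (Suc i div 2) \<times> F (i div 2))"
    unfolding e F_shift DirProd_nat_pow by force
next
  fix x assume "x \<in> carrier (L \<times>\<times> L)" "x [^]\<^bsub>L \<times>\<times> L\<^esub> p = \<one>\<^bsub>L \<times>\<times> L\<^esub>"
  then show "x = \<one>\<^bsub>L \<times>\<times> L\<^esub>" using pow_p_eq_one by (cases x) (auto simp: DirProd_nat_pow)
qed

section \<open>Sorting the runners\<close>

text \<open>The increment \<open>\<delta> i\<close> enters the partial sums with index at least \<open>i\<close>.\<close>

lemma sum_partial_sums:
  fixes \<delta> :: "nat \<Rightarrow> nat"
  shows "(\<Sum>j<n. \<Sum>i\<le>j. \<delta> i) = (\<Sum>i<n. (n - i) * \<delta> i)"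
proof (induction n)
  case (Suc n)
  have "(\<Sum>i<Suc n. (Suc n - i) * \<delta> i) = (\<Sum>i<Suc n. (n - i) * \<delta> i + \<delta> i)"
    by (rule sum.cong) (auto simp: Suc_diff_le)
  also have "\<dots> = (\<Sum>i<n. (n - i) * \<delta> i) + (\<Sum>i\<le>n. \<delta> i)"
    by (simp add: sum.distrib lessThan_Suc_atMost[symmetric])
  finally show ?case using Suc by simp
qed simp

text \<open>The increment \<open>\<delta> i\<close> enters the difference of the partial sums at \<open>j < l\<close> iff \<open>j < i \<le> l\<close>.\<close>

lemma sum_partial_sum_differences:
  fixes \<delta> :: "nat \<Rightarrow> nat"
  defines "c \<equiv> \<lambda>j. \<Sum>i\<le>j. \<delta> i"
  shows "(\<Sum>l<n. \<Sum>j<l. c l - c j) = (\<Sum>i<n. i * (n - i) * \<delta> i)"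
proof -
  have mono: "j \<le> l \<Longrightarrow> c j \<le> c l" for j l by (auto simp: c_def intro!: sum_mono2)
  have T: "(\<Sum>j<l. c l - c j) = (\<Sum>i\<le>l. i * \<delta> i)" for l
  proof (induction l)
    case (Suc l)
    have "(\<Sum>j<Suc l. c (Suc l) - c j) = (\<Sum>j<Suc l. \<delta> (Suc l) + (c l - c j))"
    proof (rule sum.cong)
      fix j assume "j \<in> {..<Suc l}"
      then have "c j \<le> c l" using mono by simp
      moreover have "c (Suc l) = c l + \<delta> (Suc l)" by (simp add: c_def)
      ultimately show "c (Suc l) - c j = \<delta> (Suc l) + (c l - c j)" by simp
    qed simp
    also have "\<dots> = Suc l * \<delta> (Suc l) + (\<Sum>j<l. c l - c j)" by (simp add: sum.distrib)
    finally show ?case using Suc by simp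
  qed simp
  show ?thesis unfolding T
  proof (induction n)
    case (Suc n)
    have "(\<Sum>i<Suc n. i * (Suc n - i) * \<delta> i) = (\<Sum>i<Suc n. i * (n - i) * \<delta> i + i * \<delta> i)"
      by (rule sum.cong) (auto simp: Suc_diff_le algebra_simps)
    also have "\<dots> = (\<Sum>i<n. i * (n - i) * \<delta> i) + (\<Sum>i\<le>n. i * \<delta> i)"
      by (simp add: sum.distrib lessThan_Suc_atMost[symmetric])
    finally show ?case using Suc by simp
  qed simp
qed

text \<open>For the gap set of a lattice \<open>M\<close> this is the least \<open>k\<close> with \<open>\<pi> ^ k R \<subseteq> M\<close>.\<close>

definition conductor :: "nat \<Rightarrow> nat set \<Rightarrow> nat" where
  "conductor f S = (LEAST k. S \<subseteq> {..<f * k})"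

text \<open>The permutation transported to \<open>{..<n}\<close>, as runners are counted from \<open>0\<close>.\<close>

definition shifted_perm :: "(nat \<Rightarrow> nat) \<Rightarrow> nat \<Rightarrow> nat" where
  "shifted_perm w j = w (Suc j) - 1"

text \<open>Runners of equal length have to be listed in increasing order, so the length must strictly increase
  at a descent; the list \<open>ds\<close> records what exceeds this minimum.\<close>

definition steps :: "nat \<Rightarrow> (nat \<Rightarrow> nat) \<Rightarrow> nat list \<Rightarrow> nat \<Rightarrow> nat" where
  "steps n w ds i = ds ! i + (if i \<in> descents n w then 1 else 0)"

definition heights :: "nat \<Rightarrow> (nat \<Rightarrow> nat) \<Rightarrow> nat list \<Rightarrow> nat \<Rightarrow> nat" where
  "heights n w ds j = (\<Sum>i\<le>j. steps n w ds i)"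

text \<open>The runner \<open>w(j + 1) - 1\<close> is given the length \<open>heights n w ds j\<close>. The pairs \<open>(w, ds)\<close> are
  thus the result of sorting the runners by their first free positions.\<close>

definition arrange :: "nat \<Rightarrow> (nat \<Rightarrow> nat) \<times> nat list \<Rightarrow> nat list" where
  "arrange n = (\<lambda>(w, ds). map (\<lambda>r. heights n w ds (inv_into {..<n} (shifted_perm w) r)) [0..<n])"

context
  fixes n :: nat and w :: "nat \<Rightarrow> nat"
  assumes w: "w permutes {1..n}"
begin

lemma Suc_shifted_perm: "j < n \<Longrightarrow> Suc (shifted_perm w j) = w (Suc j)"
  using permutes_in_image[OF w, of "Suc j"] by (simp add: shifted_perm_def)

lemma shifted_perm_less: "j < n \<Longrightarrow> shifted_perm w j < n"
  using permutes_in_image[OF w, of "Suc j"] by (auto simp: shifted_perm_def)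

lemma inj_on_shifted_perm: "inj_on (shifted_perm w) {..<n}"
proof (rule inj_onI)
  fix i j assume "i \<in> {..<n}" "j \<in> {..<n}" "shifted_perm w i = shifted_perm w j"
  then have "w (Suc i) = w (Suc j)" using Suc_shifted_perm by (metis lessThan_iff)
  then show "i = j" using permutes_inj[OF w] by (auto dest: injD)
qed

lemma bij_betw_shifted_perm: "bij_betw (shifted_perm w) {..<n} {..<n}"
proof -
  have "shifted_perm w ` {..<n} = {..<n}"
    by (rule endo_inj_surj) (use shifted_perm_less inj_on_shifted_perm in auto)
  then show ?thesis using inj_on_shifted_perm by (simp add: bij_betw_def)
qed

lemma descents_iff: "i \<in> descents n w \<longleftrightarrow> 0 < i \<and> i < n \<and> shifted_perm w i < shifted_perm w (i - 1)"
proof (cases "0 < i \<and> i < n")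
  case True
  then obtain j where "i = Suc j" by (cases i) auto
  then show ?thesis using True Suc_shifted_perm[of i] Suc_shifted_perm[of j] by (auto simp: descents_def)
qed (auto simp: descents_def)

lemma arrange_nth: "j < n \<Longrightarrow> arrange n (w, ds) ! shifted_perm w j = heights n w ds j"
  using shifted_perm_less[of j] inj_on_shifted_perm by (simp add: arrange_def inv_into_f_f)

lemma length_arrange: "length (arrange n (w, ds)) = n"
  by (simp add: arrange_def)

lemma heights_mono: "j \<le> l \<Longrightarrow> heights n w ds j \<le> heights n w ds l"
  by (auto simp: heights_def intro!: sum_mono2)

text \<open>Between descents \<open>w\<close> increases, and at a descent the height grows; so the first free positions of the
  runners increase along \<open>w\<close>.\<close>

lemma heights_order:
  assumes "j < l" "l < n"
  shows "heights n w ds j < heights n w ds l \<or>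
    heights n w ds j = heights n w ds l \<and> shifted_perm w j < shifted_perm w l"
  using assms
proof (induction l)
  case (Suc l)
  have step: "heights n w ds l < heights n w ds (Suc l) \<or>
    heights n w ds l = heights n w ds (Suc l) \<and> shifted_perm w l < shifted_perm w (Suc l)"
  proof (cases "Suc l \<in> descents n w")
    case True
    then show ?thesis by (simp add: heights_def steps_def)
  next
    case False
    then have "\<not> shifted_perm w (Suc l) < shifted_perm w l" using Suc.prems by (simp add: descents_iff)
    moreover have "shifted_perm w (Suc l) \<noteq> shifted_perm w l"
      using inj_on_shifted_perm Suc.prems by (auto dest: inj_onD)
    ultimately show ?thesis using heights_mono[of l "Suc l" ds] by auto
  qed
  show ?case
  proof (cases "j = l")
    case False
    then show ?thesis using Suc step by auto
  qed (use step in simp)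
qed simp

lemma sum_list_arrange: "sum_list (arrange n (w, ds)) = (\<Sum>i<n. (n - i) * steps n w ds i)"
proof -
  have "sum_list (arrange n (w, ds)) = (\<Sum>r<n. arrange n (w, ds) ! r)"
    by (simp add: sum_list_sum_nth length_arrange atLeast0LessThan)
  also have "\<dots> = (\<Sum>j<n. arrange n (w, ds) ! shifted_perm w j)"
    by (rule sum.reindex_bij_betw[OF bij_betw_shifted_perm, symmetric])
  also have "\<dots> = (\<Sum>j<n. heights n w ds j)" by (rule sum.cong) (use arrange_nth in auto)
  finally show ?thesis unfolding heights_def sum_partial_sums .
qed

lemma perm_length_shifted: "perm_length n w = (\<Sum>l<n. \<Sum>j<l. if shifted_perm w l < shifted_perm w j then 1 else 0)"
proof -
  have "inversions n w = (\<lambda>(l, j). (Suc j, Suc l)) ` (SIGMA l:{..<n}. {j \<in> {..<l}. shifted_perm w l < shifted_perm w j})"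
    (is "_ = ?f ` ?S")
  proof (intro equalityI subsetI)
    fix q assume "q \<in> inversions n w"
    then obtain i j where q: "q = (i, j)" "i \<in> {1..n}" "j \<in> {1..n}" "i < j" "w j < w i"
      by (auto simp: inversions_def)
    obtain i' j' where ij: "i = Suc i'" "j = Suc j'" using q by (cases i; cases j) auto
    have "(j', i') \<in> ?S" using q ij Suc_shifted_perm[of i'] Suc_shifted_perm[of j'] by auto
    moreover have "q = ?f (j', i')" using q ij by simp
    ultimately show "q \<in> ?f ` ?S" by blast
  next
    fix q assume "q \<in> ?f ` ?S"
    then obtain l j where lj: "q = (Suc j, Suc l)" "l < n" "j < l" "shifted_perm w l < shifted_perm w j" by auto
    then show "q \<in> inversions n w" using Suc_shifted_perm[of j] Suc_shifted_perm[of l] by (auto simp: inversions_def)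
  qed
  moreover have "inj_on ?f ?S" by (auto simp: inj_on_def)
  ultimately have "card (inversions n w) = card ?S" by (simp add: card_image)
  also have "\<dots> = (\<Sum>l<n. card {j \<in> {..<l}. shifted_perm w l < shifted_perm w j})" by simp
  also have "\<dots> = (\<Sum>l<n. \<Sum>j<l. if shifted_perm w l < shifted_perm w j then 1 else 0)"
    unfolding card_eq_sum by (intro sum.cong refl sum.inter_filter) simp
  finally show ?thesis by (simp add: perm_length_inversions)
qed

text \<open>In sorted order only pairs \<open>j < l\<close> contribute, with the difference of the two lengths, reduced by
  one if the longer runner \<open>w(l + 1) - 1\<close> stands to the left. These reductions are the inversions
  of \<open>w\<close>.\<close>

lemma inv_weight_arrange:
  "inv_weight (arrange n (w, ds)) + perm_length n w = (\<Sum>i<n. i * (n - i) * steps n w ds i)"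
proof -
  let ?ms = "arrange n (w, ds)" and ?s = "shifted_perm w" and ?c = "heights n w ds"
  let ?t = "\<lambda>r r'. if r' < r then ?ms ! r - ?ms ! r' else if r < r' then ?ms ! r - ?ms ! r' - 1 else 0"
  have "inv_weight ?ms = (\<Sum>r<n. \<Sum>r'<n. ?t r r')" using inv_weight_pairs[of ?ms] by (simp add: length_arrange)
  also have "\<dots> = (\<Sum>l<n. \<Sum>r'<n. ?t (?s l) r')"
    by (rule sum.reindex_bij_betw[OF bij_betw_shifted_perm, symmetric])
  also have "\<dots> = (\<Sum>l<n. \<Sum>j<n. ?t (?s l) (?s j))"
    by (rule sum.cong[OF refl]) (rule sum.reindex_bij_betw[OF bij_betw_shifted_perm, symmetric])
  also have "\<dots> = (\<Sum>l<n. \<Sum>j<l. if ?s l < ?s j then ?c l - ?c j - 1 else ?c l - ?c j)"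
  proof (rule sum.cong[OF refl])
    fix l assume l: "l \<in> {..<n}"
    have zero: "?t (?s l) (?s j) = 0" if "j \<in> {..<n} - {..<l}" for j
    proof (cases "j = l")
      case False
      then have "?c l < ?c j \<or> ?c l = ?c j \<and> ?s l < ?s j" using heights_order[of l j ds] that by auto
      then show ?thesis using arrange_nth[of l ds] arrange_nth[of j ds] l that by auto
    qed simp
    have "(\<Sum>j<n. ?t (?s l) (?s j)) = (\<Sum>j<l. ?t (?s l) (?s j))"
      by (rule sum.mono_neutral_right) (use l zero in auto)
    also have "\<dots> = (\<Sum>j<l. if ?s l < ?s j then ?c l - ?c j - 1 else ?c l - ?c j)"
    proof (rule sum.cong[OF refl])
      fix j assume j: "j \<in> {..<l}"
      have "?s j \<noteq> ?s l" using inj_on_shifted_perm j l by (auto dest: inj_onD)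
      then show "?t (?s l) (?s j) = (if ?s l < ?s j then ?c l - ?c j - 1 else ?c l - ?c j)"
        using arrange_nth[of l ds] arrange_nth[of j ds] l j by auto
    qed
    finally show "(\<Sum>j<n. ?t (?s l) (?s j)) = (\<Sum>j<l. if ?s l < ?s j then ?c l - ?c j - 1 else ?c l - ?c j)" .
  qed
  finally have "inv_weight ?ms + perm_length n w =
     (\<Sum>l<n. \<Sum>j<l. (if ?s l < ?s j then ?c l - ?c j - 1 else ?c l - ?c j) + (if ?s l < ?s j then 1 else 0))"
    by (simp add: perm_length_shifted sum.distrib)
  also have "\<dots> = (\<Sum>l<n. \<Sum>j<l. ?c l - ?c j)"
  proof (intro sum.cong refl)
    fix l j assume "l \<in> {..<n}" "j \<in> {..<l}"
    then show "(if ?s l < ?s j then ?c l - ?c j - 1 else ?c l - ?c j) + (if ?s l < ?s j then 1 else 0) = ?c l - ?c j"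
      using heights_order[of j l ds] by auto
  qed
  also have "\<dots> = (\<Sum>i<n. i * (n - i) * steps n w ds i)"
    unfolding heights_def by (rule sum_partial_sum_differences)
  finally show ?thesis .
qed

lemma positions_increasing:
  assumes "j < l" "l < n"
  shows "shifted_perm w j + n * heights n w ds j < shifted_perm w l + n * heights n w ds l"
  using runner_less_iff[of "shifted_perm w l" n "shifted_perm w j"] heights_order[OF assms]
    shifted_perm_less[of j] shifted_perm_less[of l] assms by simp

text \<open>The last of the first free positions lies on the runner \<open>w(n) - 1\<close>, and the largest bead, if there is
  any, is found \<open>n\<close> positions before it.\<close>

lemma runner_gaps_arrange_bounded:
  assumes n: "0 < n"
  shows "runner_gaps (arrange n (w, ds)) \<subseteq> {..<i} \<longleftrightarrow> n * heights n w ds (n - 1) \<le> i + (n - w n)"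
proof -
  let ?ms = "arrange n (w, ds)" and ?s = "shifted_perm w" and ?c = "heights n w ds"
  have wn: "Suc (?s (n - 1)) = w n" using Suc_shifted_perm[of "n - 1"] n by simp
  have wle: "?s (n - 1) < n" using shifted_perm_less n by simp
  have "runner_gaps ?ms \<subseteq> {..<i} \<longleftrightarrow> (\<forall>r<n. r + n * ?ms ! r < i + n)"
    using runner_gaps_subset_iff[of n ?ms i] n by (simp add: length_arrange)
  also have "\<dots> \<longleftrightarrow> (\<forall>j<n. ?s j + n * ?c j < i + n)"
  proof
    assume a: "\<forall>r<n. r + n * ?ms ! r < i + n"
    show "\<forall>j<n. ?s j + n * ?c j < i + n"
    proof (intro allI impI)
      fix j assume j: "j < n"
      then show "?s j + n * ?c j < i + n"
        using a[rule_format, of "?s j"] shifted_perm_less[OF j] arrange_nth[OF j, of ds] by simp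
    qed
  next
    assume a: "\<forall>j<n. ?s j + n * ?c j < i + n"
    show "\<forall>r<n. r + n * ?ms ! r < i + n"
    proof (intro allI impI)
      fix r assume "r < n"
      then obtain j where "j < n" "r = ?s j"
        using bij_betw_shifted_perm unfolding bij_betw_def by (metis imageE lessThan_iff)
      then show "r + n * ?ms ! r < i + n" using a arrange_nth[of j ds] by simp
    qed
  qed
  also have "\<dots> \<longleftrightarrow> ?s (n - 1) + n * ?c (n - 1) < i + n"
  proof
    assume a: "?s (n - 1) + n * ?c (n - 1) < i + n"
    show "\<forall>j<n. ?s j + n * ?c j < i + n"
    proof (intro allI impI)
      fix j assume j: "j < n"
      show "?s j + n * ?c j < i + n"
      proof (cases "j = n - 1")
        case False
        then have "j < n - 1" using j by simp
        then show ?thesis using positions_increasing[of j "n - 1" ds] n a by linarith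
      qed (use a in simp)
    qed
  qed (use n in simp)
  also have "\<dots> \<longleftrightarrow> n * ?c (n - 1) \<le> i + (n - w n)" using wn wle by linarith
  finally show ?thesis .
qed

lemma last_fixed_if_no_heights:
  assumes "0 < n" "heights n w ds (n - 1) = 0"
  shows "w n = n"
proof -
  have z: "heights n w ds j = 0" if "j < n" for j
    using heights_mono[of j "n - 1" ds] that assms by simp
  have "j \<le> shifted_perm w j" if "j < n" for j
    using that
  proof (induction j)
    case (Suc j)
    then show ?case using heights_order[of j "Suc j" ds] z[of j] z[of "Suc j"] by simp
  qed simp
  then have "n - 1 \<le> shifted_perm w (n - 1)" using assms by simp
  then show ?thesis using Suc_shifted_perm[of "n - 1"] shifted_perm_less[of "n - 1"] assms by simp
qed

text \<open>By the previous bound the conductor is the least \<open>k\<close> with \<open>f e c \<le> f k + (n - w(n))\<close>, where \<open>c\<close> is the greatest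
  height, so division by \<open>f\<close> brings in the rounded quotient \<open>(n - w(n)) div f\<close>. The equation is written
  with a sum on the left to avoid truncated subtraction.\<close>

lemma conductor_arrange:
  assumes n: "n = e * f" "0 < n"
  shows "conductor f (runner_gaps (arrange n (w, ds))) + (n - w n) div f = e * heights n w ds (n - 1)"
proof -
  let ?a = "heights n w ds (n - 1)" and ?c = "n - w n"
  have f: "0 < f" using n by auto
  have bound: "runner_gaps (arrange n (w, ds)) \<subseteq> {..<f * k} \<longleftrightarrow> e * ?a \<le> k + ?c div f" for k
  proof -
    have "n * ?a \<le> f * k + ?c \<longleftrightarrow> f * (e * ?a) \<le> f * (k + ?c div f) + ?c mod f"
      by (simp add: n(1) algebra_simps)
    also have "\<dots> \<longleftrightarrow> e * ?a \<le> k + ?c div f"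
    proof
      assume h: "f * (e * ?a) \<le> f * (k + ?c div f) + ?c mod f"
      have "?c mod f < f" using f by simp
      then have "f * (e * ?a) < f * (k + ?c div f) + f" using h by linarith
      also have "\<dots> = f * Suc (k + ?c div f)" by simp
      finally have "e * ?a < Suc (k + ?c div f)" by (simp only: mult_less_cancel1)
      then show "e * ?a \<le> k + ?c div f" by simp
    next
      assume "e * ?a \<le> k + ?c div f"
      then have "f * (e * ?a) \<le> f * (k + ?c div f)" by (rule mult_le_mono2)
      then show "f * (e * ?a) \<le> f * (k + ?c div f) + ?c mod f" by (rule trans_le_add1)
    qed
    finally show ?thesis using runner_gaps_arrange_bounded[OF n(2)] by simp
  qed
  have "conductor f (runner_gaps (arrange n (w, ds))) = e * ?a - ?c div f"
    unfolding conductor_def bound by (rule Least_equality) auto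
  moreover have "?c div f \<le> e * ?a"
  proof (cases "?a = 0")
    case True
    then show ?thesis using last_fixed_if_no_heights[OF n(2)] by simp
  next
    case False
    have "?c < e * f" using n permutes_in_image[OF w, of n] by auto
    then have "?c div f < e" by (simp add: less_mult_imp_div_less)
    then show ?thesis using False by (cases ?a) auto
  qed
  ultimately show ?thesis by simp
qed

end

text \<open>The permutation is recovered by sorting the first free positions, which are pairwise distinct, and
  the increments are recovered from the heights.\<close>

lemma inj_on_arrange:
  "inj_on (arrange n) ({w. w permutes {1..n}} \<times> {ds. length ds = n})"
proof (rule inj_onI)
  fix u v assume u: "u \<in> {w. w permutes {1..n}} \<times> {ds. length ds = n}"
    and v: "v \<in> {w. w permutes {1..n}} \<times> {ds. length ds = n}" and eq: "arrange n u = arrange n v"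
  obtain w ds where uu: "u = (w, ds)" by (cases u)
  obtain w' ds' where vv: "v = (w', ds')" by (cases v)
  have w: "w permutes {1..n}" "length ds = n" and w': "w' permutes {1..n}" "length ds' = n"
    using u v uu vv by auto
  define ms where "ms = arrange n u"
  let ?key = "\<lambda>r. r + n * ms ! r"
  have sorted: "sorted (map (?key \<circ> shifted_perm x) [0..<n]) \<and> distinct (map (?key \<circ> shifted_perm x) [0..<n])
      \<and> set (map (?key \<circ> shifted_perm x) [0..<n]) = ?key ` {..<n}"
    if x: "x permutes {1..n}" "ms = arrange n (x, es)" for x es
  proof -
    have inc: "(?key \<circ> shifted_perm x) i < (?key \<circ> shifted_perm x) j" if "i < j" "j < n" for i j
      using positions_increasing[OF x(1) that, of es] arrange_nth[OF x(1), of i es] arrange_nth[OF x(1), of j es] x(2) that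
      by simp
    have "sorted_wrt (<) (map (?key \<circ> shifted_perm x) [0..<n])"
      unfolding sorted_wrt_iff_nth_less using inc by simp
    then have "sorted (map (?key \<circ> shifted_perm x) [0..<n])" "distinct (map (?key \<circ> shifted_perm x) [0..<n])"
      by (simp_all add: strict_sorted_iff del: sorted_map)
    moreover have "set (map (?key \<circ> shifted_perm x) [0..<n]) = ?key ` shifted_perm x ` {..<n}"
      by (simp add: image_comp atLeast0LessThan)
    moreover have "shifted_perm x ` {..<n} = {..<n}"
      using bij_betw_shifted_perm[OF x(1)] by (simp add: bij_betw_def)
    ultimately show ?thesis by simp
  qed
  have m1: "ms = arrange n (w, ds)" and m2: "ms = arrange n (w', ds')" using eq uu vv by (auto simp: ms_def)
  have "map (?key \<circ> shifted_perm w) [0..<n] = map (?key \<circ> shifted_perm w') [0..<n]"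
    using sorted[OF w(1) m1] sorted[OF w'(1) m2] by (intro sorted_distinct_set_unique) simp_all
  then have k: "?key (shifted_perm w j) = ?key (shifted_perm w' j)" if "j < n" for j
    using that by (auto dest: map_eq_conv[THEN iffD1])
  have s: "shifted_perm w j = shifted_perm w' j" if "j < n" for j
    using runner_unique[OF shifted_perm_less[OF w(1) that] shifted_perm_less[OF w'(1) that] k[OF that]] by simp
  have ww: "w = w'"
  proof
    fix x
    show "w x = w' x"
    proof (cases "x \<in> {1..n}")
      case True
      then obtain j where "x = Suc j" "j < n" by (cases x) auto
      then show ?thesis using Suc_shifted_perm[OF w(1), of j] Suc_shifted_perm[OF w'(1), of j] s[of j] by simp
    next
      case False
      then show ?thesis using w(1) w'(1) by (simp add: permutes_not_in)
    qed
  qed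
  have h: "heights n w ds j = heights n w ds' j" if "j < n" for j
    using arrange_nth[OF w(1) that, of ds] arrange_nth[OF w(1) that, of ds'] m1 m2 ww by simp
  have "ds ! j = ds' ! j" if "j < n" for j
  proof (cases j)
    case 0
    then show ?thesis using h[of 0] that by (simp add: heights_def steps_def)
  next
    case (Suc i)
    then show ?thesis using h[of i] h[of "Suc i"] that by (simp add: heights_def steps_def)
  qed
  then have "ds = ds'" using w(2) w'(2) by (intro nth_equalityI) auto
  then show "u = v" using uu vv ww by simp
qed

lemma arrange_surj:
  assumes ms: "length ms = n" and n: "0 < n"
  shows "\<exists>w ds. w permutes {1..n} \<and> length ds = n \<and> arrange n (w, ds) = ms"
proof -
  define key where "key = (\<lambda>r. r + n * ms ! r)"
  define ys where "ys = sorted_list_of_set (key ` {..<n})"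
  have keymod: "key r mod n = r" if "r < n" for r using that by (simp add: key_def)
  have inj: "inj_on key {..<n}" by (rule inj_onI) (metis keymod lessThan_iff)
  have ys: "sorted ys" "distinct ys" "set ys = key ` {..<n}" by (simp_all add: ys_def)
  have len: "length ys = n" using ys inj by (metis card_image card_lessThan distinct_card)
  define \<sigma> where "\<sigma> = (\<lambda>j. ys ! j mod n)"
  have \<sigma>: "\<sigma> j < n \<and> key (\<sigma> j) = ys ! j" if "j < n" for j
  proof -
    have "ys ! j \<in> key ` {..<n}" using that len ys(3) nth_mem by metis
    then obtain r where "r < n" "ys ! j = key r" by auto
    then show ?thesis using keymod by (simp add: \<sigma>_def)
  qed
  have inj\<sigma>: "inj_on \<sigma> {..<n}"
  proof (rule inj_onI)
    fix i j assume "i \<in> {..<n}" "j \<in> {..<n}" "\<sigma> i = \<sigma> j"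
    then have "ys ! i = ys ! j" using \<sigma>[of i] \<sigma>[of j] by simp
    then show "i = j" using ys(2) len \<open>i \<in> {..<n}\<close> \<open>j \<in> {..<n}\<close> by (simp add: nth_eq_iff_index_eq)
  qed
  have inc: "\<sigma> i + n * ms ! \<sigma> i < \<sigma> j + n * ms ! \<sigma> j" if "i < j" "j < n" for i j
  proof -
    have "ys ! i \<le> ys ! j" using ys(1) that len by (simp add: sorted_iff_nth_mono)
    moreover have "ys ! i \<noteq> ys ! j" using ys(2) len that by (simp add: nth_eq_iff_index_eq)
    ultimately have "ys ! i < ys ! j" by simp
    then show ?thesis using \<sigma>[of i] \<sigma>[of j] that by (simp add: key_def)
  qed
  define w where "w = (\<lambda>x. if x \<in> {1..n} then Suc (\<sigma> (x - 1)) else x)"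
  have w: "w permutes {1..n}"
  proof (rule bij_imp_permutes)
    have "inj_on w {1..n}"
    proof (rule inj_onI)
      fix x y assume x: "x \<in> {1..n}" and y: "y \<in> {1..n}" and "w x = w y"
      then have "\<sigma> (x - 1) = \<sigma> (y - 1)" by (simp add: w_def)
      then have "x - 1 = y - 1" using inj_onD[OF inj\<sigma>, of "x - 1" "y - 1"] x y by auto
      then show "x = y" using x y by auto
    qed
    moreover have "w ` {1..n} \<subseteq> {1..n}"
    proof
      fix y assume "y \<in> w ` {1..n}"
      then obtain x where "x \<in> {1..n}" "y = Suc (\<sigma> (x - 1))" by (auto simp: w_def)
      moreover then have "x - 1 < n" by auto
      ultimately show "y \<in> {1..n}" using \<sigma>[of "x - 1"] by auto
    qed
    ultimately show "bij_betw w {1..n} {1..n}" by (simp add: bij_betw_def endo_inj_surj)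
  qed (auto simp: w_def)
  have sw: "shifted_perm w j = \<sigma> j" if "j < n" for j using that by (simp add: shifted_perm_def w_def)
  define c where "c = (\<lambda>j. ms ! \<sigma> j)"
  define ds where "ds = map (\<lambda>j. c j - (if j = 0 then 0 else c (j - 1)) - (if j \<in> descents n w then 1 else 0)) [0..<n]"
  have h: "heights n w ds j = c j" if "j < n" for j
    using that
  proof (induction j)
    case 0
    then show ?case using descents_iff[OF w, of 0] by (simp add: heights_def steps_def ds_def)
  next
    case (Suc j)
    have cc: "c j < c (Suc j) \<or> c j = c (Suc j) \<and> \<sigma> j < \<sigma> (Suc j)"
      using runner_less_iff[of "\<sigma> (Suc j)" n "\<sigma> j"] inc[of j "Suc j"] \<sigma>[of j] \<sigma>[of "Suc j"] Suc.prems
      by (simp add: c_def)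
    have "Suc j \<in> descents n w \<longleftrightarrow> \<sigma> (Suc j) < \<sigma> j"
      using descents_iff[OF w, of "Suc j"] Suc.prems sw[of j] sw[of "Suc j"] by simp
    then have "steps n w ds (Suc j) = c (Suc j) - c j"
      using cc Suc.prems by (auto simp: steps_def ds_def)
    moreover have "heights n w ds (Suc j) = heights n w ds j + steps n w ds (Suc j)" by (simp add: heights_def)
    ultimately show ?case using Suc cc by auto
  qed
  have "arrange n (w, ds) = ms"
  proof (rule nth_equalityI)
    fix r assume "r < length (arrange n (w, ds))"
    then have "r < n" by (simp add: arrange_def)
    then obtain j where j: "j < n" "r = shifted_perm w j"
      using bij_betw_shifted_perm[OF w] unfolding bij_betw_def by (metis imageE lessThan_iff)
    then show "arrange n (w, ds) ! r = ms ! r"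
      using arrange_nth[OF w j(1), of ds] h[OF j(1)] sw[OF j(1)] by (simp add: c_def)
  qed (simp add: arrange_def ms)
  moreover have "length ds = n" by (simp add: ds_def)
  ultimately show ?thesis using w by blast
qed

lemma bij_betw_arrange:
  assumes "0 < n"
  shows "bij_betw (arrange n) ({w. w permutes {1..n}} \<times> {ds. length ds = n}) {ms. length ms = n}"
  unfolding bij_betw_def
proof
  show "arrange n ` ({w. w permutes {1..n}} \<times> {ds. length ds = n}) = {ms. length ms = n}"
  proof (intro equalityI subsetI)
    fix ms :: "nat list" assume "ms \<in> {ms. length ms = n}"
    then obtain w ds where "w permutes {1..n}" "length ds = n" "arrange n (w, ds) = ms"
      using arrange_surj[of ms n] assms by auto
    then show "ms \<in> arrange n ` ({w. w permutes {1..n}} \<times> {ds. length ds = n})"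
      by (intro image_eqI[of _ _ "(w, ds)"]) auto
  qed (auto simp: arrange_def)
qed (rule inj_on_arrange)

text \<open>Along the bijection \<open>arrange\<close> both exponents become linear in the increments, up to corrections
  that depend on \<open>w\<close> alone: the increment at \<open>i\<close> raises the \<open>n - i\<close> runners from \<open>i\<close> on, whose
  total contribution is one factor \<open>x i\<close>. The corrections are the length of \<open>w\<close> and the rounded quotient in the
  conductor. The increments split into one unit for each descent and a free part, over which one
  sums geometric series.\<close>

theorem has_sum_permutation_formula:
  fixes P t :: complex
  assumes n: "n = e * f" "0 < n" and P: "P \<noteq> 0" and t: "t \<noteq> 0"
    and x: "\<And>i. x i = P ^ ((2 * n + i) * (n - i)) * t ^ (3 * n - i)"
    and less: "\<And>i. i < n \<Longrightarrow> norm (x i) < 1"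
  shows "((\<lambda>ms. P ^ (inv_weight ms + 2 * n * sum_list ms) *
        t ^ (sum_list ms + 2 * f * conductor f (runner_gaps ms))) has_sum
      (\<Sum>w | w permutes {1..n}. (1 / P) ^ perm_length n w * (1 / t) ^ (2 * f * ((n - w n) div f)) *
         (\<Prod>j\<in>descents n w. x j)) * (\<Prod>i<n. 1 / (1 - x i))) {ms. length ms = n}"
proof -
  let ?F = "\<lambda>ms. P ^ (inv_weight ms + 2 * n * sum_list ms) *
        t ^ (sum_list ms + 2 * f * conductor f (runner_gaps ms))"
  let ?g = "\<lambda>w. (1 / P) ^ perm_length n w * (1 / t) ^ (2 * f * ((n - w n) div f)) * (\<Prod>j\<in>descents n w. x j)"
  have summand: "?F (arrange n (w, ds)) = ?g w * (\<Prod>i<n. x i ^ (ds ! i))"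
    if w: "w permutes {1..n}" and "length ds = n" for w ds
  proof -
    let ?d = "steps n w ds" and ?ms = "arrange n (w, ds)"
    have a: "heights n w ds (n - 1) = (\<Sum>i<n. ?d i)"
      using n(2) by (simp add: heights_def lessThan_Suc_atMost[symmetric])
    have e1: "inv_weight ?ms + 2 * n * sum_list ?ms + perm_length n w = (\<Sum>i<n. (2 * n + i) * (n - i) * ?d i)"
    proof -
      have "2 * n * sum_list ?ms = (\<Sum>i<n. 2 * n * ((n - i) * ?d i))"
        by (simp only: sum_list_arrange[OF w] sum_distrib_left)
      then have "inv_weight ?ms + 2 * n * sum_list ?ms + perm_length n w =
          (\<Sum>i<n. i * (n - i) * ?d i + 2 * n * ((n - i) * ?d i))"
        using inv_weight_arrange[OF w, of ds] by (simp only: sum.distrib)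
      also have "\<dots> = (\<Sum>i<n. (2 * n + i) * (n - i) * ?d i)"
      proof (rule sum.cong[OF refl])
        have "i * m * y + 2 * n * (m * y) = (2 * n + i) * m * y" for i m y by (simp add: algebra_simps)
        then show "i * (n - i) * ?d i + 2 * n * ((n - i) * ?d i) = (2 * n + i) * (n - i) * ?d i" for i .
      qed
      finally show ?thesis .
    qed
    have "f * (conductor f (runner_gaps ?ms) + (n - w n) div f) = f * (e * (\<Sum>i<n. ?d i))"
      using conductor_arrange[OF w n, of ds] a by simp
    then have c: "f * conductor f (runner_gaps ?ms) + f * ((n - w n) div f) = n * (\<Sum>i<n. ?d i)"
      by (simp add: n(1) algebra_simps)
    have "(\<Sum>i<n. (3 * n - i) * ?d i) = (\<Sum>i<n. (n - i) * ?d i + 2 * n * ?d i)"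
    proof (rule sum.cong[OF refl])
      fix i assume "i \<in> {..<n}"
      then have "3 * n - i = (n - i) + 2 * n" by auto
      then show "(3 * n - i) * ?d i = (n - i) * ?d i + 2 * n * ?d i" by (simp only: distrib_right)
    qed
    also have "\<dots> = sum_list ?ms + 2 * (n * (\<Sum>i<n. ?d i))"
      by (simp only: sum_list_arrange[OF w] sum.distrib sum_distrib_left mult.assoc)
    also have "\<dots> = sum_list ?ms + 2 * f * conductor f (runner_gaps ?ms) + 2 * f * ((n - w n) div f)"
      unfolding c[symmetric] by simp
    finally have e2: "(\<Sum>i<n. (3 * n - i) * ?d i) =
      sum_list ?ms + 2 * f * conductor f (runner_gaps ?ms) + 2 * f * ((n - w n) div f)" .
    have "(\<Prod>i<n. x i ^ ?d i) = P ^ (\<Sum>i<n. (2 * n + i) * (n - i) * ?d i) * t ^ (\<Sum>i<n. (3 * n - i) * ?d i)"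
      by (simp add: x power_mult_distrib prod.distrib power_sum power_mult)
    also have "\<dots> = ?F ?ms * (P ^ perm_length n w * t ^ (2 * f * ((n - w n) div f)))"
      unfolding e1[symmetric] e2 by (simp add: power_add)
    finally have "?F ?ms = (1 / P) ^ perm_length n w * (1 / t) ^ (2 * f * ((n - w n) div f)) * (\<Prod>i<n. x i ^ ?d i)"
      using P t by (simp add: field_simps)
    moreover have "(\<Prod>i<n. x i ^ ?d i) = (\<Prod>j\<in>descents n w. x j) * (\<Prod>i<n. x i ^ (ds ! i))"
    proof -
      have "(\<Prod>i<n. x i ^ ?d i) = (\<Prod>i<n. (if i \<in> descents n w then x i else 1) * x i ^ (ds ! i))"
        by (rule prod.cong) (auto simp: steps_def)
      also have "\<dots> = (\<Prod>i<n. if i \<in> descents n w then x i else 1) * (\<Prod>i<n. x i ^ (ds ! i))"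
        by (rule prod.distrib)
      also have "(\<Prod>i<n. if i \<in> descents n w then x i else 1) = (\<Prod>j\<in>descents n w. x j)"
      proof -
        have "descents n w \<subseteq> {..<n}" using descents_iff[OF w] by auto
        then show ?thesis by (simp add: prod.If_cases Int_absorb1)
      qed
      finally show ?thesis .
    qed
    ultimately show ?thesis by simp
  qed
  have "(?g has_sum (\<Sum>w | w permutes {1..n}. ?g w)) {w. w permutes {1..n}}"
    by (rule has_sum_finite) (simp add: finite_permutations)
  from has_sum_times[OF this has_sum_multigeometric[of n x, OF less]]
  have "((\<lambda>(w, ds). ?g w * (\<Prod>i<n. x i ^ (ds ! i))) has_sum
      ((\<Sum>w | w permutes {1..n}. ?g w) * (\<Prod>i<n. 1 / (1 - x i)))) ({w. w permutes {1..n}} \<times> {ds. length ds = n})"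
    by simp
  also have "?this \<longleftrightarrow> ((\<lambda>q. ?F (arrange n q)) has_sum
      ((\<Sum>w | w permutes {1..n}. ?g w) * (\<Prod>i<n. 1 / (1 - x i)))) ({w. w permutes {1..n}} \<times> {ds. length ds = n})"
    by (rule has_sum_cong) (use summand in auto)
  finally show ?thesis by (rule iffD1[OF has_sum_reindex_bij_betw[OF bij_betw_arrange[OF n(2)]]])
qed

section \<open>Coordinates on the Heisenberg group\<close>

text \<open>Coordinates with the group law \<open>(a, b, c) (a', b', c') = (a + a', b + b', c + c' + a b')\<close>; the projection
  modulo the centre forgets \<open>c\<close>.\<close>

definition hmat :: "('a, 'b) ring_scheme \<Rightarrow> 'a \<Rightarrow> 'a \<Rightarrow> 'a \<Rightarrow> nat \<times> nat \<Rightarrow> 'a" where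
  "hmat R a b c = (\<lambda>(i, j)\<in>idx3. if i = j then \<one>\<^bsub>R\<^esub> else if (i, j) = (1, 2) then a
     else if (i, j) = (2, 3) then b else if (i, j) = (1, 3) then c else \<zero>\<^bsub>R\<^esub>)"

lemma interval_1_3: "{1..3::nat} = {1, 2, 3}"
  by auto

lemma idx3_iff: "(i, j) \<in> idx3 \<longleftrightarrow> (i = 1 \<or> i = 2 \<or> i = 3) \<and> (j = 1 \<or> j = 2 \<or> j = 3)"
  unfolding idx3_def interval_1_3 by auto

lemma hmat_entries [simp]:
  "hmat R a b c (1, 2) = a" "hmat R a b c (2, 3) = b" "hmat R a b c (1, 3) = c"
  by (simp_all add: hmat_def idx3_iff)

lemma hmat_extensional: "hmat R a b c \<in> extensional idx3"
  by (simp add: hmat_def)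

lemma hmat_eq_iff: "hmat R a b c = hmat R a' b' c' \<longleftrightarrow> a = a' \<and> b = b' \<and> c = c'"
  by (metis hmat_entries)

context cring
begin

lemma hmat_carrier:
  assumes "a \<in> carrier R" "b \<in> carrier R" "c \<in> carrier R"
  shows "hmat R a b c \<in> carrier (heisenberg R)"
proof -
  have "hmat R a b c \<in> idx3 \<rightarrow>\<^sub>E carrier R" using assms by (auto simp: hmat_def)
  moreover have "hmat R a b c (i, i) = \<one>" if "i \<in> {1..3}" for i
    using that unfolding interval_1_3 by (elim insertE emptyE) (simp_all add: hmat_def idx3_iff)
  moreover have "hmat R a b c (i, j) = \<zero>" if "i \<in> {1..3}" "j \<in> {1..3}" "j < i" for i j
    using that unfolding interval_1_3 by (elim insertE emptyE) (simp_all add: hmat_def idx3_iff)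
  ultimately show ?thesis unfolding heisenberg_def by simp
qed

lemma heisenberg_carrierE:
  assumes "A \<in> carrier (heisenberg R)"
  obtains a b c where "a \<in> carrier R" "b \<in> carrier R" "c \<in> carrier R" "A = hmat R a b c"
proof -
  have A: "A \<in> idx3 \<rightarrow>\<^sub>E carrier R" "\<And>i. i \<in> {1..3} \<Longrightarrow> A (i, i) = \<one>"
    "\<And>i j. i \<in> {1..3} \<Longrightarrow> j \<in> {1..3} \<Longrightarrow> j < i \<Longrightarrow> A (i, j) = \<zero>"
    using assms unfolding heisenberg_def by simp_all
  have c: "A (1, 2) \<in> carrier R" "A (2, 3) \<in> carrier R" "A (1, 3) \<in> carrier R"
    by (rule PiE_mem[OF A(1)], simp add: idx3_iff)+
  have "A = hmat R (A (1, 2)) (A (2, 3)) (A (1, 3))"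
  proof (rule extensionalityI[of _ idx3])
    show "A \<in> extensional idx3" using A(1) by (simp add: PiE_def)
    show "hmat R (A (1, 2)) (A (2, 3)) (A (1, 3)) \<in> extensional idx3" by (rule hmat_extensional)
    fix q assume "q \<in> idx3"
    then obtain i j where q: "q = (i, j)" "(i = 1 \<or> i = 2 \<or> i = 3) \<and> (j = 1 \<or> j = 2 \<or> j = 3)"
      by (cases q) (simp add: idx3_iff)
    have d: "A (1, 1) = \<one>" "A (2, 2) = \<one>" "A (3, 3) = \<one>" using A(2) by auto
    have l: "A (2, 1) = \<zero>" "A (3, 1) = \<zero>" "A (3, 2) = \<zero>" using A(3) by auto
    show "A q = hmat R (A (1, 2)) (A (2, 3)) (A (1, 3)) q"
      using q(2) d l unfolding q(1) by (elim conjE disjE) (simp_all add: hmat_def idx3_iff)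
  qed
  then show thesis using that c by blast
qed

lemma hmat_mult:
  assumes "a \<in> carrier R" "b \<in> carrier R" "c \<in> carrier R" "a' \<in> carrier R" "b' \<in> carrier R" "c' \<in> carrier R"
  shows "hmat R a b c \<otimes>\<^bsub>heisenberg R\<^esub> hmat R a' b' c' = hmat R (a \<oplus> a') (b \<oplus> b') (c \<oplus> c' \<oplus> a \<otimes> b')"
proof -
  let ?M = "hmat R a b c \<otimes>\<^bsub>heisenberg R\<^esub> hmat R a' b' c'"
  have fs: "(\<Oplus>k\<in>{1..3}. g k) = g 1 \<oplus> (g 2 \<oplus> g 3)"
    if "g 1 \<in> carrier R" "g 2 \<in> carrier R" "g 3 \<in> carrier R" for g :: "nat \<Rightarrow> 'a"
    unfolding interval_1_3 using that by (simp add: Pi_def)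
  have hc: "hmat R x y z q \<in> carrier R"
    if "x \<in> carrier R" "y \<in> carrier R" "z \<in> carrier R" "q \<in> idx3" for x y z q
    using that by (cases q) (simp add: hmat_def)
  have entry: "?M (i, j) = hmat R a b c (i, 1) \<otimes> hmat R a' b' c' (1, j)
     \<oplus> (hmat R a b c (i, 2) \<otimes> hmat R a' b' c' (2, j) \<oplus> hmat R a b c (i, 3) \<otimes> hmat R a' b' c' (3, j))"
    if ij: "(i, j) \<in> idx3" for i j
  proof -
    have k: "(i, k) \<in> idx3 \<and> (k, j) \<in> idx3" if "k = 1 \<or> k = 2 \<or> k = 3" for k
      using ij that unfolding idx3_iff by blast
    have "?M (i, j) = (\<Oplus>k\<in>{1..3}. hmat R a b c (i, k) \<otimes> hmat R a' b' c' (k, j))"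
      using ij by (simp add: heisenberg_def)
    also have "\<dots> = hmat R a b c (i, 1) \<otimes> hmat R a' b' c' (1, j)
     \<oplus> (hmat R a b c (i, 2) \<otimes> hmat R a' b' c' (2, j) \<oplus> hmat R a b c (i, 3) \<otimes> hmat R a' b' c' (3, j))"
      using k by (intro fs m_closed hc assms) blast+
    finally show ?thesis .
  qed
  show ?thesis
  proof (rule extensionalityI[of _ idx3])
    show "?M \<in> extensional idx3" by (simp add: heisenberg_def)
    show "hmat R (a \<oplus> a') (b \<oplus> b') (c \<oplus> c' \<oplus> a \<otimes> b') \<in> extensional idx3" by (rule hmat_extensional)
    fix q assume q: "q \<in> idx3"
    obtain i j where ij: "q = (i, j)" by (cases q)
    have "(i = 1 \<or> i = 2 \<or> i = 3) \<and> (j = 1 \<or> j = 2 \<or> j = 3)" using q unfolding ij idx3_iff .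
    then show "?M q = hmat R (a \<oplus> a') (b \<oplus> b') (c \<oplus> c' \<oplus> a \<otimes> b') q"
      using entry[of i j] q unfolding ij
      by (elim conjE disjE) (simp_all add: hmat_def idx3_iff assms a_ac)
  qed
qed

lemma heisenberg_one: "\<one>\<^bsub>heisenberg R\<^esub> = hmat R \<zero> \<zero> \<zero>"
proof (rule extensionalityI[of _ idx3])
  fix q assume q: "q \<in> idx3"
  obtain i j where ij: "q = (i, j)" by (cases q)
  show "\<one>\<^bsub>heisenberg R\<^esub> q = hmat R \<zero> \<zero> \<zero> q" using q unfolding ij by (simp add: heisenberg_def hmat_def)
qed (simp_all add: heisenberg_def hmat_extensional)

lemma heisenberg_group: "group (heisenberg R)"
proof (rule groupI)
  fix x y assume "x \<in> carrier (heisenberg R)" "y \<in> carrier (heisenberg R)"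
  then show "x \<otimes>\<^bsub>heisenberg R\<^esub> y \<in> carrier (heisenberg R)"
    by (elim heisenberg_carrierE) (simp add: hmat_mult hmat_carrier)
next
  show "\<one>\<^bsub>heisenberg R\<^esub> \<in> carrier (heisenberg R)" by (simp add: heisenberg_one hmat_carrier)
next
  fix x y z assume xyz: "x \<in> carrier (heisenberg R)" "y \<in> carrier (heisenberg R)" "z \<in> carrier (heisenberg R)"
  obtain a b c where x: "a \<in> carrier R" "b \<in> carrier R" "c \<in> carrier R" "x = hmat R a b c"
    using xyz(1) by (rule heisenberg_carrierE)
  obtain a' b' c' where y: "a' \<in> carrier R" "b' \<in> carrier R" "c' \<in> carrier R" "y = hmat R a' b' c'"
    using xyz(2) by (rule heisenberg_carrierE)
  obtain a'' b'' c'' where z: "a'' \<in> carrier R" "b'' \<in> carrier R" "c'' \<in> carrier R" "z = hmat R a'' b'' c''"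
    using xyz(3) by (rule heisenberg_carrierE)
  note abc = x(1-3) y(1-3) z(1-3)
  have "c \<oplus> c' \<oplus> a \<otimes> b' \<oplus> c'' \<oplus> (a \<oplus> a') \<otimes> b'' = c \<oplus> (c' \<oplus> c'' \<oplus> a' \<otimes> b'') \<oplus> a \<otimes> (b' \<oplus> b'')"
    using abc by (simp add: l_distr r_distr a_ac)
  then show "x \<otimes>\<^bsub>heisenberg R\<^esub> y \<otimes>\<^bsub>heisenberg R\<^esub> z = x \<otimes>\<^bsub>heisenberg R\<^esub> (y \<otimes>\<^bsub>heisenberg R\<^esub> z)"
    unfolding x(4) y(4) z(4) using abc by (simp add: hmat_mult hmat_eq_iff a_assoc)
next
  fix x assume "x \<in> carrier (heisenberg R)"
  then show "\<one>\<^bsub>heisenberg R\<^esub> \<otimes>\<^bsub>heisenberg R\<^esub> x = x"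
    by (elim heisenberg_carrierE) (simp add: heisenberg_one hmat_mult)
next
  fix x assume "x \<in> carrier (heisenberg R)"
  then obtain a b c where x: "a \<in> carrier R" "b \<in> carrier R" "c \<in> carrier R" "x = hmat R a b c"
    by (rule heisenberg_carrierE)
  have "hmat R (\<ominus> a) (\<ominus> b) (\<ominus> c \<oplus> a \<otimes> b) \<otimes>\<^bsub>heisenberg R\<^esub> x = \<one>\<^bsub>heisenberg R\<^esub>"
  proof -
    have "\<ominus> a \<oplus> a = \<zero>" "\<ominus> b \<oplus> b = \<zero>" using x(1,2) by algebra+
    moreover have "\<ominus> c \<oplus> a \<otimes> b \<oplus> c \<oplus> (\<ominus> a) \<otimes> b = \<zero>" using x(1-3) by algebra
    ultimately show ?thesis using x by (simp add: hmat_mult heisenberg_one)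
  qed
  then show "\<exists>y\<in>carrier (heisenberg R). y \<otimes>\<^bsub>heisenberg R\<^esub> x = \<one>\<^bsub>heisenberg R\<^esub>"
    using x hmat_carrier by (intro bexI[of _ "hmat R (\<ominus> a) (\<ominus> b) (\<ominus> c \<oplus> a \<otimes> b)"]) auto
qed

definition heis_proj :: "(nat \<times> nat \<Rightarrow> 'a) \<Rightarrow> 'a \<times> 'a" where
  "heis_proj A = (A (1, 2), A (2, 3))"

lemma heis_proj_hmat: "heis_proj (hmat R a b c) = (a, b)"
  unfolding heis_proj_def hmat_entries ..

lemma heis_proj_hom: "group_hom (heisenberg R) (add_monoid R \<times>\<times> add_monoid R) heis_proj"
  unfolding group_hom_def group_hom_axioms_def
proof (intro conjI heisenberg_group DirProd_group a_group)
  show "heis_proj \<in> hom (heisenberg R) (add_monoid R \<times>\<times> add_monoid R)"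
    unfolding hom_def
  proof (intro CollectI conjI funcsetI ballI)
    fix x y assume "x \<in> carrier (heisenberg R)" "y \<in> carrier (heisenberg R)"
    then show "heis_proj (x \<otimes>\<^bsub>heisenberg R\<^esub> y) = heis_proj x \<otimes>\<^bsub>add_monoid R \<times>\<times> add_monoid R\<^esub> heis_proj y"
      by (elim heisenberg_carrierE) (simp add: hmat_mult heis_proj_hmat)
  next
    fix x assume "x \<in> carrier (heisenberg R)"
    then show "heis_proj x \<in> carrier (add_monoid R \<times>\<times> add_monoid R)"
      by (elim heisenberg_carrierE) (simp add: heis_proj_hmat)
  qed
qed

lemma heis_center_hom: "group_hom (add_monoid R) (heisenberg R) (hmat R \<zero> \<zero>)"
  unfolding group_hom_def group_hom_axioms_def hom_def
  using heisenberg_group a_group by (auto simp: hmat_carrier hmat_mult)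

lemma heis_central:
  assumes "c \<in> carrier R" "x \<in> carrier (heisenberg R)"
  shows "hmat R \<zero> \<zero> c \<otimes>\<^bsub>heisenberg R\<^esub> x = x \<otimes>\<^bsub>heisenberg R\<^esub> hmat R \<zero> \<zero> c"
  using assms(2) by (elim heisenberg_carrierE) (simp add: hmat_mult assms(1) hmat_eq_iff a_ac)

text \<open>The two products \<open>x y\<close> and \<open>y x\<close> differ only in the corner.\<close>

lemma heis_commutator:
  assumes "a \<in> carrier R" "b \<in> carrier R" "c \<in> carrier R" "a' \<in> carrier R" "b' \<in> carrier R" "c' \<in> carrier R"
  defines "x \<equiv> hmat R a b c" and "y \<equiv> hmat R a' b' c'"
  shows "x \<otimes>\<^bsub>heisenberg R\<^esub> y \<otimes>\<^bsub>heisenberg R\<^esub> inv\<^bsub>heisenberg R\<^esub> x \<otimes>\<^bsub>heisenberg R\<^esub> inv\<^bsub>heisenberg R\<^esub> y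
     = hmat R \<zero> \<zero> (a \<otimes> b' \<ominus> a' \<otimes> b)"
proof -
  interpret H: group "heisenberg R" by (rule heisenberg_group)
  let ?z = "hmat R \<zero> \<zero> (a \<otimes> b' \<ominus> a' \<otimes> b)"
  have xc: "x \<in> carrier (heisenberg R)" "y \<in> carrier (heisenberg R)" "?z \<in> carrier (heisenberg R)"
    using assms by (simp_all add: hmat_carrier)
  have "x \<otimes>\<^bsub>heisenberg R\<^esub> y = ?z \<otimes>\<^bsub>heisenberg R\<^esub> (y \<otimes>\<^bsub>heisenberg R\<^esub> x)"
  proof -
    have "a \<oplus> a' = \<zero> \<oplus> (a' \<oplus> a)" "b \<oplus> b' = \<zero> \<oplus> (b' \<oplus> b)" using assms(1-6) by algebra+
    moreover have "c \<oplus> c' \<oplus> a \<otimes> b' = a \<otimes> b' \<ominus> a' \<otimes> b \<oplus> (c' \<oplus> c \<oplus> a' \<otimes> b) \<oplus> \<zero> \<otimes> (b' \<oplus> b)"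
      using assms(1-6) by algebra
    ultimately show ?thesis unfolding x_def y_def using assms(1-6) by (simp add: hmat_mult)
  qed
  then show ?thesis using xc by (simp add: H.m_assoc)
qed

text \<open>The corner of the \<open>k\<close>-th power is \<open>k c\<close> up to an integer multiple of \<open>a b\<close>.\<close>

lemma heis_power:
  assumes "a \<in> carrier R" "b \<in> carrier R" "c \<in> carrier R" and I: "ideal I R" and "a \<in> I"
  shows "\<exists>y\<in>I. hmat R a b c [^]\<^bsub>heisenberg R\<^esub> (k::nat) = hmat R ([k] \<cdot> a) ([k] \<cdot> b) ([k] \<cdot> c \<oplus> y)"
proof (induction k)
  case 0
  have "\<zero> \<in> I" using I by (simp add: additive_subgroup.zero_closed ideal.axioms(1))
  then show ?case by (intro bexI[of _ \<zero>]) (simp_all add: nat_pow_def heisenberg_one)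
next
  case (Suc k)
  then obtain y where y: "y \<in> I" "hmat R a b c [^]\<^bsub>heisenberg R\<^esub> k = hmat R ([k] \<cdot> a) ([k] \<cdot> b) ([k] \<cdot> c \<oplus> y)" by blast
  have yc: "y \<in> carrier R" using ideal.Icarr[OF I y(1)] .
  have "[k] \<cdot> a \<otimes> b = a \<otimes> [k] \<cdot> b" using assms(1,2) by (simp add: add_pow_ldistr add_pow_rdistr)
  then have "[k] \<cdot> a \<otimes> b \<in> I" using ideal.I_r_closed[OF I assms(5), of "[k] \<cdot> b"] assms(2) by simp
  then have yI: "y \<oplus> [k] \<cdot> a \<otimes> b \<in> I"
    using y(1) additive_subgroup.a_closed[OF ideal.axioms(1)[OF I]] by blast
  have "hmat R a b c [^]\<^bsub>heisenberg R\<^esub> Suc k = hmat R ([k] \<cdot> a) ([k] \<cdot> b) ([k] \<cdot> c \<oplus> y) \<otimes>\<^bsub>heisenberg R\<^esub> hmat R a b c"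
    using y(2) by (simp add: nat_pow_def)
  also have "\<dots> = hmat R ([Suc k] \<cdot> a) ([Suc k] \<cdot> b) ([Suc k] \<cdot> c \<oplus> (y \<oplus> [k] \<cdot> a \<otimes> b))"
  proof -
    have "[k] \<cdot> c \<oplus> y \<oplus> c \<oplus> [k] \<cdot> a \<otimes> b = [k] \<cdot> c \<oplus> c \<oplus> (y \<oplus> [k] \<cdot> a \<otimes> b)"
      using assms(1-3) yc by (simp add: a_ac)
    then show ?thesis using assms(1-3) yc by (simp add: hmat_mult)
  qed
  finally show ?case using yI by blast
qed

end

section \<open>Open and normal subgroups of the Heisenberg group\<close>

sublocale padic_chain \<subseteq> lat: lattice_chain "add_monoid R" p n L
  by (rule chain)

sublocale padic_chain \<subseteq> sq: lattice_chain "add_monoid R \<times>\<times> add_monoid R" p "2 * n" "\<lambda>i. L (Suc i div 2) \<times> L (i div 2)"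
  by (rule lat.lattice_chain_square)

context padic_chain
begin

lemma L_carrier: "x \<in> L i \<Longrightarrow> x \<in> carrier R"
  using lat.F_carrier by simp

lemma L_ideal: "ideal (L (f * k)) R"
  unfolding L_multiple by (rule cgenideal_ideal) (use unif in simp)

lemma L_zero: "\<zero> \<in> L i"
  using subgroup.one_closed[OF lat.F_subgroup] by simp

lemma L_add: "x \<in> L i \<Longrightarrow> y \<in> L i \<Longrightarrow> x \<oplus> y \<in> L i"
  using subgroup.m_closed[OF lat.F_subgroup] by simp

lemma L_neg: "x \<in> L i \<Longrightarrow> \<ominus> x \<in> L i"
  using subgroup.m_inv_closed[OF lat.F_subgroup] unfolding a_inv_def .

lemma subgroup_add_facts:
  assumes "subgroup M (add_monoid R)"
  shows "\<zero> \<in> M" "x \<in> M \<Longrightarrow> y \<in> M \<Longrightarrow> x \<oplus> y \<in> M" "x \<in> M \<Longrightarrow> \<ominus> x \<in> M" "x \<in> M \<Longrightarrow> x \<in> carrier R"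
  using subgroup.one_closed[OF assms] subgroup.m_closed[OF assms] subgroup.m_inv_closed[OF assms]
    subgroup.mem_carrier[OF assms] by (simp_all add: a_inv_def)

text \<open>The elements on the left-hand side form the largest ideal inside \<open>M\<close>. It is a power of the maximal ideal,
  and which powers lie inside \<open>M\<close> is visible from the gaps.\<close>

lemma largest_ideal_in_lattice:
  assumes M: "M \<in> lat.lattices" and a: "a \<in> carrier R"
  shows "(\<forall>r\<in>carrier R. r \<otimes> a \<in> M) \<longleftrightarrow> a \<in> L (f * conductor f (lat.gaps M))"
proof -
  let ?k = "conductor f (lat.gaps M)"
  have ex: "\<exists>k. lat.gaps M \<subseteq> {..<f * k}"
  proof -
    obtain j where j: "lat.gaps M \<subseteq> {..<j}" using finite_nat_bounded[OF lat.finite_gaps[OF M]] by blast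
    have "j \<le> f * j" using f_pos by (cases f) auto
    then have "{..<j} \<subseteq> {..<f * j}" unfolding lessThan_subset_iff .
    from order_trans[OF j this] show ?thesis by (rule exI)
  qed
  have kM: "lat.gaps M \<subseteq> {..<f * ?k}" unfolding conductor_def by (rule LeastI_ex[OF ex])
  have kmin: "?k \<le> k" if "lat.gaps M \<subseteq> {..<f * k}" for k
    unfolding conductor_def by (rule Least_le[of "\<lambda>k. lat.gaps M \<subseteq> {..<f * k}", OF that])
  have LM: "L (f * ?k) \<subseteq> M" using lat.F_subset_if_gaps_bounded[OF M kM] .
  show ?thesis
  proof
    assume "a \<in> L (f * ?k)"
    then show "\<forall>r\<in>carrier R. r \<otimes> a \<in> M" using ideal.I_l_closed[OF L_ideal] LM by blast
  next
    assume aM: "\<forall>r\<in>carrier R. r \<otimes> a \<in> M"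
    show "a \<in> L (f * ?k)"
    proof (rule ccontr)
      assume na: "a \<notin> L (f * ?k)"
      show False
      proof (cases ?k)
        case 0
        then show False using na a lat.F_0 by simp
      next
        case (Suc k)
        have "L (f * k) \<subseteq> PIdl a" using ideal_below[OF a] na Suc by simp
        also have "PIdl a \<subseteq> M" using aM by (auto simp: mem_cgenideal_iff)
        finally have "lat.gaps M \<subseteq> {..<f * k}" by (rule lat.gaps_bounded)
        then show False using kmin[of k] Suc by simp
      qed
    qed
  qed
qed

lemma adic_neighbourhood:
  assumes ip: "\<And>k. ideal_power R (max_ideal R) k = L (f * k)"
    and "openin (adic_topology R (max_ideal R)) U" "x \<in> U"
  shows "x \<in> carrier R \<and> (\<exists>k. \<forall>y\<in>L (f * k). y \<oplus> x \<in> U)"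
proof -
  have "generate_topology_on {ideal_power R (max_ideal R) k +> a | k a. a \<in> carrier R} U"
    using assms(2) by (simp add: adic_topology_def openin_topology_generated_by_iff)
  then show ?thesis using assms(3)
  proof (induction arbitrary: x rule: generate_topology_on.induct)
    case Empty then show ?case by simp
  next
    case (Int U V)
    then obtain k l where k: "x \<in> carrier R" "\<forall>y\<in>L (f * k). y \<oplus> x \<in> U" and l: "\<forall>y\<in>L (f * l). y \<oplus> x \<in> V"
      by (meson IntD1 IntD2)
    have "L (f * max k l) \<subseteq> L (f * k)" "L (f * max k l) \<subseteq> L (f * l)" by (auto intro!: lat.F_antimono)
    then have "\<forall>y\<in>L (f * max k l). y \<oplus> x \<in> U \<inter> V" using k l by blast
    then show ?case using k by blast
  next
    case (UN K)
    then show ?case by (meson UnionE UnionI)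
  next
    case (Basis s)
    then obtain k a where s: "s = L (f * k) +> a" "a \<in> carrier R" using ip by auto
    have mem: "z \<in> s \<longleftrightarrow> (\<exists>h\<in>L (f * k). z = h \<oplus> a)" for z unfolding s(1) a_r_coset_def' by blast
    obtain h where h: "h \<in> L (f * k)" "x = h \<oplus> a" using Basis(2) mem by blast
    have "y \<oplus> x \<in> s" if y: "y \<in> L (f * k)" for y
    proof -
      have "y \<oplus> x = (y \<oplus> h) \<oplus> a" using y h s(2) L_carrier by (simp add: a_assoc)
      then show ?thesis using mem L_add[OF y h(1)] by blast
    qed
    moreover have "x \<in> carrier R" using h s(2) L_carrier by simp
    ultimately show ?case by blast
  qed
qed

text \<open>The sets of matrices on the right are cofinal among the neighbourhoods of \<open>1\<close> in the group.\<close>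

definition contains_congruence_subgroup :: "(nat \<times> nat \<Rightarrow> 'a) set \<Rightarrow> bool" where
  "contains_congruence_subgroup N \<longleftrightarrow>
     (\<exists>k. \<forall>a\<in>L (f * k). \<forall>b\<in>L (f * k). \<forall>c\<in>L (f * k). hmat R a b c \<in> N)"

lemma open_subgroup_contains_congruence:
  assumes ip: "\<And>k. ideal_power R (max_ideal R) k = L (f * k)"
    and N: "subgroup N (heisenberg R)" and op: "openin (heisenberg_topology R) N"
  shows "contains_congruence_subgroup N"
proof -
  let ?T = "product_topology (\<lambda>_. adic_topology R (max_ideal R)) idx3"
  let ?e = "hmat R \<zero> \<zero> \<zero>"
  obtain U where U: "openin ?T U" "N = U \<inter> carrier (heisenberg R)"
    using op unfolding heisenberg_topology_def openin_subtopology by blast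
  have eN: "?e \<in> N" using subgroup.one_closed[OF N] unfolding heisenberg_one .
  then have "?e \<in> U" using U by blast
  then obtain V where V: "\<forall>i\<in>idx3. openin (adic_topology R (max_ideal R)) (V i)" "?e \<in> PiE idx3 V" "PiE idx3 V \<subseteq> U"
    using U(1) unfolding openin_product_topology_alt by meson
  have "\<exists>k. \<forall>y\<in>L (f * k). y \<oplus> ?e q \<in> V q" if q: "q \<in> idx3" for q
    using adic_neighbourhood[OF ip, of "V q" "?e q"] V(1) PiE_mem[OF V(2) q] q by blast
  then obtain k where k: "\<And>q y. q \<in> idx3 \<Longrightarrow> y \<in> L (f * k q) \<Longrightarrow> y \<oplus> ?e q \<in> V q" by metis
  define K where "K = Max (k ` idx3)"
  have fin: "finite idx3" by (simp add: idx3_def)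
  have kK: "L (f * K) \<subseteq> L (f * k q)" if "q \<in> idx3" for q
    by (rule lat.F_antimono) (use that fin in \<open>simp add: K_def\<close>)
  show ?thesis unfolding contains_congruence_subgroup_def
  proof (intro exI[of _ K] ballI)
    fix a b c assume abc: "a \<in> L (f * K)" "b \<in> L (f * K)" "c \<in> L (f * K)"
    then have car: "a \<in> carrier R" "b \<in> carrier R" "c \<in> carrier R" using L_carrier by auto
    have "hmat R a b c q \<in> V q" if q: "q \<in> idx3" for q
    proof -
      define y where "y = (if q = (1, 2) then a else if q = (2, 3) then b else if q = (1, 3) then c else \<zero>)"
      have "y \<in> L (f * K)" using abc L_zero by (simp add: y_def)
      then have "y \<oplus> ?e q \<in> V q" using k[OF q] kK[OF q] by blast
      moreover have "y \<oplus> ?e q = hmat R a b c q"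
        using q car by (cases q) (auto simp: y_def hmat_def)
      ultimately show ?thesis by simp
    qed
    then have "hmat R a b c \<in> PiE idx3 V" using hmat_extensional by (simp add: PiE_iff)
    then show "hmat R a b c \<in> N" using V(3) U(2) hmat_carrier[OF car] by blast
  qed
qed

text \<open>With an element \<open>A\<close> the subgroup contains all matrices with entries close to those of \<open>A\<close>: such a matrix
  is a product of a matrix close to \<open>1\<close> and \<open>A\<close>.\<close>

lemma congruence_subgroup_open:
  assumes ip: "\<And>k. ideal_power R (max_ideal R) k = L (f * k)"
    and N: "subgroup N (heisenberg R)" and cc: "contains_congruence_subgroup N"
  shows "openin (heisenberg_topology R) N"
proof -
  obtain k where k: "\<And>a b c. a \<in> L (f * k) \<Longrightarrow> b \<in> L (f * k) \<Longrightarrow> c \<in> L (f * k) \<Longrightarrow> hmat R a b c \<in> N"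
    using cc unfolding contains_congruence_subgroup_def by blast
  let ?T = "product_topology (\<lambda>_. adic_topology R (max_ideal R)) idx3"
  have fin: "finite idx3" by (simp add: idx3_def)
  show ?thesis
  proof (subst openin_subopen, intro ballI)
    fix A assume A: "A \<in> N"
    have Ac: "A \<in> carrier (heisenberg R)" using subgroup.mem_carrier[OF N A] .
    obtain a b c where abc: "a \<in> carrier R" "b \<in> carrier R" "c \<in> carrier R" "A = hmat R a b c"
      using Ac by (rule heisenberg_carrierE)
    have AP: "A \<in> idx3 \<rightarrow>\<^sub>E carrier R" using Ac by (simp add: heisenberg_def)
    define V where "V = (\<lambda>q. L (f * k) +> A q)"
    have mem: "z \<in> V q \<longleftrightarrow> (\<exists>h\<in>L (f * k). z = h \<oplus> A q)" for z q unfolding V_def a_r_coset_def' by blast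
    have Vo: "openin (adic_topology R (max_ideal R)) (V q)" if "q \<in> idx3" for q
      unfolding adic_topology_def
      by (rule topology_generated_by_Basis) (use ip PiE_mem[OF AP that] in \<open>auto simp: V_def\<close>)
    have PVo: "openin ?T (PiE idx3 V)"
      unfolding openin_PiE_gen using fin Vo by simp
    have AV: "A \<in> PiE idx3 V"
    proof (rule PiE_I)
      fix q assume "q \<in> idx3"
      then have "A q = \<zero> \<oplus> A q" using PiE_mem[OF AP] by simp
      then show "A q \<in> V q" using mem L_zero by blast
    qed (use PiE_arb[OF AP] in blast)
    have "PiE idx3 V \<inter> carrier (heisenberg R) \<subseteq> N"
    proof
      fix B assume B: "B \<in> PiE idx3 V \<inter> carrier (heisenberg R)"
      then obtain a' b' c' where abc': "a' \<in> carrier R" "b' \<in> carrier R" "c' \<in> carrier R" "B = hmat R a' b' c'"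
        using heisenberg_carrierE by blast
      have q: "(1, 2) \<in> idx3" "(2, 3) \<in> idx3" "(1, 3) \<in> idx3" by (simp_all add: idx3_iff)
      have "B (1, 2) \<in> V (1, 2)" "B (2, 3) \<in> V (2, 3)" "B (1, 3) \<in> V (1, 3)"
        using B q PiE_mem[of B idx3 V] by blast+
      then obtain u v w where uvw: "u \<in> L (f * k)" "v \<in> L (f * k)" "w \<in> L (f * k)"
        "a' = u \<oplus> a" "b' = v \<oplus> b" "c' = w \<oplus> c"
        unfolding mem abc'(4) abc(4) hmat_entries by blast
      have uc: "u \<in> carrier R" "v \<in> carrier R" "w \<in> carrier R" using uvw L_carrier by auto
      have "u \<otimes> b \<in> L (f * k)" using ideal.I_r_closed[OF L_ideal uvw(1) abc(2)] .
      then have w': "w \<ominus> u \<otimes> b \<in> L (f * k)" unfolding a_minus_def using uvw(3) L_add L_neg by blast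
      have "w \<ominus> u \<otimes> b \<oplus> c \<oplus> u \<otimes> b = w \<oplus> c" using uc abc by algebra
      then have "B = hmat R u v (w \<ominus> u \<otimes> b) \<otimes>\<^bsub>heisenberg R\<^esub> A"
        unfolding abc'(4) abc(4) uvw(4-6) using uc abc by (simp add: hmat_mult)
      then show "B \<in> N" using subgroup.m_closed[OF N k[OF uvw(1,2) w'] A] by simp
    qed
    moreover have "openin (heisenberg_topology R) (PiE idx3 V \<inter> carrier (heisenberg R))"
      unfolding heisenberg_topology_def openin_subtopology using PVo by blast
    ultimately show "\<exists>T. openin (heisenberg_topology R) T \<and> A \<in> T \<and> T \<subseteq> N" using AV Ac by blast
  qed
qed

definition central_part :: "(nat \<times> nat \<Rightarrow> 'a) set \<Rightarrow> 'a set" where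
  "central_part N = {c \<in> carrier R. hmat R \<zero> \<zero> c \<in> N}"

lemma subgroup_central_part:
  assumes N: "subgroup N (heisenberg R)"
  shows "subgroup (central_part N) (add_monoid R)"
proof (rule group.subgroupI[OF a_group])
  show "central_part N \<subseteq> carrier (add_monoid R)" by (auto simp: central_part_def)
  show "central_part N \<noteq> {}"
    using subgroup.one_closed[OF N] unfolding heisenberg_one central_part_def by blast
next
  fix a assume "a \<in> central_part N"
  then have a: "a \<in> carrier R" "hmat R \<zero> \<zero> a \<in> N" by (auto simp: central_part_def)
  have "inv\<^bsub>heisenberg R\<^esub> (hmat R \<zero> \<zero> a) = hmat R \<zero> \<zero> (\<ominus> a)"
    using group_hom.hom_inv[OF heis_center_hom, of a] a(1) by (simp add: a_inv_def)
  then have "hmat R \<zero> \<zero> (\<ominus> a) \<in> N" using subgroup.m_inv_closed[OF N a(2)] by simp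
  then show "inv\<^bsub>add_monoid R\<^esub> a \<in> central_part N" using a(1) by (simp add: central_part_def a_inv_def[symmetric])
next
  fix a b assume "a \<in> central_part N" "b \<in> central_part N"
  then have ab: "a \<in> carrier R" "hmat R \<zero> \<zero> a \<in> N" "b \<in> carrier R" "hmat R \<zero> \<zero> b \<in> N" by (auto simp: central_part_def)
  have "hmat R \<zero> \<zero> a \<otimes>\<^bsub>heisenberg R\<^esub> hmat R \<zero> \<zero> b = hmat R \<zero> \<zero> (a \<oplus> b)"
    using ab by (simp add: hmat_mult)
  then have "hmat R \<zero> \<zero> (a \<oplus> b) \<in> N" using subgroup.m_closed[OF N ab(2,4)] by simp
  then show "a \<otimes>\<^bsub>add_monoid R\<^esub> b \<in> central_part N" using ab by (simp add: central_part_def)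
qed

lemma subgroup_proj:
  "subgroup N (heisenberg R) \<Longrightarrow> subgroup (heis_proj ` N) (add_monoid R \<times>\<times> add_monoid R)"
  by (rule group_hom.subgroup_img_is_subgroup[OF heis_proj_hom])

lemma mem_proj_iff:
  assumes "subgroup N (heisenberg R)"
  shows "(a, b) \<in> heis_proj ` N \<longleftrightarrow> a \<in> carrier R \<and> b \<in> carrier R \<and> (\<exists>c\<in>carrier R. hmat R a b c \<in> N)"
proof
  assume "(a, b) \<in> heis_proj ` N"
  then obtain x where x: "x \<in> N" "(a, b) = heis_proj x" by auto
  obtain a' b' c where "a' \<in> carrier R" "b' \<in> carrier R" "c \<in> carrier R" "x = hmat R a' b' c"
    using subgroup.mem_carrier[OF assms x(1)] by (rule heisenberg_carrierE)
  then show "a \<in> carrier R \<and> b \<in> carrier R \<and> (\<exists>c\<in>carrier R. hmat R a b c \<in> N)"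
    using x by (auto simp: heis_proj_hmat)
next
  assume "a \<in> carrier R \<and> b \<in> carrier R \<and> (\<exists>c\<in>carrier R. hmat R a b c \<in> N)"
  then obtain c where "hmat R a b c \<in> N" by blast
  then show "(a, b) \<in> heis_proj ` N" using heis_proj_hmat by (metis imageI)
qed

lemma add_pow_monoid: "x [^]\<^bsub>add_monoid R\<^esub> (k::nat) = [k] \<cdot> x"
  by (simp add: add_pow_def)

text \<open>For the converse, let the projection and the central part contain \<open>L (f k)\<close>. An element over a pair
  divisible by a high power \<open>q\<close> of \<open>p\<close> is found as the \<open>q\<close>-th power of an element of \<open>N\<close>. Taking the power
  forces its corner into \<open>L (f k)\<close>, where it can be corrected by the central part.\<close>

lemma contains_congruence_iff_lattices:
  assumes N: "subgroup N (heisenberg R)"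
  shows "contains_congruence_subgroup N \<longleftrightarrow> heis_proj ` N \<in> sq.lattices \<and> central_part N \<in> lat.lattices"
proof
  assume "contains_congruence_subgroup N"
  then obtain k where k: "\<And>a b c. a \<in> L (f * k) \<Longrightarrow> b \<in> L (f * k) \<Longrightarrow> c \<in> L (f * k) \<Longrightarrow> hmat R a b c \<in> N"
    unfolding contains_congruence_subgroup_def by blast
  have "L (f * k) \<subseteq> central_part N" using k L_zero L_carrier by (auto simp: central_part_def)
  then have 1: "central_part N \<in> lat.lattices" using subgroup_central_part[OF N] by (auto simp: lat.lattices_def)
  have "L (Suc (2 * (f * k)) div 2) \<times> L (2 * (f * k) div 2) \<subseteq> heis_proj ` N"
  proof
    fix q assume q: "q \<in> L (Suc (2 * (f * k)) div 2) \<times> L (2 * (f * k) div 2)"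
    obtain a b where ab: "q = (a, b)" by (cases q)
    have "a \<in> L (f * k)" "b \<in> L (f * k)" using q ab by simp_all
    then show "q \<in> heis_proj ` N"
      unfolding ab mem_proj_iff[OF N] using k L_zero L_carrier by blast
  qed
  then have "heis_proj ` N \<in> sq.lattices" using subgroup_proj[OF N] unfolding sq.lattices_def by blast
  then show "heis_proj ` N \<in> sq.lattices \<and> central_part N \<in> lat.lattices" using 1 by blast
next
  assume a: "heis_proj ` N \<in> sq.lattices \<and> central_part N \<in> lat.lattices"
  obtain i where i: "L (Suc i div 2) \<times> L (i div 2) \<subseteq> heis_proj ` N" using a unfolding sq.lattices_def by blast
  obtain j where j: "L j \<subseteq> central_part N" using a unfolding lat.lattices_def by blast
  \<comment> \<open>With \<open>k\<close> at least \<open>i + j\<close>, both shadows of \<open>N\<close> contain what lies in \<open>L (f k)\<close>.\<close>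
  define k where "k = i + j"
  have fk: "i + j \<le> f * k" using f_pos by (cases f) (auto simp: k_def)
  have LP: "(a, b) \<in> heis_proj ` N" if "a \<in> L (f * k)" "b \<in> L (f * k)" for a b
  proof -
    have "L (f * k) \<subseteq> L (Suc i div 2)" "L (f * k) \<subseteq> L (i div 2)" using fk by (auto intro!: lat.F_antimono)
    then show ?thesis using that i by blast
  qed
  have LC: "hmat R \<zero> \<zero> c \<in> N" if "c \<in> L (f * k)" for c
  proof -
    have "L (f * k) \<subseteq> L j" by (rule lat.F_antimono) (use fk in simp)
    then show ?thesis using that j by (auto simp: central_part_def)
  qed
  let ?l = "f * k" and ?q = "p ^ (f * k)"
  have shift: "L (i' + ?l * n) = (\<lambda>x. [?q] \<cdot> x) ` L i'" for i'
    using lat.F_shift_iterate[of i' ?l] unfolding add_pow_monoid .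
  \<comment> \<open>Depth \<open>f (k + k n)\<close> is where the elements of \<open>L (f k)\<close> arrive after multiplication by \<open>q\<close>.\<close>
  show "contains_congruence_subgroup N" unfolding contains_congruence_subgroup_def
  proof (intro exI[of _ "k + k * n"] ballI)
    fix a b c assume abc: "a \<in> L (f * (k + k * n))" "b \<in> L (f * (k + k * n))" "c \<in> L (f * (k + k * n))"
    have e: "f * (k + k * n) = ?l + ?l * n" by (simp add: algebra_simps)
    obtain a0 where a0: "a0 \<in> L ?l" "a = [?q] \<cdot> a0" using abc(1) unfolding e shift by blast
    obtain b0 where b0: "b0 \<in> L ?l" "b = [?q] \<cdot> b0" using abc(2) unfolding e shift by blast
    obtain c0 where c0: "c0 \<in> carrier R" "hmat R a0 b0 c0 \<in> N"
      using LP[OF a0(1) b0(1)] unfolding mem_proj_iff[OF N] by blast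
    obtain y where y: "y \<in> L ?l" "hmat R a0 b0 c0 [^]\<^bsub>heisenberg R\<^esub> ?q = hmat R a b ([?q] \<cdot> c0 \<oplus> y)"
      using heis_power[OF L_carrier[OF a0(1)] L_carrier[OF b0(1)] c0(1) L_ideal a0(1), of ?q] a0(2) b0(2) by auto
    have hN: "hmat R a b ([?q] \<cdot> c0 \<oplus> y) \<in> N"
      using group.subgroup_nat_pow_closed[OF heisenberg_group N c0(2), of ?q] y(2) by simp
    have "[?q] \<cdot> c0 \<in> L (0 + ?l * n)" unfolding shift using c0(1) lat.F_0 by auto
    moreover have "L (0 + ?l * n) \<subseteq> L ?l" using lat.d_pos by (intro lat.F_antimono) simp
    ultimately have s: "[?q] \<cdot> c0 \<oplus> y \<in> L ?l" using y(1) L_add by blast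
    have "L (f * (k + k * n)) \<subseteq> L ?l" by (rule lat.F_antimono) simp
    then have cl: "c \<in> L ?l" using abc(3) by blast
    then have d: "c \<ominus> ([?q] \<cdot> c0 \<oplus> y) \<in> L ?l" unfolding a_minus_def using s L_add L_neg by blast
    let ?s = "[?q] \<cdot> c0 \<oplus> y"
    have car: "a \<in> carrier R" "b \<in> carrier R" "c \<in> carrier R" "?s \<in> carrier R" "c \<ominus> ?s \<in> carrier R"
      using abc cl s d L_carrier by auto
    have "c \<ominus> ?s \<oplus> ?s \<oplus> \<zero> \<otimes> b = c" using car(2-4) by algebra
    then have "hmat R \<zero> \<zero> (c \<ominus> ?s) \<otimes>\<^bsub>heisenberg R\<^esub> hmat R a b ?s = hmat R a b c"
      using car by (simp add: hmat_mult)
    then show "hmat R a b c \<in> N" using subgroup.m_closed[OF N LC[OF d] hN] by simp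
  qed
qed

text \<open>Conjugation changes an element by a commutator, and the commutators of an element over \<open>(a, b)\<close> with the
  whole group are the central elements \<open>r b - a s\<close> with arbitrary \<open>r\<close> and \<open>s\<close>.\<close>

lemma normal_iff_proj:
  assumes N: "subgroup N (heisenberg R)" and M: "central_part N \<in> lat.lattices"
  defines "I \<equiv> L (f * conductor f (lat.gaps (central_part N)))"
  shows "N \<lhd> heisenberg R \<longleftrightarrow> heis_proj ` N \<subseteq> I \<times> I"
proof -
  interpret H: group "heisenberg R" by (rule heisenberg_group)
  have MI: "a \<in> I \<longleftrightarrow> (\<forall>r\<in>carrier R. r \<otimes> a \<in> central_part N)" if "a \<in> carrier R" for a
    unfolding I_def using largest_ideal_in_lattice[OF M that] by simp
  note C = subgroup_add_facts[OF subgroup_central_part[OF N]]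
  show ?thesis
  proof
    assume nor: "N \<lhd> heisenberg R"
    have comm: "hmat R \<zero> \<zero> (r \<otimes> b \<ominus> a \<otimes> s) \<in> N"
      if h: "hmat R a b c \<in> N" "a \<in> carrier R" "b \<in> carrier R" "c \<in> carrier R" and rs: "r \<in> carrier R" "s \<in> carrier R"
      for a b c r s
    proof -
      let ?g = "hmat R r s \<zero>" and ?h = "hmat R a b c"
      have g: "?g \<in> carrier (heisenberg R)" using rs by (simp add: hmat_carrier)
      have "?g \<otimes>\<^bsub>heisenberg R\<^esub> ?h \<otimes>\<^bsub>heisenberg R\<^esub> inv\<^bsub>heisenberg R\<^esub> ?g \<in> N"
        using nor g h(1) unfolding H.normal_inv_iff by blast
      then have "?g \<otimes>\<^bsub>heisenberg R\<^esub> ?h \<otimes>\<^bsub>heisenberg R\<^esub> inv\<^bsub>heisenberg R\<^esub> ?g \<otimes>\<^bsub>heisenberg R\<^esub> inv\<^bsub>heisenberg R\<^esub> ?h \<in> N"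
        using subgroup.m_closed[OF N] subgroup.m_inv_closed[OF N h(1)] by blast
      then show ?thesis using heis_commutator[OF rs zero_closed h(2-4)] by simp
    qed
    show "heis_proj ` N \<subseteq> I \<times> I"
    proof
      fix q assume q: "q \<in> heis_proj ` N"
      obtain a b where ab: "q = (a, b)" by (cases q)
      obtain c where c: "a \<in> carrier R" "b \<in> carrier R" "c \<in> carrier R" "hmat R a b c \<in> N"
        using q unfolding ab mem_proj_iff[OF N] by blast
      have "r \<otimes> b \<in> central_part N" if r: "r \<in> carrier R" for r
      proof -
        have "r \<otimes> b \<ominus> a \<otimes> \<zero> = r \<otimes> b" using r c by algebra
        then show ?thesis using comm[OF c(4,1-3) r zero_closed] r c by (simp add: central_part_def)
      qed
      moreover have "r \<otimes> a \<in> central_part N" if r: "r \<in> carrier R" for r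
      proof -
        have "\<zero> \<otimes> b \<ominus> a \<otimes> (\<ominus> r) = r \<otimes> a" using r c by algebra
        then show ?thesis using comm[OF c(4,1-3) zero_closed, of "\<ominus> r"] r c by (simp add: central_part_def)
      qed
      ultimately show "q \<in> I \<times> I" using MI c ab by simp
    qed
  next
    assume sub: "heis_proj ` N \<subseteq> I \<times> I"
    show "N \<lhd> heisenberg R"
    proof (rule H.normal_invI[OF N])
      fix x h assume x: "x \<in> carrier (heisenberg R)" and h: "h \<in> N"
      have hc: "h \<in> carrier (heisenberg R)" using subgroup.mem_carrier[OF N h] .
      obtain a b c where X: "a \<in> carrier R" "b \<in> carrier R" "c \<in> carrier R" "x = hmat R a b c"
        using x by (rule heisenberg_carrierE)
      obtain a' b' c' where Y: "a' \<in> carrier R" "b' \<in> carrier R" "c' \<in> carrier R" "h = hmat R a' b' c'"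
        using hc by (rule heisenberg_carrierE)
      have "(a', b') \<in> I \<times> I" using sub h heis_proj_hmat Y(4) by (metis imageI subsetD)
      then have "a \<otimes> b' \<in> central_part N" "b \<otimes> a' \<in> central_part N" using MI Y X by auto
      then have "a \<otimes> b' \<ominus> a' \<otimes> b \<in> central_part N"
        unfolding a_minus_def using C(2,3) m_comm[OF X(2) Y(1)] by simp
      then have "hmat R \<zero> \<zero> (a \<otimes> b' \<ominus> a' \<otimes> b) \<in> N" by (simp add: central_part_def)
      then have "x \<otimes>\<^bsub>heisenberg R\<^esub> h \<otimes>\<^bsub>heisenberg R\<^esub> inv\<^bsub>heisenberg R\<^esub> x \<otimes>\<^bsub>heisenberg R\<^esub> inv\<^bsub>heisenberg R\<^esub> h \<in> N"
        using heis_commutator[OF X(1-3) Y(1-3)] X(4) Y(4) by simp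
      then have "x \<otimes>\<^bsub>heisenberg R\<^esub> h \<otimes>\<^bsub>heisenberg R\<^esub> inv\<^bsub>heisenberg R\<^esub> x \<otimes>\<^bsub>heisenberg R\<^esub> inv\<^bsub>heisenberg R\<^esub> h \<otimes>\<^bsub>heisenberg R\<^esub> h \<in> N"
        using subgroup.m_closed[OF N] h by blast
      then show "x \<otimes>\<^bsub>heisenberg R\<^esub> h \<otimes>\<^bsub>heisenberg R\<^esub> inv\<^bsub>heisenberg R\<^esub> x \<in> N" using x hc by (simp add: H.m_assoc)
    qed
  qed
qed

section \<open>Subgroups with given projection and central part\<close>

text \<open>This is \<open>card_extensions\<close> with \<open>Z\<close> the centre, \<open>P\<close> the preimage of \<open>M1\<close> and \<open>E\<close> a chain from \<open>M2\<close> to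
  \<open>R\<close>. The commutators of elements of \<open>P\<close> lie in the largest ideal inside \<open>M2\<close>, hence in \<open>E 0\<close>, and the factor
  \<open>c\<close> is the index of \<open>p M1\<close> in \<open>M1\<close>, a lattice of rank \<open>2 n\<close>.\<close>

lemma card_subgroups_over:
  assumes M1: "M1 \<in> sq.lattices" and M2: "M2 \<in> lat.lattices"
    and sub: "M1 \<subseteq> L (f * conductor f (lat.gaps M2)) \<times> L (f * conductor f (lat.gaps M2))"
  defines "S \<equiv> {N. subgroup N (heisenberg R) \<and> heis_proj ` N = M1 \<and> central_part N = M2}"
  shows "finite S \<and> card S = p ^ (2 * n * card (lat.gaps M2)) \<and>
    (\<forall>N\<in>S. rel_index (heisenberg R) (carrier (heisenberg R)) N = p ^ (card (sq.gaps M1) + card (lat.gaps M2)))"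
proof -
  let ?H = "heisenberg R" and ?A = "add_monoid R" and ?Q = "add_monoid R \<times>\<times> add_monoid R"
  let ?k = "card (lat.gaps M2)" and ?z = "hmat R \<zero> \<zero>"
  have Qg: "group ?Q" by (rule DirProd_group[OF a_group a_group])
  interpret H: group ?H by (rule heisenberg_group)
  interpret pr: group_hom ?H ?Q heis_proj by (rule heis_proj_hom)
  interpret ce: group_hom ?A ?H ?z by (rule heis_center_hom)
  have hc [simp]: "heis_proj x \<in> carrier R \<times> carrier R" if "x \<in> carrier ?H" for x
    using pr.hom_closed[OF that] by simp
  have M1s: "subgroup M1 ?Q" using M1 by (simp add: sq.lattices_def)
  define Z where "Z = ?z ` carrier R"
  define P where "P = {x \<in> carrier ?H. heis_proj x \<in> M1}"
  have Zs: "subgroup Z ?H" unfolding Z_def using ce.subgroup_img_is_subgroup[OF group.subgroup_self[OF a_group]] by simp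
  have Ps: "subgroup P ?H"
  proof (rule H.subgroupI)
    show "P \<noteq> {}" using pr.hom_one subgroup.one_closed[OF M1s] by (auto simp: P_def)
    show "inv\<^bsub>?H\<^esub> a \<in> P" if "a \<in> P" for a using that subgroup.m_inv_closed[OF M1s] by (auto simp: P_def)
    show "a \<otimes>\<^bsub>?H\<^esub> b \<in> P" if "a \<in> P" "b \<in> P" for a b using that subgroup.m_closed[OF M1s] by (auto simp: P_def)
  qed (auto simp: P_def)
  have Zker: "x \<in> Z \<longleftrightarrow> heis_proj x = \<one>\<^bsub>?Q\<^esub>" if xc: "x \<in> carrier ?H" for x
  proof -
    obtain a b c where x: "a \<in> carrier R" "b \<in> carrier R" "c \<in> carrier R" "x = hmat R a b c"
      using xc by (rule heisenberg_carrierE)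
    then show ?thesis by (auto simp: Z_def hmat_eq_iff heis_proj_hmat)
  qed
  have ZP: "Z \<subseteq> P"
  proof
    fix x assume x: "x \<in> Z"
    have "x \<in> carrier ?H" using subgroup.mem_carrier[OF Zs x] .
    then show "x \<in> P" using x Zker subgroup.one_closed[OF M1s] by (simp add: P_def)
  qed
  have kerZ: "kernel ?H ?Q heis_proj \<subseteq> Z" using Zker by (auto simp: kernel_def)
  have surj: "q \<in> heis_proj ` carrier ?H" if q: "q \<in> carrier R \<times> carrier R" for q
  proof -
    obtain a b where "q = (a, b)" "a \<in> carrier R" "b \<in> carrier R" using q by (cases q) auto
    then have "hmat R a b \<zero> \<in> carrier ?H" "q = heis_proj (hmat R a b \<zero>)" by (simp_all add: hmat_carrier heis_proj_hmat)
    then show ?thesis by blast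
  qed
  have M1c: "M1 \<subseteq> carrier R \<times> carrier R" using subgroup.subset[OF M1s] by simp
  have prP: "heis_proj ` P = M1"
  proof (intro equalityI subsetI)
    fix q assume q: "q \<in> M1"
    then obtain x where "x \<in> carrier ?H" "q = heis_proj x" using surj M1c by blast
    then show "q \<in> heis_proj ` P" using q unfolding P_def by blast
  qed (auto simp: P_def)
  have prH: "heis_proj ` carrier ?H = carrier ?Q"
  proof (intro equalityI subsetI)
    fix q assume "q \<in> heis_proj ` carrier ?H"
    then obtain x where x: "x \<in> carrier ?H" "q = heis_proj x" by blast
    show "q \<in> carrier ?Q" unfolding x(2) by (rule pr.hom_closed[OF x(1)])
  next
    fix q assume "q \<in> carrier ?Q"
    then show "q \<in> heis_proj ` carrier ?H" by (intro surj) simp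
  qed
  have central: "z \<otimes>\<^bsub>?H\<^esub> g = g \<otimes>\<^bsub>?H\<^esub> z" if z: "z \<in> Z" and g: "g \<in> carrier ?H" for z g
    using z heis_central[OF _ g] by (auto simp: Z_def)
  have tf: "x \<in> Z" if x: "x \<in> P" and xp: "x [^]\<^bsub>?H\<^esub> p \<in> Z" for x
  proof -
    have xc: "x \<in> carrier ?H" using x by (simp add: P_def)
    have "heis_proj x [^]\<^bsub>?Q\<^esub> p = heis_proj (x [^]\<^bsub>?H\<^esub> p)" using pr.hom_nat_pow[OF xc] by simp
    also have "\<dots> = \<one>\<^bsub>?Q\<^esub>" using Zker xp xc by simp
    finally have "heis_proj x = \<one>\<^bsub>?Q\<^esub>" by (rule sq.pow_p_eq_one[rotated]) (use xc in simp)
    then show ?thesis using Zker xc by simp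
  qed
  have commutator_eq: "\<exists>e\<in>L (f * conductor f (lat.gaps M2)). x \<otimes>\<^bsub>?H\<^esub> y \<otimes>\<^bsub>?H\<^esub> inv\<^bsub>?H\<^esub> x \<otimes>\<^bsub>?H\<^esub> inv\<^bsub>?H\<^esub> y = ?z e"
    if x: "x \<in> P" and y: "y \<in> P" for x y
  proof -
    let ?I = "L (f * conductor f (lat.gaps M2))"
    have xyc: "x \<in> carrier ?H" "y \<in> carrier ?H" using x y unfolding P_def by blast+
    obtain a b c where xx: "a \<in> carrier R" "b \<in> carrier R" "c \<in> carrier R" "x = hmat R a b c"
      using xyc(1) by (rule heisenberg_carrierE)
    obtain a' b' c' where yy: "a' \<in> carrier R" "b' \<in> carrier R" "c' \<in> carrier R" "y = hmat R a' b' c'"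
      using xyc(2) by (rule heisenberg_carrierE)
    have "a \<in> ?I" "a' \<in> ?I" using x y sub unfolding P_def xx(4) yy(4) by (auto simp: heis_proj_hmat)
    then have "a \<otimes> b' \<in> ?I" "a' \<otimes> b \<in> ?I" using ideal.I_r_closed[OF L_ideal] xx(2) yy(2) by blast+
    then have "a \<otimes> b' \<ominus> a' \<otimes> b \<in> ?I" unfolding a_minus_def using L_add L_neg by blast
    then show ?thesis using heis_commutator[OF xx(1-3) yy(1-3)] xx(4) yy(4) by auto
  qed
  have IM2: "L (f * conductor f (lat.gaps M2)) \<subseteq> M2"
  proof
    fix x assume x: "x \<in> L (f * conductor f (lat.gaps M2))"
    then have "\<one> \<otimes> x \<in> M2" using largest_ideal_in_lattice[OF M2 L_carrier[OF x]] by blast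
    then show "x \<in> M2" using L_carrier[OF x] by simp
  qed
  obtain E0 where E0: "E0 0 = M2" "E0 ?k = carrier R" "\<And>i::nat. subgroup (E0 i) ?A"
    "\<And>i. i < ?k \<Longrightarrow> E0 i \<subseteq> E0 (Suc i) \<and> rel_index ?A (E0 (Suc i)) (E0 i) = p \<and>
       (\<forall>x\<in>E0 (Suc i). x [^]\<^bsub>?A\<^esub> p \<in> E0 i)"
    using lat.chain_to_top[OF M2] by auto
  define E where "E = (\<lambda>i. ?z ` E0 i)"
  have comm: "commutators_in ?H P (E 0)" unfolding commutators_in_def
  proof (intro ballI)
    fix x y assume "x \<in> P" "y \<in> P"
    then obtain e where "e \<in> L (f * conductor f (lat.gaps M2))"
      "x \<otimes>\<^bsub>?H\<^esub> y \<otimes>\<^bsub>?H\<^esub> inv\<^bsub>?H\<^esub> x \<otimes>\<^bsub>?H\<^esub> inv\<^bsub>?H\<^esub> y = ?z e" using commutator_eq by blast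
    then show "x \<otimes>\<^bsub>?H\<^esub> y \<otimes>\<^bsub>?H\<^esub> inv\<^bsub>?H\<^esub> x \<otimes>\<^bsub>?H\<^esub> inv\<^bsub>?H\<^esub> y \<in> E 0"
      unfolding E_def E0(1) using IM2 by blast
  qed
  have E0c: "x \<in> E0 i \<Longrightarrow> x \<in> carrier R" for x i using subgroup.mem_carrier[OF E0(3)] by simp
  have Es: "subgroup (E i) ?H" for i unfolding E_def by (rule ce.subgroup_img_is_subgroup[OF E0(3)])
  have Ek: "E ?k = Z" by (simp add: E_def Z_def E0(2))
  have Emono: "E i \<subseteq> E (Suc i)" if "i < ?k" for i unfolding E_def using E0(4)[OF that] by blast
  have Ei: "rel_index ?H (E (Suc i)) (E i) = p" if "i < ?k" for i
  proof -
    have "kernel ?A ?H ?z \<subseteq> E0 i"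
      using subgroup.one_closed[OF E0(3)[of i]] by (auto simp: kernel_def heisenberg_one hmat_eq_iff)
    then show ?thesis
      unfolding E_def using ce.rel_index_image[OF E0(3) E0(3), of i "Suc i"] E0(4)[OF that] by simp
  qed
  have Ep: "x [^]\<^bsub>?H\<^esub> p \<in> E i" if i: "i < ?k" and x: "x \<in> E (Suc i)" for i x
  proof -
    obtain y where y: "y \<in> E0 (Suc i)" "x = ?z y" using x by (auto simp: E_def)
    have "x [^]\<^bsub>?H\<^esub> p = ?z (y [^]\<^bsub>?A\<^esub> p)" using ce.hom_nat_pow[of y p] E0c[OF y(1)] y(2) by simp
    then show ?thesis unfolding E_def using E0(4)[OF i] y(1) by blast
  qed
  define W where "W = Z <#>\<^bsub>?H\<^esub> (\<lambda>a. a [^]\<^bsub>?H\<^esub> p) ` P"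
  have commZ: "commutators_in ?H P Z"
  proof -
    have "E 0 \<subseteq> Z" unfolding E_def Z_def using E0c by blast
    then show ?thesis using H.commutators_in_mono[OF comm] by blast
  qed
  have Ws: "subgroup W ?H" unfolding W_def by (rule H.subgroup_powers_mod_in_subgroup[OF Ps Zs ZP commZ])
  have Pc: "x \<in> P \<Longrightarrow> x \<in> carrier ?H" for x by (simp add: P_def)
  have WP: "W \<subseteq> P" unfolding W_def
    by (rule H.set_mult_least[OF Ps ZP]) (use H.subgroup_nat_pow_closed[OF Ps] in auto)
  have ZW: "Z \<subseteq> W"
  proof
    fix z assume z: "z \<in> Z"
    then have "z = z \<otimes>\<^bsub>?H\<^esub> \<one>\<^bsub>?H\<^esub> [^]\<^bsub>?H\<^esub> p" using subgroup.mem_carrier[OF Zs] by simp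
    then show "z \<in> W" unfolding W_def set_mult_def using z subgroup.one_closed[OF Ps] by blast
  qed
  have prW: "heis_proj ` W = (\<lambda>x. x [^]\<^bsub>?Q\<^esub> p) ` M1"
  proof (intro equalityI subsetI)
    fix q assume "q \<in> heis_proj ` W"
    then obtain z x where zx: "z \<in> Z" "x \<in> P" "q = heis_proj (z \<otimes>\<^bsub>?H\<^esub> x [^]\<^bsub>?H\<^esub> p)"
      by (auto simp: W_def set_mult_def)
    have zc: "z \<in> carrier ?H" using subgroup.mem_carrier[OF Zs zx(1)] .
    have "q = heis_proj z \<otimes>\<^bsub>?Q\<^esub> heis_proj x [^]\<^bsub>?Q\<^esub> p"
      using zx zc Pc[OF zx(2)] pr.hom_mult[OF zc, of "x [^]\<^bsub>?H\<^esub> p"] pr.hom_nat_pow[OF Pc[OF zx(2)]] by simp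
    also have "heis_proj z = \<one>\<^bsub>?Q\<^esub>" using Zker[OF zc] zx(1) by blast
    also have "\<one>\<^bsub>?Q\<^esub> \<otimes>\<^bsub>?Q\<^esub> heis_proj x [^]\<^bsub>?Q\<^esub> p = heis_proj x [^]\<^bsub>?Q\<^esub> p"
      by (rule monoid.l_one[OF group.is_monoid[OF Qg] monoid.nat_pow_closed[OF group.is_monoid[OF Qg] pr.hom_closed[OF Pc[OF zx(2)]]]])
    finally show "q \<in> (\<lambda>x. x [^]\<^bsub>?Q\<^esub> p) ` M1" using prP zx(2) by blast
  next
    fix q assume "q \<in> (\<lambda>x. x [^]\<^bsub>?Q\<^esub> p) ` M1"
    then obtain x where x: "x \<in> P" "q = heis_proj x [^]\<^bsub>?Q\<^esub> p" using prP by blast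
    have "x [^]\<^bsub>?H\<^esub> p = \<one>\<^bsub>?H\<^esub> \<otimes>\<^bsub>?H\<^esub> x [^]\<^bsub>?H\<^esub> p" using Pc[OF x(1)] by simp
    then have "x [^]\<^bsub>?H\<^esub> p \<in> W" unfolding W_def set_mult_def using x(1) subgroup.one_closed[OF Zs] by blast
    moreover have "q = heis_proj (x [^]\<^bsub>?H\<^esub> p)" using pr.hom_nat_pow[OF Pc[OF x(1)]] x(2) by simp
    ultimately show "q \<in> heis_proj ` W" by blast
  qed
  have idx: "rel_index ?H P W = p ^ (2 * n)"
    using pr.rel_index_image[OF Ps Ws WP order_trans[OF kerZ ZW]] sq.rel_index_powers[OF M1] prP prW by simp
  have nz: "p ^ (2 * n) \<noteq> 0" using lat.prime_p by auto
  have ext: "finite {N. subgroup N ?H \<and> N <#>\<^bsub>?H\<^esub> Z = P \<and> N \<inter> Z = E 0} \<and>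
      card {N. subgroup N ?H \<and> N <#>\<^bsub>?H\<^esub> Z = P \<and> N \<inter> Z = E 0} = (p ^ (2 * n)) ^ ?k \<and>
      (\<forall>N. subgroup N ?H \<and> N <#>\<^bsub>?H\<^esub> Z = P \<and> N \<inter> Z = E 0 \<longrightarrow> rel_index ?H P N = p ^ ?k)"
    by (rule H.card_extensions[OF lat.prime_p Zs Ps ZP central tf idx[unfolded W_def] nz Es Emono Ek Ei Ep comm])
  have S_eq: "S = {N. subgroup N ?H \<and> N <#>\<^bsub>?H\<^esub> Z = P \<and> N \<inter> Z = E 0}"
  proof -
    have "heis_proj ` N = M1 \<and> central_part N = M2 \<longleftrightarrow> N <#>\<^bsub>?H\<^esub> Z = P \<and> N \<inter> Z = E 0"
      if N: "subgroup N ?H" for N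
    proof -
      have Nc: "x \<in> N \<Longrightarrow> x \<in> carrier ?H" for x using subgroup.mem_carrier[OF N] .
      have NZ: "x \<in> N <#>\<^bsub>?H\<^esub> Z \<longleftrightarrow> heis_proj x \<in> heis_proj ` N" if x: "x \<in> carrier ?H" for x
      proof
        assume "x \<in> N <#>\<^bsub>?H\<^esub> Z"
        then obtain y z where yz: "y \<in> N" "z \<in> Z" "x = y \<otimes>\<^bsub>?H\<^esub> z" by (auto simp: set_mult_def)
        have zc: "z \<in> carrier ?H" using subgroup.mem_carrier[OF Zs yz(2)] .
        have "heis_proj x = heis_proj y \<otimes>\<^bsub>?Q\<^esub> heis_proj z" using yz zc Nc by simp
        also have "heis_proj z = \<one>\<^bsub>?Q\<^esub>" using Zker[OF zc] yz(2) by blast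
        also have "heis_proj y \<otimes>\<^bsub>?Q\<^esub> \<one>\<^bsub>?Q\<^esub> = heis_proj y" by (rule monoid.r_one[OF group.is_monoid[OF Qg] pr.hom_closed[OF Nc[OF yz(1)]]])
        finally show "heis_proj x \<in> heis_proj ` N" using yz(1) by blast
      next
        assume "heis_proj x \<in> heis_proj ` N"
        then obtain y where y: "y \<in> N" "heis_proj x = heis_proj y" by auto
        have "heis_proj (inv\<^bsub>?H\<^esub> y \<otimes>\<^bsub>?H\<^esub> x) = inv\<^bsub>?Q\<^esub> (heis_proj y) \<otimes>\<^bsub>?Q\<^esub> heis_proj y"
          using y Nc x by (simp del: inv_DirProd)
        also have "\<dots> = \<one>\<^bsub>?Q\<^esub>" by (rule group.l_inv[OF Qg pr.hom_closed[OF Nc[OF y(1)]]])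
        finally have "inv\<^bsub>?H\<^esub> y \<otimes>\<^bsub>?H\<^esub> x \<in> Z" using Zker y Nc x by simp
        moreover have "x = y \<otimes>\<^bsub>?H\<^esub> (inv\<^bsub>?H\<^esub> y \<otimes>\<^bsub>?H\<^esub> x)" using y Nc x by (simp add: H.m_assoc[symmetric])
        ultimately show "x \<in> N <#>\<^bsub>?H\<^esub> Z" unfolding set_mult_def using y(1) by blast
      qed
      have NZc: "N <#>\<^bsub>?H\<^esub> Z \<subseteq> carrier ?H" using H.set_mult_closed[OF subgroup.subset[OF N] subgroup.subset[OF Zs]] .
      have Piff: "x \<in> P \<longleftrightarrow> x \<in> carrier ?H \<and> heis_proj x \<in> M1" for x by (simp add: P_def)
      have 1: "N <#>\<^bsub>?H\<^esub> Z = P \<longleftrightarrow> heis_proj ` N = M1"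
      proof
        assume e: "N <#>\<^bsub>?H\<^esub> Z = P"
        show "heis_proj ` N = M1"
        proof (intro equalityI subsetI)
          fix q assume "q \<in> heis_proj ` N"
          then obtain x where x: "x \<in> N" "q = heis_proj x" by blast
          then have "x \<in> P" unfolding e[symmetric] NZ[OF Nc[OF x(1)]] by blast
          then show "q \<in> M1" unfolding Piff x(2) by blast
        next
          fix q assume q: "q \<in> M1"
          then obtain x where x: "x \<in> carrier ?H" "q = heis_proj x" using surj M1c by blast
          then have "x \<in> N <#>\<^bsub>?H\<^esub> Z" using q unfolding e Piff by blast
          then show "q \<in> heis_proj ` N" unfolding NZ[OF x(1)] x(2) .
        qed
      next
        assume e: "heis_proj ` N = M1"
        have "x \<in> N <#>\<^bsub>?H\<^esub> Z \<longleftrightarrow> x \<in> P" for x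
          using NZ[of x] NZc unfolding e Piff by blast
        then show "N <#>\<^bsub>?H\<^esub> Z = P" by blast
      qed
      have NZi: "N \<inter> Z = ?z ` central_part N" unfolding Z_def central_part_def by blast
      have 2: "N \<inter> Z = E 0 \<longleftrightarrow> central_part N = M2"
      proof
        assume "N \<inter> Z = E 0"
        then have e: "?z ` central_part N = ?z ` M2" unfolding NZi E_def E0(1) .
        show "central_part N = M2"
        proof (rule inj_image_eq_iff[THEN iffD1, OF _ e])
          show "inj ?z" by (rule injI) (simp add: hmat_eq_iff)
        qed
      qed (simp add: NZi E_def E0(1))
      show ?thesis using 1 2 by blast
    qed
    then show ?thesis unfolding S_def by blast
  qed
  have PM: "rel_index ?H (carrier ?H) P = p ^ card (sq.gaps M1)"
  proof -
    have "rel_index ?H (carrier ?H) P = rel_index ?Q (heis_proj ` carrier ?H) (heis_proj ` P)"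
      by (rule pr.rel_index_image[OF H.subgroup_self Ps subgroup.subset[OF Ps] order_trans[OF kerZ ZP], symmetric])
    then show ?thesis unfolding prP prH using sq.rel_index_lattice[OF M1] by simp
  qed
  have "rel_index ?H (carrier ?H) N = p ^ (card (sq.gaps M1) + ?k)" if N: "N \<in> S" for N
  proof -
    have Ns: "subgroup N ?H" "N <#>\<^bsub>?H\<^esub> Z = P" "N \<inter> Z = E 0" using N unfolding S_eq by blast+
    have NP: "N \<subseteq> P" using H.set_mult_superset(1)[OF Ns(1) Zs] Ns(2) by simp
    have "rel_index ?H P N = p ^ ?k" using ext Ns by blast
    then show ?thesis
      using H.rel_index_trans[OF H.subgroup_self Ps Ns(1) NP subgroup.subset[OF Ps]] PM by (simp add: power_add)
  qed
  moreover have "finite S \<and> card S = (p ^ (2 * n)) ^ ?k" unfolding S_eq using ext by blast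
  ultimately show ?thesis by (simp add: power_mult)
qed

section \<open>Scaling by powers of the uniformizer\<close>

definition scale :: "nat \<Rightarrow> 'a \<times> 'a \<Rightarrow> 'a \<times> 'a" where
  "scale k q = (\<pi> [^] k \<otimes> fst q, \<pi> [^] k \<otimes> snd q)"

lemma pi_pow: "\<pi> [^] (k::nat) \<in> carrier R" "\<pi> [^] (k::nat) \<noteq> \<zero>"
  using unif by (induction k) (auto simp: integral_iff)

lemma scale_hom: "group_hom (add_monoid R \<times>\<times> add_monoid R) (add_monoid R \<times>\<times> add_monoid R) (scale k)"
  unfolding group_hom_def group_hom_axioms_def hom_def
  using pi_pow(1)[of k] by (auto simp: scale_def r_distr intro!: DirProd_group a_group)

lemma scale_inj: "inj_on (scale k) (carrier R \<times> carrier R)"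
  using pi_pow[of k] by (auto simp: inj_on_def scale_def m_lcancel)

lemma scale_image_L: "scale k ` (L (f * j) \<times> L (f * j)) = L (f * (k + j)) \<times> L (f * (k + j))"
proof -
  have img: "L (f * (k + j)) = (\<otimes>) (\<pi> [^] k) ` L (f * j)"
  proof (intro equalityI subsetI)
    fix y assume "y \<in> L (f * (k + j))"
    then obtain x where x: "x \<in> carrier R" "y = x \<otimes> \<pi> [^] (k + j)" unfolding L_multiple mem_cgenideal_iff by blast
    have "\<pi> [^] (k + j) = \<pi> [^] k \<otimes> \<pi> [^] j" using unif(1) by (simp add: nat_pow_mult)
    then have "y = \<pi> [^] k \<otimes> (x \<otimes> \<pi> [^] j)" using x pi_pow(1) by (simp add: m_ac)
    moreover have "x \<otimes> \<pi> [^] j \<in> L (f * j)" unfolding L_multiple mem_cgenideal_iff using x(1) by blast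
    ultimately show "y \<in> (\<otimes>) (\<pi> [^] k) ` L (f * j)" by blast
  next
    fix y assume "y \<in> (\<otimes>) (\<pi> [^] k) ` L (f * j)"
    then obtain x' where x': "x' \<in> L (f * j)" "y = \<pi> [^] k \<otimes> x'" by blast
    obtain x where "x \<in> carrier R" "x' = x \<otimes> \<pi> [^] j" using x'(1) unfolding L_multiple mem_cgenideal_iff by blast
    then have x: "x \<in> carrier R" "y = \<pi> [^] k \<otimes> (x \<otimes> \<pi> [^] j)" using x'(2) by simp_all
    have "\<pi> [^] (k + j) = \<pi> [^] k \<otimes> \<pi> [^] j" using unif(1) by (simp add: nat_pow_mult)
    then have "y = x \<otimes> \<pi> [^] (k + j)" using x pi_pow(1) by (simp add: m_ac)
    then show "y \<in> L (f * (k + j))" unfolding L_multiple mem_cgenideal_iff using x(1) by blast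
  qed
  show ?thesis
  proof (intro equalityI subsetI)
    fix q assume "q \<in> L (f * (k + j)) \<times> L (f * (k + j))"
    then obtain a b where "a \<in> L (f * j)" "b \<in> L (f * j)" "q = (\<pi> [^] k \<otimes> a, \<pi> [^] k \<otimes> b)"
      unfolding img by blast
    then show "q \<in> scale k ` (L (f * j) \<times> L (f * j))" unfolding scale_def image_iff by (intro bexI[of _ "(a, b)"]) simp_all
  qed (auto simp: scale_def img)
qed

lemma L_square: "L (Suc (2 * i) div 2) \<times> L (2 * i div 2) = L i \<times> L i"
  by simp

text \<open>The filtration of \<open>R \<times> R\<close> interlaces two copies of that of \<open>R\<close>; cofinal in it are the squares of ideals.\<close>

lemma square_lattice_iff: "M \<in> sq.lattices \<longleftrightarrow>
    subgroup M (add_monoid R \<times>\<times> add_monoid R) \<and> (\<exists>j. L (f * j) \<times> L (f * j) \<subseteq> M)"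
proof
  assume "M \<in> sq.lattices"
  then obtain i where i: "subgroup M (add_monoid R \<times>\<times> add_monoid R)" "L (Suc i div 2) \<times> L (i div 2) \<subseteq> M"
    unfolding sq.lattices_def by blast
  have "i \<le> f * i" using f_pos by (cases f) auto
  moreover have "Suc i div 2 \<le> i" "i div 2 \<le> i" by auto
  ultimately have "L (f * i) \<subseteq> L (Suc i div 2)" "L (f * i) \<subseteq> L (i div 2)"
    by (meson lat.F_antimono order_trans)+
  then have "L (f * i) \<times> L (f * i) \<subseteq> M" using i(2) by blast
  then show "subgroup M (add_monoid R \<times>\<times> add_monoid R) \<and> (\<exists>j. L (f * j) \<times> L (f * j) \<subseteq> M)" using i(1) by blast
next
  assume "subgroup M (add_monoid R \<times>\<times> add_monoid R) \<and> (\<exists>j. L (f * j) \<times> L (f * j) \<subseteq> M)"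
  then obtain j where j: "subgroup M (add_monoid R \<times>\<times> add_monoid R)" "L (f * j) \<times> L (f * j) \<subseteq> M" by blast
  have "L (Suc (2 * (f * j)) div 2) \<times> L (2 * (f * j) div 2) \<subseteq> M" unfolding L_square by (rule j(2))
  then show "M \<in> sq.lattices" unfolding sq.lattices_def using j(1) by blast
qed

definition unscale :: "nat \<Rightarrow> ('a \<times> 'a) set \<Rightarrow> ('a \<times> 'a) set" where
  "unscale k M = {q \<in> carrier R \<times> carrier R. scale k q \<in> M}"

lemma unscale_scale: "M \<subseteq> carrier R \<times> carrier R \<Longrightarrow> unscale k (scale k ` M) = M"
  using scale_inj[of k] unfolding unscale_def inj_on_def by blast

text \<open>Scaling is injective, so \<open>M\<close> has in \<open>R \<times> R\<close> the index that its image has in the image of \<open>R \<times> R\<close>, and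
  this image has \<open>2 f k\<close> gaps.\<close>

lemma scale_lattice:
  assumes M: "M \<in> sq.lattices"
  shows "scale k ` M \<in> sq.lattices" "scale k ` M \<subseteq> L (f * k) \<times> L (f * k)"
    "card (sq.gaps (scale k ` M)) = 2 * f * k + card (sq.gaps M)"
proof -
  let ?Q = "add_monoid R \<times>\<times> add_monoid R"
  have Qg: "group ?Q" by (rule DirProd_group[OF a_group a_group])
  interpret sc: group_hom ?Q ?Q "scale k" by (rule scale_hom)
  have Ms: "subgroup M ?Q" using M unfolding sq.lattices_def by blast
  have Mc: "M \<subseteq> carrier R \<times> carrier R" using subgroup.subset[OF Ms] by simp
  obtain j where j: "L (f * j) \<times> L (f * j) \<subseteq> M" using M unfolding square_lattice_iff by blast
  have "L (f * (k + j)) \<times> L (f * (k + j)) \<subseteq> scale k ` M" using j unfolding scale_image_L[symmetric] by blast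
  then show sL: "scale k ` M \<in> sq.lattices"
    unfolding square_lattice_iff using sc.subgroup_img_is_subgroup[OF Ms] by blast
  have c0: "carrier R \<times> carrier R = L (f * 0) \<times> L (f * 0)" using lat.F_0 by simp
  have img: "scale k ` (carrier R \<times> carrier R) = L (f * k) \<times> L (f * k)"
    unfolding c0 scale_image_L by simp
  show sub: "scale k ` M \<subseteq> L (f * k) \<times> L (f * k)" using Mc img by blast
  have T: "L (f * k) \<times> L (f * k) = L (Suc (2 * (f * k)) div 2) \<times> L (2 * (f * k) div 2)" by (rule L_square[symmetric])
  have TL: "L (f * k) \<times> L (f * k) \<in> sq.lattices" unfolding T by (rule sq.F_lattice)
  have gT: "sq.gaps (L (f * k) \<times> L (f * k)) = {..<2 * (f * k)}" unfolding T by (rule sq.gaps_F)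
  have "kernel ?Q ?Q (scale k) \<subseteq> M"
  proof
    fix q assume "q \<in> kernel ?Q ?Q (scale k)"
    then have q: "q \<in> carrier R \<times> carrier R" "scale k q = \<one>\<^bsub>?Q\<^esub>" by (auto simp: kernel_def)
    then have "scale k q = scale k \<one>\<^bsub>?Q\<^esub>" using sc.hom_one by simp
    then have "q = \<one>\<^bsub>?Q\<^esub>" by (rule inj_onD[OF scale_inj]) (use q in auto)
    then show "q \<in> M" using subgroup.one_closed[OF Ms] by simp
  qed
  then have "rel_index ?Q (scale k ` (carrier R \<times> carrier R)) (scale k ` M) = rel_index ?Q (carrier R \<times> carrier R) M"
    using sc.rel_index_image[OF group.subgroup_self[OF Qg] Ms] Mc by simp
  then have "rel_index ?Q (L (f * k) \<times> L (f * k)) (scale k ` M) = p ^ card (sq.gaps M)"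
    unfolding img using sq.rel_index_lattice[OF M] by simp
  then have "p ^ card (sq.gaps (scale k ` M) - {..<2 * (f * k)}) = p ^ card (sq.gaps M)"
    using sq.rel_index_between_lattices[OF TL sL sub] gT by simp
  then have "card (sq.gaps (scale k ` M) - {..<2 * (f * k)}) = card (sq.gaps M)"
    using prime_gt_1_nat[OF lat.prime_p] by simp
  moreover have "{..<2 * (f * k)} \<subseteq> sq.gaps (scale k ` M)"
    unfolding gT[symmetric] using sub by (auto simp: sq.gaps_def)
  ultimately have "card (sq.gaps (scale k ` M)) = 2 * (f * k) + card (sq.gaps M)"
    using card_Diff_subset[of "{..<2 * (f * k)}" "sq.gaps (scale k ` M)"]
      card_mono[OF sq.finite_gaps[OF sL], of "{..<2 * (f * k)}"] by simp
  then show "card (sq.gaps (scale k ` M)) = 2 * f * k + card (sq.gaps M)" by simp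
qed

lemma unscale_lattice:
  assumes M: "M \<in> sq.lattices" and sub: "M \<subseteq> L (f * k) \<times> L (f * k)"
  shows "unscale k M \<in> sq.lattices" "scale k ` unscale k M = M"
proof -
  let ?Q = "add_monoid R \<times>\<times> add_monoid R"
  have Qg: "group ?Q" by (rule DirProd_group[OF a_group a_group])
  interpret sc: group_hom ?Q ?Q "scale k" by (rule scale_hom)
  have Ms: "subgroup M ?Q" using M unfolding sq.lattices_def by blast
  have c0: "carrier R \<times> carrier R = L (f * 0) \<times> L (f * 0)" using lat.F_0 by simp
  have img: "scale k ` (carrier R \<times> carrier R) = L (f * k) \<times> L (f * k)"
    unfolding c0 scale_image_L by simp
  show "scale k ` unscale k M = M"
  proof (intro equalityI subsetI)
    fix q assume q: "q \<in> M"
    then have "q \<in> scale k ` (carrier R \<times> carrier R)" unfolding img by (rule subsetD[OF sub])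
    then obtain r where r: "q = scale k r" "r \<in> carrier R \<times> carrier R" by (rule imageE)
    then have "r \<in> unscale k M" unfolding unscale_def using q by (intro CollectI conjI) simp_all
    then show "q \<in> scale k ` unscale k M" unfolding r(1) by (rule imageI)
  qed (auto simp: unscale_def)
  obtain j where j: "L (f * j) \<times> L (f * j) \<subseteq> M" using M unfolding square_lattice_iff by blast
  have "L (f * j) \<times> L (f * j) \<subseteq> unscale k M"
  proof
    fix q assume q: "q \<in> L (f * j) \<times> L (f * j)"
    then have "scale k q \<in> L (f * (k + j)) \<times> L (f * (k + j))" unfolding scale_image_L[symmetric] by (rule imageI)
    moreover have "L (f * (k + j)) \<subseteq> L (f * j)" by (rule lat.F_antimono) simp
    then have "L (f * (k + j)) \<times> L (f * (k + j)) \<subseteq> L (f * j) \<times> L (f * j)" by (intro Sigma_mono)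
    ultimately have "scale k q \<in> L (f * j) \<times> L (f * j)" by (rule subsetD[rotated])
    then have "scale k q \<in> M" by (rule subsetD[OF j])
    moreover have "q \<in> carrier R \<times> carrier R" using q by (auto intro: L_carrier)
    ultimately show "q \<in> unscale k M" unfolding unscale_def by (intro CollectI conjI)
  qed
  moreover have "subgroup (unscale k M) ?Q"
  proof (rule group.subgroupI[OF Qg])
    show "unscale k M \<subseteq> carrier ?Q" by (auto simp: unscale_def)
    have "scale k (\<zero>, \<zero>) \<in> M" using sc.hom_one subgroup.one_closed[OF Ms] by simp
    then have "(\<zero>, \<zero>) \<in> unscale k M" by (simp add: unscale_def)
    then show "unscale k M \<noteq> {}" by blast
    show "inv\<^bsub>?Q\<^esub> a \<in> unscale k M" if "a \<in> unscale k M" for a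
    proof -
      have a: "a \<in> carrier ?Q" "scale k a \<in> M" using that by (auto simp: unscale_def)
      have "scale k (inv\<^bsub>?Q\<^esub> a) \<in> M" using sc.hom_inv[OF a(1)] subgroup.m_inv_closed[OF Ms a(2)] by simp
      moreover have "inv\<^bsub>?Q\<^esub> a \<in> carrier ?Q" using group.inv_closed[OF Qg a(1)] .
      ultimately show ?thesis by (simp add: unscale_def)
    qed
    show "a \<otimes>\<^bsub>?Q\<^esub> b \<in> unscale k M" if "a \<in> unscale k M" "b \<in> unscale k M" for a b
    proof -
      have ab: "a \<in> carrier ?Q" "scale k a \<in> M" "b \<in> carrier ?Q" "scale k b \<in> M" using that by (auto simp: unscale_def)
      have "scale k (a \<otimes>\<^bsub>?Q\<^esub> b) \<in> M" using sc.hom_mult[OF ab(1,3)] subgroup.m_closed[OF Ms ab(2,4)] by simp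
      moreover have "a \<otimes>\<^bsub>?Q\<^esub> b \<in> carrier ?Q" using monoid.m_closed[OF group.is_monoid[OF Qg] ab(1,3)] .
      ultimately show ?thesis by (simp add: unscale_def)
    qed
  qed
  ultimately show "unscale k M \<in> sq.lattices" unfolding square_lattice_iff by blast
qed

section \<open>The fibres of the gap statistics\<close>

definition open_normal :: "(nat \<times> nat \<Rightarrow> 'a) set set" where
  "open_normal = {N. N \<lhd> heisenberg R \<and> openin (heisenberg_topology R) N}"

text \<open>The exponent \<open>k\<close> for which \<open>\<pi> ^ k R\<close> is the largest ideal inside the central part.\<close>

definition level :: "(nat \<times> nat \<Rightarrow> 'a) set \<Rightarrow> nat" where
  "level N = conductor f (lat.gaps (central_part N))"

text \<open>The first component describes the projection after division by \<open>\<pi> ^ k\<close>, which by normality is again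
  a lattice and is subject to no further condition.\<close>

definition gap_pair :: "(nat \<times> nat \<Rightarrow> 'a) set \<Rightarrow> nat set \<times> nat set" where
  "gap_pair N = (sq.gaps (unscale (level N) (heis_proj ` N)), lat.gaps (central_part N))"

lemma open_normal_iff:
  assumes ip: "\<And>k. ideal_power R (max_ideal R) k = L (f * k)"
  shows "N \<in> open_normal \<longleftrightarrow> subgroup N (heisenberg R) \<and> heis_proj ` N \<in> sq.lattices \<and> central_part N \<in> lat.lattices \<and>
    heis_proj ` N \<subseteq> L (f * level N) \<times> L (f * level N)"
proof (cases "subgroup N (heisenberg R)")
  case True
  have "openin (heisenberg_topology R) N \<longleftrightarrow> heis_proj ` N \<in> sq.lattices \<and> central_part N \<in> lat.lattices"
    using contains_congruence_iff_lattices[OF True] open_subgroup_contains_congruence[OF ip True]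
      congruence_subgroup_open[OF ip True] by blast
  then show ?thesis
    using normal_iff_proj[OF True] True unfolding open_normal_def level_def by blast
next
  case False
  then show ?thesis unfolding open_normal_def using normal_imp_subgroup by blast
qed

lemma card_rcosets_eq_rel_index: "card (rcosets\<^bsub>G\<^esub> N) = rel_index G (carrier G) N"
  unfolding RCOSETS_def rel_index_def by (rule arg_cong[where f = card]) blast

text \<open>A subgroup is determined by the pair of lattices up to the count of \<open>card_subgroups_over\<close>, and the lattices in
  turn by their gaps up to the count of \<open>card_lattices_with_gaps\<close>. The second part records the effect of
  the scaling on the index.\<close>

theorem open_normal_fibres:
  assumes ip: "\<And>k. ideal_power R (max_ideal R) k = L (f * k)"
  shows "N \<in> open_normal \<Longrightarrow> gap_pair N \<in> {S. flush_set (2 * n) S} \<times> {S. flush_set n S}"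
    and "N \<in> open_normal \<Longrightarrow> card (rcosets\<^bsub>heisenberg R\<^esub> N) =
      p ^ (card (fst (gap_pair N)) + (card (snd (gap_pair N)) + 2 * f * conductor f (snd (gap_pair N))))"
    and "flush_set (2 * n) S1 \<Longrightarrow> flush_set n S2 \<Longrightarrow> finite {N \<in> open_normal. gap_pair N = (S1, S2)} \<and>
      card {N \<in> open_normal. gap_pair N = (S1, S2)} = p ^ (gap_weight (2 * n) S1 + (gap_weight n S2 + 2 * n * card S2))"
proof -
  note iff = open_normal_iff[OF ip]
  show "gap_pair N \<in> {S. flush_set (2 * n) S} \<times> {S. flush_set n S}" if N: "N \<in> open_normal"
  proof -
    have "unscale (level N) (heis_proj ` N) \<in> sq.lattices" using N unfolding iff by (intro unscale_lattice(1)) blast+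
    then have "flush_set (2 * n) (sq.gaps (unscale (level N) (heis_proj ` N)))" by (rule sq.flush_set_gaps)
    moreover have "flush_set n (lat.gaps (central_part N))" by (rule lat.flush_set_gaps) (use N iff in blast)
    ultimately show ?thesis by (simp add: gap_pair_def)
  qed
  show "card (rcosets\<^bsub>heisenberg R\<^esub> N) =
      p ^ (card (fst (gap_pair N)) + (card (snd (gap_pair N)) + 2 * f * conductor f (snd (gap_pair N))))"
    if N: "N \<in> open_normal"
  proof -
    have N': "subgroup N (heisenberg R)" "heis_proj ` N \<in> sq.lattices" "central_part N \<in> lat.lattices"
      "heis_proj ` N \<subseteq> L (f * level N) \<times> L (f * level N)" using N unfolding iff by blast+
    have "rel_index (heisenberg R) (carrier (heisenberg R)) N =
        p ^ (card (sq.gaps (heis_proj ` N)) + card (lat.gaps (central_part N)))"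
      using card_subgroups_over[OF N'(2,3) N'(4)[unfolded level_def]] N'(1) by blast
    moreover have "card (sq.gaps (heis_proj ` N)) = 2 * f * level N + card (sq.gaps (unscale (level N) (heis_proj ` N)))"
      using scale_lattice(3)[OF unscale_lattice(1)[OF N'(2,4)], of "level N"] unscale_lattice(2)[OF N'(2,4)] by simp
    ultimately show ?thesis unfolding card_rcosets_eq_rel_index by (simp add: gap_pair_def level_def ac_simps)
  qed
  assume S1: "flush_set (2 * n) S1" and S2: "flush_set n S2"
  let ?T1 = "{M \<in> sq.lattices. sq.gaps M = S1}" and ?T2 = "{M \<in> lat.lattices. lat.gaps M = S2}"
  let ?X = "{N \<in> open_normal. gap_pair N = (S1, S2)}"
  let ?h = "\<lambda>N. (unscale (level N) (heis_proj ` N), central_part N)"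
  have T1: "finite ?T1 \<and> card ?T1 = p ^ gap_weight (2 * n) S1" by (rule sq.card_lattices_with_gaps[OF S1])
  have T2: "finite ?T2 \<and> card ?T2 = p ^ gap_weight n S2" by (rule lat.card_lattices_with_gaps[OF S2])
  have "finite ?X \<and> card ?X = (\<Sum>q\<in>?T1 \<times> ?T2. p ^ (2 * n * card S2))"
  proof (rule card_by_fibres[where h = ?h])
    show "finite (?T1 \<times> ?T2)" using T1 T2 by simp
    show "?h N \<in> ?T1 \<times> ?T2" if "N \<in> ?X" for N
    proof -
      have N: "N \<in> open_normal" "gap_pair N = (S1, S2)" using that by auto
      have "unscale (level N) (heis_proj ` N) \<in> sq.lattices" using N(1) unfolding iff by (intro unscale_lattice(1)) blast+
      moreover have "central_part N \<in> lat.lattices" using N(1) iff by blast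
      ultimately show ?thesis using N(2) by (simp add: gap_pair_def)
    qed
    show "finite {N \<in> ?X. ?h N = q} \<and> card {N \<in> ?X. ?h N = q} = p ^ (2 * n * card S2)" if q: "q \<in> ?T1 \<times> ?T2" for q
    proof -
      obtain M1 M2 where qq: "q = (M1, M2)" by (cases q)
      have M1: "M1 \<in> sq.lattices" "sq.gaps M1 = S1" and M2: "M2 \<in> lat.lattices" "lat.gaps M2 = S2" using q qq by auto
      let ?k = "conductor f (lat.gaps M2)"
      have M1c: "M1 \<subseteq> carrier R \<times> carrier R" using M1(1) subgroup.subset[of M1] unfolding sq.lattices_def by fastforce
      note sl = scale_lattice[OF M1(1), of ?k]
      have "{N \<in> ?X. ?h N = q} = {N. subgroup N (heisenberg R) \<and> heis_proj ` N = scale ?k ` M1 \<and> central_part N = M2}"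
      proof (intro equalityI subsetI)
        fix N assume "N \<in> {N \<in> ?X. ?h N = q}"
        then have N: "N \<in> open_normal" "unscale (level N) (heis_proj ` N) = M1" "central_part N = M2" using qq by auto
        have lv: "level N = ?k" using N(3) by (simp add: level_def)
        have "heis_proj ` N \<in> sq.lattices" "heis_proj ` N \<subseteq> L (f * level N) \<times> L (f * level N)"
          using N(1) unfolding iff by blast+
        from unscale_lattice(2)[OF this] have "heis_proj ` N = scale ?k ` M1" using N(2) lv by simp
        then show "N \<in> {N. subgroup N (heisenberg R) \<and> heis_proj ` N = scale ?k ` M1 \<and> central_part N = M2}"
          using N iff by blast
      next
        fix N assume "N \<in> {N. subgroup N (heisenberg R) \<and> heis_proj ` N = scale ?k ` M1 \<and> central_part N = M2}"
        then have N: "subgroup N (heisenberg R)" "heis_proj ` N = scale ?k ` M1" "central_part N = M2" by auto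
        have lv: "level N = ?k" using N(3) by (simp add: level_def)
        have on: "N \<in> open_normal" unfolding iff using N sl M2 lv by simp
        have un: "unscale (level N) (heis_proj ` N) = M1" unfolding lv N(2) by (rule unscale_scale[OF M1c])
        then have "gap_pair N = (S1, S2)" using M1 M2 N(3) by (simp add: gap_pair_def)
        then show "N \<in> {N \<in> ?X. ?h N = q}" using on un N(3) qq by simp
      qed
      then show ?thesis using card_subgroups_over[OF sl(1) M2(1) sl(2)] M2(2) by simp
    qed
  qed
  moreover have "(\<Sum>q\<in>?T1 \<times> ?T2. p ^ (2 * n * card S2)) = p ^ (gap_weight (2 * n) S1 + (gap_weight n S2 + 2 * n * card S2))"
    using T1 T2 by (simp add: card_cartesian_product power_add)
  ultimately show "finite ?X \<and> card ?X = p ^ (gap_weight (2 * n) S1 + (gap_weight n S2 + 2 * n * card S2))" by simp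
qed

end

section \<open>The Dirichlet series\<close>

lemma finite_flush_sets_card_le:
  assumes "d > 0"
  shows "finite {S. flush_set d S \<and> card S \<le> v}"
proof (rule finite_subset)
  show "{S. flush_set d S \<and> card S \<le> v} \<subseteq> runner_gaps ` {ms. set ms \<subseteq> {..v} \<and> length ms = d}"
  proof
    fix S assume S: "S \<in> {S. flush_set d S \<and> card S \<le> v}"
    then obtain ms where ms: "length ms = d" "S = runner_gaps ms"
      using bij_betw_imp_surj_on[OF bij_betw_runner_gaps[OF assms]] by auto
    have "x \<le> v" if "x \<in> set ms" for x
      using member_le_sum_list[of x ms] that S ms card_runner_gaps[of ms] by simp
    then show "S \<in> runner_gaps ` {ms. set ms \<subseteq> {..v} \<and> length ms = d}" using ms by auto
  qed
  show "finite (runner_gaps ` {ms. set ms \<subseteq> {..v} \<and> length ms = d})"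
    by (intro finite_imageI finite_lists_length_eq) simp
qed

text \<open>A Dirichlet series whose terms are supported on the powers of \<open>p\<close> is a power series in \<open>t = p ^ (- s)\<close>. Its
  terms are obtained by grouping the given sum according to the exponent \<open>u\<close>.\<close>

lemma dirichlet_series_from_fibres:
  fixes c u :: "'j \<Rightarrow> nat" and ind :: "'b \<Rightarrow> nat" and t s Z :: complex
  assumes p: "2 \<le> p"
    and \<Phi>: "\<And>N. N \<in> \<N>' \<Longrightarrow> \<Phi> N \<in> J"
    and ind: "\<And>N. N \<in> \<N>' \<Longrightarrow> ind N = p ^ u (\<Phi> N)"
    and fib: "\<And>j. j \<in> J \<Longrightarrow> finite {N \<in> \<N>'. \<Phi> N = j} \<and> card {N \<in> \<N>'. \<Phi> N = j} = c j"
    and fin: "\<And>v. finite {j \<in> J. u j = v}"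
    and t: "\<And>v. t ^ v = of_nat (p ^ v) powr (- s)"
    and hs: "((\<lambda>j. of_nat (c j) * t ^ u j) has_sum Z) J"
  shows "(\<lambda>k. of_nat (card {N \<in> \<N>'. ind N = Suc k}) * of_nat (Suc k) powr (- s)) sums Z"
proof -
  let ?F = "\<lambda>k. of_nat (card {N \<in> \<N>'. ind N = Suc k}) * of_nat (Suc k) powr (- s) :: complex"
  \<comment> \<open>The series starts with the index \<open>1\<close>, so the index \<open>p ^ v\<close> belongs to the term \<open>p ^ v - 1\<close>.\<close>
  let ?g = "\<lambda>v. p ^ v - 1"
  have pinj: "p ^ v = p ^ w \<longleftrightarrow> v = w" for v w using p by simp
  have Sg: "Suc (?g v) = p ^ v" for v using p by simp
  have bij: "bij_betw (\<lambda>j. (u j, j)) J (SIGMA v:UNIV. {j \<in> J. u j = v})"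
    by (auto simp: bij_betw_def inj_on_def)
  have "((\<lambda>q. of_nat (c (snd q)) * t ^ u (snd q)) has_sum Z) (SIGMA v:UNIV. {j \<in> J. u j = v})"
    by (rule iffD1[OF has_sum_reindex_bij_betw[OF bij]]) (use hs in simp)
  then have "((\<lambda>v. \<Sum>j\<in>{j \<in> J. u j = v}. of_nat (c j) * t ^ u j) has_sum Z) UNIV"
  proof (rule has_sum_SigmaD)
    show "((\<lambda>j. of_nat (c (snd (v, j))) * t ^ u (snd (v, j))) has_sum
        (\<Sum>j\<in>{j \<in> J. u j = v}. of_nat (c j) * t ^ u j)) {j \<in> J. u j = v}" for v
      unfolding snd_conv by (rule has_sum_finite[OF fin])
  qed
  also have "(\<lambda>v. \<Sum>j\<in>{j \<in> J. u j = v}. of_nat (c j) * t ^ u j) = (\<lambda>v. ?F (?g v))"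
  proof
    fix v
    have "finite {N \<in> \<N>'. ind N = p ^ v} \<and> card {N \<in> \<N>'. ind N = p ^ v} = (\<Sum>j\<in>{j \<in> J. u j = v}. c j)"
    proof (rule card_by_fibres[where h = \<Phi>])
      show "\<Phi> N \<in> {j \<in> J. u j = v}" if "N \<in> {N \<in> \<N>'. ind N = p ^ v}" for N
        using that \<Phi> ind[of N] pinj by auto
      show "finite {N \<in> {N \<in> \<N>'. ind N = p ^ v}. \<Phi> N = j} \<and> card {N \<in> {N \<in> \<N>'. ind N = p ^ v}. \<Phi> N = j} = c j"
        if j: "j \<in> {j \<in> J. u j = v}" for j
      proof -
        have "{N \<in> {N \<in> \<N>'. ind N = p ^ v}. \<Phi> N = j} = {N \<in> \<N>'. \<Phi> N = j}" using j ind by auto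
        then show ?thesis using fib j by simp
      qed
    qed (rule fin)
    then have "?F (?g v) = (\<Sum>j\<in>{j \<in> J. u j = v}. of_nat (c j)) * t ^ v"
      unfolding Sg t by simp
    also have "\<dots> = (\<Sum>j\<in>{j \<in> J. u j = v}. of_nat (c j) * t ^ u j)"
      unfolding sum_distrib_right by (rule sum.cong) auto
    finally show "(\<Sum>j\<in>{j \<in> J. u j = v}. of_nat (c j) * t ^ u j) = ?F (?g v)" by simp
  qed
  finally have "((\<lambda>v. ?F (?g v)) has_sum Z) UNIV" .
  moreover have "inj ?g"
  proof (rule injI)
    fix v w assume "?g v = ?g w"
    then have "Suc (?g v) = Suc (?g w)" by simp
    then show "v = w" unfolding Sg pinj .
  qed
  ultimately have "(?F has_sum Z) (range ?g)" using has_sum_reindex[of ?g UNIV ?F Z] by (simp add: comp_def)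
  moreover have "?F k = 0" if "k \<notin> range ?g" for k
  proof -
    have "{N \<in> \<N>'. ind N = Suc k} = {}"
    proof (rule ccontr)
      assume "\<not> ?thesis"
      then obtain N where "N \<in> \<N>'" "ind N = Suc k" by blast
      then have "k = ?g (u (\<Phi> N))" using ind[of N] by simp
      then show False using that by blast
    qed
    then show ?thesis by (simp only: card.empty) simp
  qed
  ultimately have "(?F has_sum Z) UNIV"
    using has_sum_cong_neutral[of UNIV "range ?g" ?F ?F Z] by auto
  then show ?thesis by (rule has_sum_imp_sums)
qed

theorem theorem3p8:
  fixes R :: "('a, 'b) ring_scheme" and p e f n :: nat
  assumes "Factorial_Ring.prime p"
    and "finite_extension_Zp p R"
    and "has_inertia_degree R f"
    and "has_ramification_index p R e"
    and "n = e * f"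
  shows "\<exists>\<sigma> :: real. \<forall>s :: complex. \<sigma> < Re s \<longrightarrow>
    (let x = (\<lambda>i :: nat. of_nat p powr
                ((2 * of_nat n + of_nat i) * (of_nat n - of_nat i) - (3 * of_nat n - of_nat i) * s))
     in summable (normal_zeta_term (heisenberg R) (heisenberg_topology R) s) \<and>
        normal_zeta (heisenberg R) (heisenberg_topology R) s =
          zeta_Zp_power p (2 * n) s *
          ((\<Sum>w \<in> carrier (sym_group n).
              of_nat p powr
                (- of_nat (perm_length n w) +
                 2 * of_nat f * of_int \<lfloor>real (parabolic_length n (n - 2) w) / real f\<rfloor> * s) *
              (\<Prod>j \<in> descents n w. x j)) /
           (\<Prod>i \<in> {0..<n}. 1 - x i)))"
proof -
  obtain \<pi> L where e: "0 < e" and chain: "padic_chain R p (e * f) f \<pi> L"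
    and ip: "\<And>k. ideal_power R (max_ideal R) k = L (f * k)"
    using padic_chain_exists[OF assms(1-4)] by blast
  interpret padic_chain R p n f \<pi> L using chain unfolding assms(5) .
  have f: "0 < f" by (rule f_pos)
  have n: "0 < n" "n = e * f" using e f assms(5) by auto
  have p2: "2 \<le> p" using assms(1) by (rule prime_ge_2_nat)
  show ?thesis
  \<comment> \<open>This abscissa is chosen generously: \<open>(2 n + i) (n - i) \<le> 3 n (3 n - i)\<close> for \<open>i < n\<close>.\<close>
  proof (intro exI[of _ "real (3 * n)"] allI impI)
    fix s :: complex assume s: "real (3 * n) < Re s"
    define P :: complex where "P = of_nat p"
    define l :: real where "l = ln (real p)"
    define t where "t = P powr (- s)"
    have l: "l > 0" using p2 by (simp add: l_def)
    have P0: "P \<noteq> 0" using p2 by (simp add: P_def)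
    have LnP: "Ln P = of_real l" using p2 by (simp add: P_def l_def Ln_of_nat)
    have powr_exp: "P powr z = exp (z * of_real l)" for z using P0 by (simp add: powr_def LnP)
    have Pexp: "P ^ k = exp (of_nat k * of_real l)" for k
    proof -
      have "P = exp (of_real l)" using P0 LnP exp_Ln by metis
      then show ?thesis by (simp add: exp_of_nat_mult)
    qed
    have texp: "t ^ k = exp (of_nat k * (- s * of_real l))" for k
      unfolding t_def powr_exp by (rule exp_of_nat_mult[symmetric])
    have t0: "t \<noteq> 0" unfolding t_def powr_exp by simp
    have mixed: "P powr (of_nat a - of_nat b * s) = P ^ a * t ^ b" for a b
      unfolding powr_exp Pexp texp exp_add[symmetric] by (simp add: algebra_simps)
    have norm_mixed: "norm (P ^ a * t ^ b) < 1" if "real a < real b * Re s" for a b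
    proof -
      have "norm (P ^ a * t ^ b) = exp ((real a - real b * Re s) * l)"
        unfolding mixed[symmetric] powr_exp norm_exp_eq_Re by simp
      also have "\<dots> < 1" using that l by (simp add: mult_neg_pos)
      finally show ?thesis .
    qed
    define x where "x = (\<lambda>i. P ^ ((2 * n + i) * (n - i)) * t ^ (3 * n - i))"
    let ?x = "\<lambda>i :: nat. of_nat p powr
                ((2 * of_nat n + of_nat i) * (of_nat n - of_nat i) - (3 * of_nat n - of_nat i) * s)"
    have x_eq: "?x i = x i" if "i < n" for i
    proof -
      have *: "(2 * of_nat n + of_nat i) * (of_nat n - of_nat i) = (of_nat ((2 * n + i) * (n - i)) :: complex)"
        "3 * of_nat n - of_nat i = (of_nat (3 * n - i) :: complex)"
        using that by (simp_all add: of_nat_diff)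
      show ?thesis unfolding x_def mixed[symmetric] * by (simp only: P_def)
    qed
    have x_less: "norm (x i) < 1" if "i < n" for i
      unfolding x_def
    proof (rule norm_mixed)
      have "(2 * n + i) * (n - i) \<le> (3 * n) * n" using that by (intro mult_le_mono) auto
      also have "\<dots> \<le> (3 * n - i) * (3 * n)" using that by (simp add: mult.commute[of "3 * n"])
      finally have "real ((2 * n + i) * (n - i)) \<le> real (3 * n - i) * real (3 * n)"
        unfolding of_nat_mult[symmetric] of_nat_le_iff .
      also have "\<dots> < real (3 * n - i) * Re s" using that s by (intro mult_strict_left_mono) auto
      finally show "real ((2 * n + i) * (n - i)) < real (3 * n - i) * Re s" .
    qed
    have z_less: "norm (P ^ i * t) < 1" if "i < 2 * n" for i
      using norm_mixed[of i 1] that s by simp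
    let ?num = "\<Sum>w | w permutes {1..n}. (1 / P) ^ perm_length n w * (1 / t) ^ (2 * f * ((n - w n) div f)) *
         (\<Prod>j\<in>descents n w. x j)"
    let ?Z = "(\<Prod>i<2 * n. 1 / (1 - P ^ i * t)) * (?num * (\<Prod>i<n. 1 / (1 - x i)))"
    have hs1: "((\<lambda>S. P ^ gap_weight (2 * n) S * t ^ card S) has_sum (\<Prod>i<2 * n. 1 / (1 - P ^ i * t)))
        {S. flush_set (2 * n) S}"
    proof (rule iffD1[OF has_sum_reindex_bij_betw[OF bij_betw_runner_gaps]])
      show "0 < 2 * n" using n by simp
      have "((\<lambda>ms. P ^ inv_weight ms * t ^ sum_list ms) has_sum (\<Prod>i<2 * n. 1 / (1 - P ^ i * t))) {ms. length ms = 2 * n}"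
        by (rule has_sum_inv_weight) (use z_less in simp)
      then show "((\<lambda>ms. P ^ gap_weight (2 * n) (runner_gaps ms) * t ^ card (runner_gaps ms)) has_sum
          (\<Prod>i<2 * n. 1 / (1 - P ^ i * t))) {ms. length ms = 2 * n}"
      proof (rule has_sum_cong[THEN iffD1, rotated])
        fix ms :: "nat list" assume "ms \<in> {ms. length ms = 2 * n}"
        then have len: "length ms = 2 * n" by simp
        have "gap_weight (2 * n) (runner_gaps ms) = inv_weight ms"
          using gap_weight_runner_gaps[of ms] len n by simp
        then show "P ^ inv_weight ms * t ^ sum_list ms = P ^ gap_weight (2 * n) (runner_gaps ms) * t ^ card (runner_gaps ms)"
          by (simp add: card_runner_gaps)
      qed
    qed
    have hs2: "((\<lambda>S. P ^ (gap_weight n S + 2 * n * card S) * t ^ (card S + 2 * f * conductor f S)) has_sum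
        (?num * (\<Prod>i<n. 1 / (1 - x i)))) {S. flush_set n S}"
    proof (rule iffD1[OF has_sum_reindex_bij_betw[OF bij_betw_runner_gaps[OF n(1)]]])
      have "((\<lambda>ms. P ^ (inv_weight ms + 2 * n * sum_list ms) *
          t ^ (sum_list ms + 2 * f * conductor f (runner_gaps ms))) has_sum (?num * (\<Prod>i<n. 1 / (1 - x i)))) {ms. length ms = n}"
        by (rule has_sum_permutation_formula[OF n(2,1) P0 t0]) (use x_less in \<open>simp_all add: x_def\<close>)
      then show "((\<lambda>ms. P ^ (gap_weight n (runner_gaps ms) + 2 * n * card (runner_gaps ms)) *
          t ^ (card (runner_gaps ms) + 2 * f * conductor f (runner_gaps ms))) has_sum
          (?num * (\<Prod>i<n. 1 / (1 - x i)))) {ms. length ms = n}"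
      proof (rule has_sum_cong[THEN iffD1, rotated])
        fix ms :: "nat list" assume "ms \<in> {ms. length ms = n}"
        then have len: "length ms = n" by simp
        have "gap_weight n (runner_gaps ms) = inv_weight ms"
          using gap_weight_runner_gaps[of ms] len n by simp
        then show "P ^ (inv_weight ms + 2 * n * sum_list ms) * t ^ (sum_list ms + 2 * f * conductor f (runner_gaps ms)) =
          P ^ (gap_weight n (runner_gaps ms) + 2 * n * card (runner_gaps ms)) *
          t ^ (card (runner_gaps ms) + 2 * f * conductor f (runner_gaps ms))"
          by (simp add: card_runner_gaps)
      qed
    qed
    let ?J = "{S. flush_set (2 * n) S} \<times> {S. flush_set n S}"
    let ?u = "\<lambda>q :: nat set \<times> nat set. card (fst q) + (card (snd q) + 2 * f * conductor f (snd q))"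
    let ?c = "\<lambda>q :: nat set \<times> nat set. p ^ (gap_weight (2 * n) (fst q) + (gap_weight n (snd q) + 2 * n * card (snd q)))"
    have hs: "((\<lambda>q. of_nat (?c q) * t ^ ?u q) has_sum ?Z) ?J"
    proof -
      have "((\<lambda>(S1, S2). (P ^ gap_weight (2 * n) S1 * t ^ card S1) *
          (P ^ (gap_weight n S2 + 2 * n * card S2) * t ^ (card S2 + 2 * f * conductor f S2))) has_sum ?Z) ?J"
        by (rule has_sum_times[OF hs1 hs2])
      then show ?thesis
        by (rule has_sum_cong[THEN iffD1, rotated]) (auto simp: P_def power_add)
    qed
    have "(\<lambda>k. of_nat (card {N \<in> open_normal. card (rcosets\<^bsub>heisenberg R\<^esub> N) = Suc k}) * of_nat (Suc k) powr (- s)) sums ?Z"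
    proof (rule dirichlet_series_from_fibres[OF p2 open_normal_fibres(1)[OF ip] open_normal_fibres(2)[OF ip] _ _ _ hs])
      fix q assume "q \<in> ?J"
      then show "finite {N \<in> open_normal. gap_pair N = q} \<and> card {N \<in> open_normal. gap_pair N = q} = ?c q"
        using open_normal_fibres(3)[OF ip, of "fst q" "snd q"] by auto
    next
      fix v
      have "{q \<in> ?J. ?u q = v} \<subseteq> {S. flush_set (2 * n) S \<and> card S \<le> v} \<times> {S. flush_set n S \<and> card S \<le> v}" by auto
      moreover have "finite ({S. flush_set (2 * n) S \<and> card S \<le> v} \<times> {S. flush_set n S \<and> card S \<le> v})"
        using n(1) by (intro finite_cartesian_product finite_flush_sets_card_le) auto
      ultimately show "finite {q \<in> ?J. ?u q = v}" by (rule finite_subset)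
    next
      fix v
      have "complex_of_nat (p ^ v) powr (- s) = exp (- s * Ln (P ^ v))"
        using P0 by (simp add: powr_def P_def)
      also have "Ln (P ^ v) = of_nat v * of_real l"
      proof -
        have "Ln (of_nat (p ^ v)) = complex_of_real (ln (real (p ^ v)))" using p2 by (intro Ln_of_nat) simp
        then have "Ln (P ^ v) = of_real (ln (real p ^ v))" by (simp add: P_def)
        then show ?thesis using p2 by (simp add: l_def ln_realpow)
      qed
      finally show "t ^ v = complex_of_nat (p ^ v) powr (- s)" unfolding texp by (simp add: algebra_simps)
    qed
    moreover have "(\<lambda>k. of_nat (card {N \<in> open_normal. card (rcosets\<^bsub>heisenberg R\<^esub> N) = Suc k}) * of_nat (Suc k) powr (- s)) =
        normal_zeta_term (heisenberg R) (heisenberg_topology R) s"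
      by (simp add: fun_eq_iff normal_zeta_term_def num_open_normal_def open_normal_def conj_assoc)
    ultimately have sums: "normal_zeta_term (heisenberg R) (heisenberg_topology R) s sums ?Z" by simp
    have zeta_eq: "zeta_Zp_power p (2 * n) s = (\<Prod>i<2 * n. 1 / (1 - P ^ i * t))"
    proof -
      have "P powr (of_nat i - s) = P ^ i * t" for i using mixed[of i 1] by simp
      then show ?thesis by (simp add: zeta_Zp_power_def P_def[symmetric] inverse_eq_divide)
    qed
    have "?num = (\<Sum>w \<in> carrier (sym_group n).
              of_nat p powr
                (- of_nat (perm_length n w) +
                 2 * of_nat f * of_int \<lfloor>real (parabolic_length n (n - 2) w) / real f\<rfloor> * s) *
              (\<Prod>j \<in> descents n w. ?x j))"
    proof (rule sum.cong)
      show "{w. w permutes {1..n}} = carrier (sym_group n)" by (auto simp: sym_group_carrier)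
      fix w assume "w \<in> carrier (sym_group n)"
      then have w: "w permutes {1..n}" by (simp add: sym_group_carrier)
      let ?m = "2 * f * ((n - w n) div f)"
      have pl: "parabolic_length n (n - 2) w = n - w n" using parabolic_length_eq_last[OF w] n(1) by simp
      have floor: "2 * of_nat f * of_int \<lfloor>real (n - w n) / real f\<rfloor> = (of_nat ?m :: complex)"
        by (simp add: floor_divide_of_nat_eq)
      have "of_nat p powr (- of_nat (perm_length n w) +
          2 * of_nat f * of_int \<lfloor>real (parabolic_length n (n - 2) w) / real f\<rfloor> * s) =
          P powr (- of_nat (perm_length n w) + of_nat ?m * s)"
        unfolding pl P_def floor ..
      also have "\<dots> = inverse (P ^ perm_length n w) * inverse (t ^ ?m)"
        unfolding powr_exp Pexp texp exp_minus[symmetric] exp_add[symmetric] by (simp add: algebra_simps)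
      also have "\<dots> = (1 / P) ^ perm_length n w * (1 / t) ^ ?m"
        by (simp add: power_one_over inverse_eq_divide)
      finally have *: "of_nat p powr (- of_nat (perm_length n w) +
          2 * of_nat f * of_int \<lfloor>real (parabolic_length n (n - 2) w) / real f\<rfloor> * s) =
          (1 / P) ^ perm_length n w * (1 / t) ^ ?m" .
      have "(\<Prod>j\<in>descents n w. ?x j) = (\<Prod>j\<in>descents n w. x j)"
        by (rule prod.cong) (use x_eq descents_iff[OF w] in auto)
      then show "(1 / P) ^ perm_length n w * (1 / t) ^ ?m * (\<Prod>j\<in>descents n w. x j) =
          of_nat p powr (- of_nat (perm_length n w) +
          2 * of_nat f * of_int \<lfloor>real (parabolic_length n (n - 2) w) / real f\<rfloor> * s) * (\<Prod>j\<in>descents n w. ?x j)"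
        unfolding * by simp
    qed
    moreover have "(\<Prod>i \<in> {0..<n}. 1 - ?x i) = (\<Prod>i<n. 1 - x i)"
      unfolding atLeast0LessThan by (rule prod.cong) (use x_eq in auto)
    moreover have "(\<Prod>i<n. 1 / (1 - x i)) = 1 / (\<Prod>i<n. 1 - x i)" by (simp add: prod_dividef)
    ultimately have Z_eq: "?Z = zeta_Zp_power p (2 * n) s *
          ((\<Sum>w \<in> carrier (sym_group n).
              of_nat p powr
                (- of_nat (perm_length n w) +
                 2 * of_nat f * of_int \<lfloor>real (parabolic_length n (n - 2) w) / real f\<rfloor> * s) *
              (\<Prod>j \<in> descents n w. ?x j)) /
           (\<Prod>i \<in> {0..<n}. 1 - ?x i))"
      unfolding zeta_eq by simp
    show "let x = ?x
     in summable (normal_zeta_term (heisenberg R) (heisenberg_topology R) s) \<and>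
        normal_zeta (heisenberg R) (heisenberg_topology R) s =
          zeta_Zp_power p (2 * n) s *
          ((\<Sum>w \<in> carrier (sym_group n).
              of_nat p powr
                (- of_nat (perm_length n w) +
                 2 * of_nat f * of_int \<lfloor>real (parabolic_length n (n - 2) w) / real f\<rfloor> * s) *
              (\<Prod>j \<in> descents n w. x j)) /
           (\<Prod>i \<in> {0..<n}. 1 - x i))"
      unfolding Let_def normal_zeta_def
      using sums_summable[OF sums] sums_unique[OF sums] Z_eq by simp
  qed
qed

end
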